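(* Let $n\ge1$ be an integer, $\gamma>0$, $\alpha>-1$, $1<q<\infty$ and $1<p<\infty$. Let $E=L^q(\mathbb{B}_n,\chi_{D(0,\gamma)}\,d\tau)$, and let $T_{\mathrm{tent}}$ be the operator $$[T_{\mathrm{tent}}f(z)](w)=\int_{\mathbb{B}_n}\frac{f(u)\,dv_\alpha(u)}{(1-\langle\varphi_z(w),u\rangle)^{n+1+\alpha}},\qquad z,w\in\mathbb{B}_n,$$ with $E$-valued kernel $K_{\mathrm{tent}}(z,u)(w)=(1-\langle\varphi_z(w),u\rangle)^{-(n+1+\alpha)}$. Then $T_{\mathrm{tent}}\in\mathrm{BIO}_\alpha(E)$. Consequently, there is a constant $C>0$ independent of $f$ such that $$\|A^{(q)}_\gamma(f)\|_{L^p_\alpha}\le C\,\|f\|_{L^p_\alpha}\qquad\text{for all } f\in\mathcal{A}^p_\alpha .$$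
   Context: $\mathbb{B}_n$ is the open unit ball of $\mathbb{C}^n$ and $\langle z,w\rangle=\sum_j z_j\overline{w_j}$. $dv$ is Lebesgue measure on $\mathbb{B}_n$ normalized to have total mass $1$; for $\alpha>-1$, $dv_\alpha(z)=c_\alpha(1-|z|^2)^\alpha dv(z)$ with $c_\alpha=\Gamma(n+\alpha+1)/[n!\,\Gamma(\alpha+1)]$. The invariant measure is $d\tau(z)=(1-|z|^2)^{-(n+1)}dv(z)$. $L^p_\alpha=L^p(\mathbb{B}_n,dv_\alpha)$, and $\mathcal{A}^p_\alpha$ is the space of holomorphic functions on $\mathbb{B}_n$ belonging to $L^p_\alpha$. $\varphi_z$ is the standard involutive automorphism of $\mathbb{B}_n$ with $\varphi_z(0)=z$, $\varphi_z(z)=0$, $\varphi_z\circ\varphi_z=\mathrm{id}$; explicitly $\varphi_0(w)=-w$ and, for $z\ne0$, $\varphi_z(w)=\frac{z-P_z w-\sqrt{1-|z|^2}\,(w-P_zw)}{1-\langle w,z\rangle}$ with $P_z w=\frac{\langle w,z\rangle}{|z|^2}z$. The Bergman metric is $\beta(z,w)=\frac12\log\frac{1+|\varphi_z(w)|}{1-|\varphi_z(w)|}$ and $D(z,\gamma)=\{w\in\mathbb{B}_n:\beta(z,w)<\gamma\}$. For $1<q<\infty$, $$A^{(q)}_\gamma(f)(z)=\left(\int_{D(z,\gamma)}|f(w)|^q\,d\tau(w)\right)^{1/q}.$$ The function $\varrho$ on $\mathbb{B}_n\times\mathbb{B}_n$ is $\varrho(z,w)=\big||z|-|w|\big|+\big|1-\frac{1}{|z||w|}\langle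 z,w\rangle\big|$ if $z,w\in\mathbb{B}_n\setminus\{0\}$, and $\varrho(z,w)=|z|+|w|$ otherwise. Definition of $\mathrm{BIO}_\alpha(E)$: for a Banach space $E$ and $\alpha>-1$, an $\alpha$-time Bergman singular integral operator is an operator $Tf(z)=\int_{\mathbb{B}_n}K(z,w)f(w)\,dv_\alpha(w)$ whose kernel $K:\{(z,w)\in\mathbb{B}_n\times\mathbb{B}_n: z\ne w\}\to E$ is continuous and satisfies, for some constants $C>0$, $\delta>0$ and $0<\beta\le1$ (here $\beta$ denotes an exponent), $$\|K(z,w)\|_E\le\frac{C}{\varrho(z,w)^{n+1+\alpha}}\quad\text{for all } z\neq w \text{ in } \mathbb{B}_n,$$ $$\|K(z,w)-K(z,\zeta)\|_E+\|K(w,z)-K(\zeta,z)\|_E\le\frac{C\,\varrho(w,\zeta)^\beta}{\varrho(z,\zeta)^{n+1+\alpha+\beta}}$$ for all $z,w,\zeta\in\mathbb{B}_n$ with $\varrho(z,\zeta)\ge\delta\,\varrho(w,\zeta)$. $\mathrm{BIO}_\alpha(E)$ is the set of all such $T$ that are bounded from $L^p_\alpha$ into the Bochner space $L^p(\mathbb{B}_n,v_\alpha;E)$ for every $1<p<\infty$. *)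

theory Defs
  imports "HOL-Analysis.Analysis" "HOL-Algebra.Module"
begin

section \<open>Complex Banach spaces given by a carrier\<close>

text \<open>
  \<open>L\<^sup>q(\<mu>)\<close> depends on the real number \<open>q\<close> and on the measure \<open>\<mu>\<close>, so it cannot be an instance of
  the class \<^class>\<open>banach\<close>.  Banach spaces are therefore modules over the field of complex numbers
  in the sense of \<^theory>\<open>HOL-Algebra.Module\<close>, together with a norm.  As usual for modules, the
  fields \<^const>\<open>mult\<close> and \<^const>\<open>one\<close> of such a record play no role.
\<close>

definition complex_ring :: "complex ring" where
  "complex_ring = \<lparr>carrier = UNIV, mult = (*), one = 1, zero = 0, add = (+)\<rparr>"

record 'e normed_module = "(complex, 'e) module" +
  nrm :: "'e \<Rightarrow> real"

locale complex_banach_space = module complex_ring E for E :: "'e normed_module" (structure) +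
  assumes nrm_eq_0_iff: "x \<in> carrier E \<Longrightarrow> nrm E x = 0 \<longleftrightarrow> x = \<zero>\<^bsub>E\<^esub>"
    and nrm_triangle: "x \<in> carrier E \<Longrightarrow> y \<in> carrier E \<Longrightarrow> nrm E (x \<oplus>\<^bsub>E\<^esub> y) \<le> nrm E x + nrm E y"
    and nrm_smult: "x \<in> carrier E \<Longrightarrow> nrm E (c \<odot>\<^bsub>E\<^esub> x) = cmod c * nrm E x"
    and complete: "(\<And>k. X k \<in> carrier E) \<Longrightarrow>
      (\<And>e. e > 0 \<Longrightarrow> \<exists>N. \<forall>i\<ge>N. \<forall>j\<ge>N. nrm E (X i \<ominus>\<^bsub>E\<^esub> X j) < e) \<Longrightarrow>
      \<exists>x\<in>carrier E. (\<lambda>k. nrm E (X k \<ominus>\<^bsub>E\<^esub> x)) \<longlonglongrightarrow> 0"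


subsection \<open>The Bochner integral\<close>

text \<open>
  The construction is that of \<^theory>\<open>HOL-Analysis.Bochner_Integration\<close>, with Borel measurability
  replaced by strong measurability (almost everywhere limit of simple functions).  Values on a null
  set are irrelevant and need not even lie in the carrier; this matters because the kernels below
  are not defined on the diagonal.
\<close>

definition simple_into :: "'a measure \<Rightarrow> 'e normed_module \<Rightarrow> ('a \<Rightarrow> 'e) \<Rightarrow> bool" where
  "simple_into M E s \<longleftrightarrow> simple_function M s \<and> s ` space M \<subseteq> carrier E"

definition strongly_measurable :: "'a measure \<Rightarrow> 'e normed_module \<Rightarrow> ('a \<Rightarrow> 'e) \<Rightarrow> bool" where
  "strongly_measurable M E g \<longleftrightarrow>
     (\<exists>s. (\<forall>k. simple_into M E (s k)) \<and>
       (AE x in M. g x \<in> carrier E \<and> (\<lambda>k. nrm E (s k x \<ominus>\<^bsub>E\<^esub> g x)) \<longlonglongrightarrow> 0))"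

definition simple_integral_into :: "'a measure \<Rightarrow> 'e normed_module \<Rightarrow> ('a \<Rightarrow> 'e) \<Rightarrow> 'e" where
  "simple_integral_into M E s =
     (\<Oplus>\<^bsub>E\<^esub>y\<in>s ` space M. complex_of_real (measure M {x \<in> space M. s x = y}) \<odot>\<^bsub>E\<^esub> y)"

definition has_integral_into :: "'a measure \<Rightarrow> 'e normed_module \<Rightarrow> ('a \<Rightarrow> 'e) \<Rightarrow> 'e \<Rightarrow> bool" where
  "has_integral_into M E g y \<longleftrightarrow>
     y \<in> carrier E \<and> strongly_measurable M E g \<and>
     (\<exists>s. (\<forall>k. simple_into M E (s k) \<and> emeasure M {x \<in> space M. s k x \<noteq> \<zero>\<^bsub>E\<^esub>} < \<infinity>) \<and>
       (\<lambda>k. \<integral>\<^sup>+ x. ennreal (nrm E (g x \<ominus>\<^bsub>E\<^esub> s k x)) \<partial>M) \<longlonglongrightarrow> 0 \<and>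
       (\<lambda>k. nrm E (simple_integral_into M E (s k) \<ominus>\<^bsub>E\<^esub> y)) \<longlonglongrightarrow> 0)"

definition Bochner_Lp :: "'a measure \<Rightarrow> real \<Rightarrow> 'e normed_module \<Rightarrow> ('a \<Rightarrow> 'e) set" where
  "Bochner_Lp M p E =
     {g. strongly_measurable M E g \<and> (\<integral>\<^sup>+ x. ennreal (nrm E (g x) powr p) \<partial>M) < \<infinity>}"

definition Bochner_Lp_norm :: "'a measure \<Rightarrow> real \<Rightarrow> 'e normed_module \<Rightarrow> ('a \<Rightarrow> 'e) \<Rightarrow> real" where
  "Bochner_Lp_norm M p E g = enn2real (\<integral>\<^sup>+ x. ennreal (nrm E (g x) powr p) \<partial>M) powr (1 / p)"


section \<open>Lebesgue spaces\<close>

definition Lp_fun :: "'a measure \<Rightarrow> real \<Rightarrow> ('a \<Rightarrow> 'b::real_normed_vector) set" where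
  "Lp_fun M p = {f \<in> borel_measurable M. integrable M (\<lambda>x. norm (f x) powr p)}"

definition Lp_norm :: "'a measure \<Rightarrow> real \<Rightarrow> ('a \<Rightarrow> 'b::real_normed_vector) \<Rightarrow> real" where
  "Lp_norm M p f = (\<integral>x. norm (f x) powr p \<partial>M) powr (1 / p)"

text \<open>
  The Banach space of equivalence classes modulo equality almost everywhere.  Note that
  \<open>Lp_class M p f\<close> is empty, hence outside the carrier, unless \<open>f\<close> is almost everywhere equal to
  an element of \<open>Lp_fun M p\<close>.
\<close>

definition Lp_class :: "'a measure \<Rightarrow> real \<Rightarrow> ('a \<Rightarrow> complex) \<Rightarrow> ('a \<Rightarrow> complex) set" where
  "Lp_class M p f = {g \<in> Lp_fun M p. AE x in M. g x = f x}"

definition Lp_rep :: "('a \<Rightarrow> complex) set \<Rightarrow> 'a \<Rightarrow> complex" where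
  "Lp_rep A = (SOME f. f \<in> A)"

definition Lp_space :: "'a measure \<Rightarrow> real \<Rightarrow> ('a \<Rightarrow> complex) set normed_module" where
  "Lp_space M p =
     \<lparr>carrier = Lp_class M p ` Lp_fun M p,
      mult = (\<lambda>_ _. undefined),
      one = undefined,
      zero = Lp_class M p (\<lambda>_. 0),
      add = (\<lambda>A B. Lp_class M p (\<lambda>x. Lp_rep A x + Lp_rep B x)),
      smult = (\<lambda>c A. Lp_class M p (\<lambda>x. c * Lp_rep A x)),
      nrm = (\<lambda>A. Lp_norm M p (Lp_rep A))\<rparr>"


subsection \<open>Completeness\<close>

lemma Lp_funI: "f \<in> borel_measurable M \<Longrightarrow> integrable M (\<lambda>x. norm (f x) powr p) \<Longrightarrow> f \<in> Lp_fun M p"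
  by (simp add: Lp_fun_def)

lemma Lp_fun_measurable: "f \<in> Lp_fun M p \<Longrightarrow> f \<in> borel_measurable M"
  and Lp_fun_integrable: "f \<in> Lp_fun M p \<Longrightarrow> integrable M (\<lambda>x. norm (f x) powr p)"
  by (simp_all add: Lp_fun_def)

lemma Lp_norm_nonneg: "Lp_norm M p f \<ge> 0"
  by (simp add: Lp_norm_def)

lemma Lp_norm_powr: "p > 0 \<Longrightarrow> Lp_norm M p f powr p = (\<integral>x. norm (f x) powr p \<partial>M)"
  by (simp add: Lp_norm_def powr_powr)

lemma Lp_norm_cong_AE:
  assumes "f \<in> borel_measurable M" "g \<in> borel_measurable M" "AE x in M. f x = g x"
  shows "Lp_norm M p f = Lp_norm M p g"
proof -
  have "(\<integral>x. norm (f x) powr p \<partial>M) = (\<integral>x. norm (g x) powr p \<partial>M)"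
    using assms by (intro integral_cong_AE) (auto simp: )
  then show ?thesis by (simp add: Lp_norm_def)
qed

lemma powr_convex_nonneg:
  fixes x y t p :: real
  assumes "x \<ge> 0" "y \<ge> 0" "0 \<le> t" "t \<le> 1" "p \<ge> 1"
  shows "((1 - t) * x + t * y) powr p \<le> (1 - t) * x powr p + t * y powr p"
proof -
  have aux: "(s * u) powr p \<le> s * u powr p" if "0 \<le> s" "s \<le> 1" "u \<ge> 0" for s u :: real
  proof -
    have "s powr p \<le> s"
      using that assms powr_mono'[of 1 p s] by (cases "s = 0") auto
    then show ?thesis using that by (simp add: powr_mult mult_right_mono)
  qed
  show ?thesis
  proof (cases "x = 0 \<or> y = 0")
    case True
    then show ?thesis using assms aux[of t y] aux[of "1 - t" x] by auto
  next
    case False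
    then show ?thesis
      using convex_onD[OF powr_convex[OF assms(5)], of t x y] assms by auto
  qed
qed

lemma norm_add_powr_le:
  assumes "p \<ge> 1" "a > 0" "b > 0"
  shows "norm (u + v) powr p \<le>
    (a + b) powr p * (a / (a + b) * (norm u powr p / a powr p) + b / (a + b) * (norm v powr p / b powr p))"
proof -
  have e: "1 - b / (a + b) = a / (a + b)"
    using assms by (simp add: field_simps)
  have "(a + b) * ((1 - b / (a + b)) * (norm u / a) + b / (a + b) * (norm v / b)) = norm u + norm v"
    unfolding e using assms by (simp add: distrib_left)
  then have "norm (u + v) \<le> (a + b) * ((1 - b / (a + b)) * (norm u / a) + b / (a + b) * (norm v / b))"
    using norm_triangle_ineq[of u v] by simp
  then have "norm (u + v) powr p \<le> ((a + b) * ((1 - b / (a + b)) * (norm u / a) + b / (a + b) * (norm v / b))) powr p"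
    using assms by (intro powr_mono2) auto
  also have "\<dots> = (a + b) powr p * ((1 - b / (a + b)) * (norm u / a) + b / (a + b) * (norm v / b)) powr p"
    using assms by (intro powr_mult)
  also have "\<dots> \<le> (a + b) powr p * ((1 - b / (a + b)) * (norm u / a) powr p + b / (a + b) * (norm v / b) powr p)"
    using assms by (intro mult_left_mono powr_convex_nonneg) auto
  finally show ?thesis unfolding e using assms by (simp add: powr_divide)
qed

lemma Lp_fun_add:
  fixes f g :: "'a \<Rightarrow> complex"
  assumes "p \<ge> 1" "f \<in> Lp_fun M p" "g \<in> Lp_fun M p"
  shows "(\<lambda>x. f x + g x) \<in> Lp_fun M p"
proof (rule Lp_funI)
  note [measurable] = assms(2,3)[THEN Lp_fun_measurable]
  show "(\<lambda>x. f x + g x) \<in> borel_measurable M" by measurable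
  show "integrable M (\<lambda>x. norm (f x + g x) powr p)"
  proof (rule Bochner_Integration.integrable_bound)
    show "integrable M (\<lambda>x. (1 + 1) powr p * (1 / (1 + 1) * (norm (f x) powr p / 1 powr p) + 1 / (1 + 1) * (norm (g x) powr p / 1 powr p)))"
      using assms(2,3)[THEN Lp_fun_integrable] by simp
    show "AE x in M. norm (norm (f x + g x) powr p) \<le> norm ((1 + 1) powr p * (1 / (1 + 1) * (norm (f x) powr p / 1 powr p) + 1 / (1 + 1) * (norm (g x) powr p / 1 powr p)))"
      using norm_add_powr_le[of p 1 1] assms(1) by (auto simp del: powr_one_eq_one intro!: AE_I2)
  qed measurable
qed

lemma Lp_fun_cmult:
  fixes f :: "'a \<Rightarrow> complex"
  assumes "f \<in> Lp_fun M p"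
  shows "(\<lambda>x. c * f x) \<in> Lp_fun M p"
proof (rule Lp_funI)
  note [measurable] = assms[THEN Lp_fun_measurable]
  show "(\<lambda>x. c * f x) \<in> borel_measurable M" by measurable
  show "integrable M (\<lambda>x. norm (c * f x) powr p)"
    using Lp_fun_integrable[OF assms] by (simp add: norm_mult powr_mult)
qed

lemma Lp_norm_cmult:
  fixes f :: "'a \<Rightarrow> complex"
  assumes "p > 0"
  shows "Lp_norm M p (\<lambda>x. c * f x) = cmod c * Lp_norm M p f"
  using assms by (simp add: Lp_norm_def norm_mult powr_mult powr_powr)

lemma Lp_fun_zero: "p > 0 \<Longrightarrow> (\<lambda>_. 0) \<in> Lp_fun M p"
  by (simp add: Lp_fun_def)

lemma Lp_fun_diff:
  fixes f g :: "'a \<Rightarrow> complex"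
  assumes "p \<ge> 1" "f \<in> Lp_fun M p" "g \<in> Lp_fun M p"
  shows "(\<lambda>x. f x - g x) \<in> Lp_fun M p"
  using Lp_fun_add[OF assms(1,2) Lp_fun_cmult[OF assms(3), of "-1"]] by simp

lemma Lp_norm_eq_0_iff:
  assumes "p > 0" "f \<in> Lp_fun M p"
  shows "Lp_norm M p f = 0 \<longleftrightarrow> (AE x in M. f x = 0)"
  using assms integral_nonneg_eq_0_iff_AE[OF Lp_fun_integrable[OF assms(2)]] by (simp add: Lp_norm_def)

lemma Lp_norm_triangle:
  fixes f g :: "'a \<Rightarrow> complex"
  assumes p: "p \<ge> 1" and f: "f \<in> Lp_fun M p" and g: "g \<in> Lp_fun M p"
  shows "Lp_norm M p (\<lambda>x. f x + g x) \<le> Lp_norm M p f + Lp_norm M p g"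
proof -
  note [measurable] = f[THEN Lp_fun_measurable] g[THEN Lp_fun_measurable]
  define a b where "a = Lp_norm M p f" and "b = Lp_norm M p g"
  have ap: "(\<integral>x. norm (f x) powr p \<partial>M) = a powr p" and bp: "(\<integral>x. norm (g x) powr p \<partial>M) = b powr p"
    using p by (simp_all add: a_def b_def Lp_norm_powr)
  consider "a = 0" | "b = 0" | "a > 0" "b > 0"
    using Lp_norm_nonneg[of M p f] Lp_norm_nonneg[of M p g] unfolding a_def b_def by linarith
  then show ?thesis
  proof cases
    case 1
    then have "AE x in M. f x = 0" using Lp_norm_eq_0_iff[OF _ f] p a_def by auto
    then have "Lp_norm M p (\<lambda>x. f x + g x) = Lp_norm M p g"
      by (intro Lp_norm_cong_AE) auto
    then show ?thesis using 1 a_def by simp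
  next
    case 2
    then have "AE x in M. g x = 0" using Lp_norm_eq_0_iff[OF _ g] p b_def by auto
    then have "Lp_norm M p (\<lambda>x. f x + g x) = Lp_norm M p f"
      by (intro Lp_norm_cong_AE) auto
    then show ?thesis using 2 b_def by simp
  next
    case 3
    let ?h = "\<lambda>x. (a + b) powr p * (a / (a + b) * (norm (f x) powr p / a powr p) + b / (a + b) * (norm (g x) powr p / b powr p))"
    have "(\<integral>x. norm (f x + g x) powr p \<partial>M) \<le> (\<integral>x. ?h x \<partial>M)"
      using f g p 3 Lp_fun_add[OF p f g, THEN Lp_fun_integrable]
      by (intro integral_mono norm_add_powr_le) (auto intro!: integrable_mult_right integrable_add integrable_divide Lp_fun_integrable)
    also have "\<dots> = (a + b) powr p * (a / (a + b) * (a powr p / a powr p) + b / (a + b) * (b powr p / b powr p))"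
      using f[THEN Lp_fun_integrable] g[THEN Lp_fun_integrable] by (simp add: ap bp)
    also have "\<dots> = (a + b) powr p"
      using 3 by (simp add: add_divide_distrib[symmetric])
    finally have "Lp_norm M p (\<lambda>x. f x + g x) \<le> ((a + b) powr p) powr (1 / p)"
      unfolding Lp_norm_def using p by (intro powr_mono2) auto
    then show ?thesis using 3 p by (simp add: powr_powr a_def b_def)
  qed
qed

lemma Lp_norm_sum:
  fixes f :: "nat \<Rightarrow> 'a \<Rightarrow> complex"
  assumes "p \<ge> 1" "\<And>i. f i \<in> Lp_fun M p"
  shows "(\<lambda>x. \<Sum>i<n. f i x) \<in> Lp_fun M p \<and> Lp_norm M p (\<lambda>x. \<Sum>i<n. f i x) \<le> (\<Sum>i<n. Lp_norm M p (f i))"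
proof (induction n)
  case 0 then show ?case using assms(1) by (simp add: Lp_fun_zero Lp_norm_def)
next
  case (Suc n)
  then show ?case
    using Lp_fun_add[OF assms(1) _ assms(2)[of n], of "\<lambda>x. \<Sum>i<n. f i x"]
      Lp_norm_triangle[OF assms(1) _ assms(2)[of n], of "\<lambda>x. \<Sum>i<n. f i x"] by auto
qed

lemma Lp_norm_diff_triangle:
  fixes f g h :: "'a \<Rightarrow> complex"
  assumes "p \<ge> 1" "f \<in> Lp_fun M p" "g \<in> Lp_fun M p" "h \<in> Lp_fun M p"
  shows "Lp_norm M p (\<lambda>x. f x - h x) \<le> Lp_norm M p (\<lambda>x. f x - g x) + Lp_norm M p (\<lambda>x. g x - h x)"
  using Lp_norm_triangle[OF assms(1) Lp_fun_diff[OF assms(1-3)] Lp_fun_diff[OF assms(1,3,4)]] by simp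

lemma nn_integral_Lp_norm:
  assumes "p > 0" "f \<in> Lp_fun M p"
  shows "(\<integral>\<^sup>+ x. ennreal (norm (f x) powr p) \<partial>M) = ennreal (Lp_norm M p f powr p)"
  using nn_integral_eq_integral[OF Lp_fun_integrable[OF assms(2)]] assms by (simp add: Lp_norm_powr)

lemma Lp_fatou:
  fixes f :: "nat \<Rightarrow> 'a \<Rightarrow> complex"
  assumes p: "p \<ge> 1" and f: "\<And>i. f i \<in> Lp_fun M p" and g: "g \<in> borel_measurable M"
    and lim: "AE x in M. (\<lambda>i. f i x) \<longlonglongrightarrow> g x" and bd: "\<And>i. i \<ge> n \<Longrightarrow> Lp_norm M p (f i) \<le> e"
  shows "g \<in> Lp_fun M p \<and> Lp_norm M p g \<le> e"
proof -
  note [measurable] = f[THEN Lp_fun_measurable] g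
  have e: "e \<ge> 0" using bd[of n] Lp_norm_nonneg[of M p "f n"] by simp
  have "(\<integral>\<^sup>+ x. ennreal (norm (g x) powr p) \<partial>M) = (\<integral>\<^sup>+ x. liminf (\<lambda>i. ennreal (norm (f i x) powr p)) \<partial>M)"
  proof (rule nn_integral_cong_AE, use lim in eventually_elim)
    case (elim x)
    then have "(\<lambda>i. ennreal (norm (f i x) powr p)) \<longlonglongrightarrow> ennreal (norm (g x) powr p)"
      using p by (intro tendsto_ennrealI tendsto_powr' tendsto_norm) auto
    then show ?case by (intro lim_imp_Liminf[symmetric]) auto
  qed
  also have "\<dots> \<le> liminf (\<lambda>i. \<integral>\<^sup>+ x. ennreal (norm (f i x) powr p) \<partial>M)"
    by (rule nn_integral_liminf) measurable
  also have "\<dots> \<le> ennreal (e powr p)"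
  proof (rule Liminf_le)
    show "\<forall>\<^sub>F i in sequentially. (\<integral>\<^sup>+ x. ennreal (norm (f i x) powr p) \<partial>M) \<le> ennreal (e powr p)"
      using p f bd by (intro eventually_sequentiallyI[of n])
        (auto simp: nn_integral_Lp_norm intro!: ennreal_leI powr_mono2 Lp_norm_nonneg)
  qed simp
  finally have le: "(\<integral>\<^sup>+ x. ennreal (norm (g x) powr p) \<partial>M) \<le> ennreal (e powr p)" .
  have "integrable M (\<lambda>x. norm (g x) powr p)"
    using le by (intro integrableI_bounded) (auto simp: le_less_trans)
  then have gL: "g \<in> Lp_fun M p" using g by (rule Lp_funI[rotated])
  then have "Lp_norm M p g powr p \<le> e powr p"
    using le nn_integral_Lp_norm[OF _ gL] p e by (simp add: ennreal_le_iff)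
  moreover have "e powr p < Lp_norm M p g powr p" if "e < Lp_norm M p g"
    by (rule powr_less_mono2) (use that p e in linarith)+
  ultimately have "Lp_norm M p g \<le> e"
    by (meson not_le)
  then show ?thesis using gL by simp
qed

lemma Lp_complete:
  fixes f :: "nat \<Rightarrow> 'a \<Rightarrow> complex"
  assumes p: "p \<ge> 1" and f: "\<And>i. f i \<in> Lp_fun M p"
    and cauchy: "\<And>e. e > 0 \<Longrightarrow> \<exists>N. \<forall>i\<ge>N. \<forall>j\<ge>N. Lp_norm M p (\<lambda>x. f i x - f j x) < e"
  shows "\<exists>g\<in>Lp_fun M p. (\<lambda>i. Lp_norm M p (\<lambda>x. f i x - g x)) \<longlonglongrightarrow> 0"
proof -
  note [measurable] = f[THEN Lp_fun_measurable]
  have "\<exists>N. \<forall>k. \<forall>i\<ge>N k. \<forall>j\<ge>N k. Lp_norm M p (\<lambda>x. f i x - f j x) < (1/2) ^ k"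
    by (intro choice allI cauchy) simp
  then obtain N where N: "\<And>k i j. i \<ge> N k \<Longrightarrow> j \<ge> N k \<Longrightarrow> Lp_norm M p (\<lambda>x. f i x - f j x) < (1/2) ^ k"
    by blast
  define r where "r k = k + (\<Sum>i\<le>k. N i)" for k
  have rN: "r j \<ge> N k" if "j \<ge> k" for j k
    using that member_le_sum[of k "{..j}" N] by (auto simp: r_def)
  define d where "d k x = f (r (Suc k)) x - f (r k) x" for k x
  have d: "d k \<in> Lp_fun M p" for k
    unfolding d_def using p f by (intro Lp_fun_diff)
  then have [measurable]: "d k \<in> borel_measurable M" for k by (rule Lp_fun_measurable)
  have dn: "Lp_norm M p (d k) \<le> (1/2) ^ k" for k
    unfolding d_def by (intro less_imp_le[OF N] rN) auto
  define D where "D k x = complex_of_real (norm (d k x))" for k x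
  have D: "D k \<in> Lp_fun M p" for k
    using d[THEN Lp_fun_integrable, of k] unfolding D_def by (intro Lp_funI) auto
  have Dn: "Lp_norm M p (D k) \<le> (1/2) ^ k" for k
    using dn[of k] by (simp add: Lp_norm_def D_def)
  have SD: "(\<lambda>x. \<Sum>k<n. D k x) \<in> Lp_fun M p" "Lp_norm M p (\<lambda>x. \<Sum>k<n. D k x) \<le> 2" for n
  proof -
    have "(\<Sum>k<n. Lp_norm M p (D k)) \<le> (\<Sum>k<n. (1/2) ^ k)"
      by (intro sum_mono Dn)
    also have "\<dots> \<le> 2" by (simp add: geometric_sum)
    finally show "(\<lambda>x. \<Sum>k<n. D k x) \<in> Lp_fun M p" "Lp_norm M p (\<lambda>x. \<Sum>k<n. D k x) \<le> 2"
      using Lp_norm_sum[OF p, of D M n] D by auto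
  qed
  define S where "S n x = ennreal ((\<Sum>k<n. norm (d k x)) powr p)" for n x
  have S_eq: "S n x = ennreal (norm (\<Sum>k<n. D k x) powr p)" for n x
  proof -
    have "norm (\<Sum>k<n. D k x) = (\<Sum>k<n. norm (d k x))"
      unfolding D_def of_real_sum[symmetric] norm_of_real by (simp add: sum_nonneg)
    then show ?thesis by (simp add: S_def)
  qed
  have Sint: "(\<integral>\<^sup>+ x. S n x \<partial>M) \<le> ennreal (2 powr p)" for n
    unfolding S_eq using SD[of n] p
    by (subst nn_integral_Lp_norm) (auto intro!: ennreal_leI powr_mono2 Lp_norm_nonneg)
  have inc: "incseq S"
    unfolding S_def incseq_def le_fun_def using p
    by (auto intro!: ennreal_leI powr_mono2 sum_mono2 sum_nonneg)
  have [measurable]: "S n \<in> borel_measurable M" for n unfolding S_def by measurable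
  have "(\<integral>\<^sup>+ x. (SUP n. S n x) \<partial>M) = (SUP n. \<integral>\<^sup>+ x. S n x \<partial>M)"
    by (rule nn_integral_monotone_convergence_SUP[OF inc]) measurable
  also have "\<dots> \<le> ennreal (2 powr p)" by (intro SUP_least Sint)
  finally have "(\<integral>\<^sup>+ x. (SUP n. S n x) \<partial>M) \<noteq> \<infinity>" by (auto simp: top_unique)
  then have fin: "AE x in M. (SUP n. S n x) \<noteq> \<infinity>"
    by (intro nn_integral_PInf_AE) auto
  have conv: "AE x in M. (\<lambda>i. f (r i) x) \<longlonglongrightarrow> lim (\<lambda>i. f (r i) x)"
    using fin
  proof eventually_elim
    case (elim x)
    then obtain b where b: "(SUP n. S n x) = ennreal b" "b \<ge> 0"
      by (metis ennreal_cases infinity_ennreal_def)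
    have bd: "(\<Sum>k<n. norm (d k x)) \<le> b powr (1/p)" for n
    proof -
      have "S n x \<le> ennreal b" using b SUP_upper[of n UNIV "\<lambda>n. S n x"] by simp
      then have "(\<Sum>k<n. norm (d k x)) powr p \<le> b" using b unfolding S_def by (simp add: ennreal_le_iff)
      then have "((\<Sum>k<n. norm (d k x)) powr p) powr (1/p) \<le> b powr (1/p)"
        using p by (intro powr_mono2) auto
      then show ?thesis using p by (simp add: powr_powr sum_nonneg)
    qed
    have "summable (\<lambda>k. norm (d k x))"
      by (rule bounded_imp_summable[of _ "b powr (1/p)"]) (use bd[of "Suc _"] in \<open>auto simp: lessThan_Suc_atMost\<close>)
    then have "summable (\<lambda>k. d k x)" by (rule summable_norm_cancel)
    then have "(\<lambda>n. \<Sum>k<n. d k x) \<longlonglongrightarrow> (\<Sum>k. d k x)" by (rule summable_LIMSEQ)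
    moreover have "(\<Sum>k<n. d k x) = f (r n) x - f (r 0) x" for n
      unfolding d_def by (rule sum_lessThan_telescope)
    ultimately have "(\<lambda>n. f (r n) x - f (r 0) x + f (r 0) x) \<longlonglongrightarrow> (\<Sum>k. d k x) + f (r 0) x"
      by (intro tendsto_add) auto
    then have "convergent (\<lambda>n. f (r n) x)" by (auto simp: convergent_def)
    then show ?case by (simp add: convergent_LIMSEQ_iff)
  qed
  define g where "g x = lim (\<lambda>i. f (r i) x)" for x
  have g[measurable]: "g \<in> borel_measurable M"
    unfolding g_def by (rule borel_measurable_lim_metric) measurable
  have est: "(\<lambda>x. f i x - g x) \<in> Lp_fun M p \<and> Lp_norm M p (\<lambda>x. f i x - g x) \<le> (1/2) ^ k" if "i \<ge> N k" for i k
  proof (rule Lp_fatou[OF p])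
    show "(\<lambda>x. f i x - f (r j) x) \<in> Lp_fun M p" for j using p f by (intro Lp_fun_diff)
    show "AE x in M. (\<lambda>j. f i x - f (r j) x) \<longlonglongrightarrow> f i x - g x"
      using conv unfolding g_def by eventually_elim (intro tendsto_intros)
    show "Lp_norm M p (\<lambda>x. f i x - f (r j) x) \<le> (1/2) ^ k" if "j \<ge> k" for j
      using \<open>i \<ge> N k\<close> N[of k i "r j"] rN[OF that] by linarith
  qed measurable
  have "g \<in> Lp_fun M p"
    using Lp_fun_diff[OF p f conjunct1[OF est[OF order_refl]], of "N 0" 0] by simp
  moreover have "(\<lambda>i. Lp_norm M p (\<lambda>x. f i x - g x)) \<longlonglongrightarrow> 0"
  proof (rule LIMSEQ_I)
    fix e :: real assume "e > 0"
    then obtain k where "(1/2) ^ k < e" using real_arch_pow_inv[of e "1/2"] by auto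
    then show "\<exists>n0. \<forall>n\<ge>n0. norm (Lp_norm M p (\<lambda>x. f n x - g x) - 0) < e"
    proof (intro exI[of _ "N k"] allI impI)
      fix n assume "N k \<le> n"
      then have "Lp_norm M p (\<lambda>x. f n x - g x) \<le> (1/2) ^ k" using est by simp
      then show "norm (Lp_norm M p (\<lambda>x. f n x - g x) - 0) < e"
        using \<open>(1/2) ^ k < e\<close> by (simp add: Lp_norm_nonneg)
    qed
  qed
  ultimately show ?thesis by blast
qed

lemma Lp_rep_class:
  assumes "f \<in> Lp_fun M p"
  shows "Lp_rep (Lp_class M p f) \<in> Lp_fun M p" "AE x in M. Lp_rep (Lp_class M p f) x = f x"
proof -
  have "f \<in> Lp_class M p f" using assms by (simp add: Lp_class_def)
  then have "Lp_rep (Lp_class M p f) \<in> Lp_class M p f" unfolding Lp_rep_def by (rule someI[where P="\<lambda>f. f \<in> _"])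
  then show "Lp_rep (Lp_class M p f) \<in> Lp_fun M p" "AE x in M. Lp_rep (Lp_class M p f) x = f x"
    by (simp_all add: Lp_class_def)
qed

lemma Lp_class_eqI: "AE x in M. f x = g x \<Longrightarrow> Lp_class M p f = Lp_class M p g"
  unfolding Lp_class_def by (auto elim: AE_mp)

lemma Lp_class_eq_iff:
  assumes "f \<in> Lp_fun M p"
  shows "Lp_class M p f = Lp_class M p g \<longleftrightarrow> (AE x in M. f x = g x)"
proof
  assume "Lp_class M p f = Lp_class M p g"
  moreover have "f \<in> Lp_class M p f" using assms by (simp add: Lp_class_def)
  ultimately show "AE x in M. f x = g x" by (simp add: Lp_class_def)
qed (rule Lp_class_eqI)

lemma Lp_space_carrier: "carrier (Lp_space M p) = Lp_class M p ` Lp_fun M p"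
  and Lp_space_zero: "\<zero>\<^bsub>Lp_space M p\<^esub> = Lp_class M p (\<lambda>_. 0)"
  by (simp_all add: Lp_space_def)

lemma Lp_space_add:
  assumes "f \<in> Lp_fun M p" "g \<in> Lp_fun M p"
  shows "Lp_class M p f \<oplus>\<^bsub>Lp_space M p\<^esub> Lp_class M p g = Lp_class M p (\<lambda>x. f x + g x)"
  unfolding Lp_space_def using Lp_rep_class(2)[OF assms(1)] Lp_rep_class(2)[OF assms(2)]
  by (auto intro!: Lp_class_eqI elim: AE_mp)

lemma Lp_space_smult:
  assumes "f \<in> Lp_fun M p"
  shows "c \<odot>\<^bsub>Lp_space M p\<^esub> Lp_class M p f = Lp_class M p (\<lambda>x. c * f x)"
  unfolding Lp_space_def using Lp_rep_class(2)[OF assms(1)]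
  by (auto intro!: Lp_class_eqI elim: AE_mp)

lemma Lp_space_nrm:
  assumes "f \<in> Lp_fun M p"
  shows "nrm (Lp_space M p) (Lp_class M p f) = Lp_norm M p f"
  unfolding Lp_space_def using Lp_rep_class[OF assms] assms
  by (auto intro!: Lp_norm_cong_AE dest: Lp_fun_measurable)

lemma cring_complex_ring: "cring complex_ring"
  by (rule cringI; (rule abelian_groupI comm_monoidI)?)
     (auto simp: complex_ring_def algebra_simps intro: exI[of _ "- _"])

lemma module_Lp_space:
  assumes p: "p \<ge> 1"
  shows "module complex_ring (Lp_space M p)"
proof -
  note s = Lp_space_carrier Lp_space_add Lp_space_smult Lp_space_zero
    Lp_fun_add[OF p] Lp_fun_cmult Lp_fun_zero
  show ?thesis
  proof (rule moduleI)
  show "cring complex_ring" by (rule cring_complex_ring)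
  show "abelian_group (Lp_space M p)"
  proof (rule abelian_groupI)
    fix A assume "A \<in> carrier (Lp_space M p)"
    then obtain f where f: "f \<in> Lp_fun M p" "A = Lp_class M p f" by (auto simp: s)
    then show "\<exists>B\<in>carrier (Lp_space M p). B \<oplus>\<^bsub>Lp_space M p\<^esub> A = \<zero>\<^bsub>Lp_space M p\<^esub>"
      using p Lp_fun_cmult[OF f(1), of "-1"] by (intro bexI[of _ "Lp_class M p (\<lambda>x. -1 * f x)"]) (auto simp: s)
  qed (use p in \<open>auto simp: s algebra_simps\<close>)
  qed (use p in \<open>auto simp: s complex_ring_def algebra_simps\<close>)
qed

lemma Lp_space_minus:
  assumes "p \<ge> 1" "f \<in> Lp_fun M p" "g \<in> Lp_fun M p"
  shows "Lp_class M p f \<ominus>\<^bsub>Lp_space M p\<^esub> Lp_class M p g = Lp_class M p (\<lambda>x. f x - g x)"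
proof -
  interpret module complex_ring "Lp_space M p" by (rule module_Lp_space[OF assms(1)])
  have "\<ominus>\<^bsub>Lp_space M p\<^esub> Lp_class M p g = Lp_class M p (\<lambda>x. -1 * g x)"
    using assms Lp_fun_cmult[OF assms(3), of "-1"]
    by (intro M.minus_equality) (auto simp: Lp_space_carrier Lp_space_add Lp_space_zero)
  then show ?thesis
    using assms Lp_fun_cmult[OF assms(3), of "-1"] by (simp add: a_minus_def Lp_space_add)
qed

lemma complex_banach_space_Lp_space:
  assumes p: "p \<ge> 1"
  shows "complex_banach_space (Lp_space M p)"
proof -
  interpret module complex_ring "Lp_space M p" by (rule module_Lp_space[OF p])
  note s = Lp_space_carrier Lp_space_add Lp_space_smult Lp_space_zero Lp_space_nrm
    Lp_fun_add[OF p] Lp_fun_cmult Lp_fun_zero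
  show ?thesis
  proof
    fix X :: "nat \<Rightarrow> _"
    assume X: "\<And>k. X k \<in> carrier (Lp_space M p)"
      and cauchy: "\<And>e. e > 0 \<Longrightarrow>
        \<exists>N. \<forall>i\<ge>N. \<forall>j\<ge>N. nrm (Lp_space M p) (X i \<ominus>\<^bsub>Lp_space M p\<^esub> X j) < e"
    from X have "\<exists>f. \<forall>k. f k \<in> Lp_fun M p \<and> X k = Lp_class M p (f k)"
      by (intro choice) (auto simp: s)
    then obtain f where f: "\<And>k. f k \<in> Lp_fun M p" "\<And>k. X k = Lp_class M p (f k)" by blast
    have "\<exists>g\<in>Lp_fun M p. (\<lambda>i. Lp_norm M p (\<lambda>x. f i x - g x)) \<longlonglongrightarrow> 0"
      using cauchy p f by (intro Lp_complete) (simp_all add: Lp_space_minus Lp_space_nrm Lp_fun_diff)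
    then obtain g where g: "g \<in> Lp_fun M p" "(\<lambda>i. Lp_norm M p (\<lambda>x. f i x - g x)) \<longlonglongrightarrow> 0" by blast
    then show "\<exists>x\<in>carrier (Lp_space M p). (\<lambda>k. nrm (Lp_space M p) (X k \<ominus>\<^bsub>Lp_space M p\<^esub> x)) \<longlonglongrightarrow> 0"
      using p f by (intro bexI[of _ "Lp_class M p g"])
        (simp_all add: Lp_space_minus Lp_space_nrm Lp_fun_diff Lp_space_carrier)
  next
    fix A assume "A \<in> carrier (Lp_space M p)"
    then obtain f where f: "f \<in> Lp_fun M p" "A = Lp_class M p f" by (auto simp: s)
    then show "nrm (Lp_space M p) A = 0 \<longleftrightarrow> A = \<zero>\<^bsub>Lp_space M p\<^esub>"
      using p by (simp add: Lp_space_nrm Lp_space_zero Lp_norm_eq_0_iff Lp_class_eq_iff[OF f(1)])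
  qed (use p in \<open>auto simp: s Lp_norm_triangle Lp_norm_cmult\<close>)
qed


section \<open>The unit ball\<close>

definition cinner :: "complex ^ 'n \<Rightarrow> complex ^ 'n \<Rightarrow> complex" where
  "cinner z w = (\<Sum>j\<in>UNIV. z $ j * cnj (w $ j))"

text \<open>Normalized Lebesgue measure \<open>dv\<close>, the weighted measures \<open>dv\<^sub>\<alpha>\<close> and the invariant measure \<open>d\<tau>\<close>,
  all with underlying space \<open>ball 0 1\<close>.\<close>

definition vol_ball :: "(complex ^ 'n) measure" where
  "vol_ball = restrict_space (uniform_measure lborel (ball 0 1)) (ball 0 1)"

definition weight_const :: "nat \<Rightarrow> real \<Rightarrow> real" where
  "weight_const n \<alpha> = Gamma (real n + \<alpha> + 1) / (fact n * Gamma (\<alpha> + 1))"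

definition vol_weighted :: "real \<Rightarrow> (complex ^ 'n) measure" where
  "vol_weighted \<alpha> =
     density vol_ball (\<lambda>z. ennreal (weight_const CARD('n) \<alpha> * (1 - (norm z)\<^sup>2) powr \<alpha>))"

definition inv_measure :: "(complex ^ 'n) measure" where
  "inv_measure = density vol_ball (\<lambda>z. ennreal (1 / (1 - (norm z)\<^sup>2) ^ (CARD('n) + 1)))"

text \<open>Holomorphy in several variables: complex (Frechet) differentiability.\<close>

definition holomorphic_Cn_on :: "(complex ^ 'n \<Rightarrow> complex) \<Rightarrow> (complex ^ 'n) set \<Rightarrow> bool" where
  "holomorphic_Cn_on f S \<longleftrightarrow>
     (\<forall>z\<in>S. \<exists>D. (f has_derivative D) (at z) \<and> (\<forall>c v. D (c *s v) = c * D v))"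

definition bergman_space :: "real \<Rightarrow> real \<Rightarrow> (complex ^ 'n \<Rightarrow> complex) set" where
  "bergman_space \<alpha> p = {f \<in> Lp_fun (vol_weighted \<alpha>) p. holomorphic_Cn_on f (ball 0 1)}"

definition ball_proj :: "complex ^ 'n \<Rightarrow> complex ^ 'n \<Rightarrow> complex ^ 'n" where
  "ball_proj z w = (cinner w z / complex_of_real ((norm z)\<^sup>2)) *s z"

definition ball_aut :: "complex ^ 'n \<Rightarrow> complex ^ 'n \<Rightarrow> complex ^ 'n" where
  "ball_aut z w =
     (if z = 0 then - w
      else (1 / (1 - cinner w z)) *s
        (z - ball_proj z w - sqrt (1 - (norm z)\<^sup>2) *\<^sub>R (w - ball_proj z w)))"

definition bergman_metric :: "complex ^ 'n \<Rightarrow> complex ^ 'n \<Rightarrow> real" where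
  "bergman_metric z w = 1 / 2 * ln ((1 + norm (ball_aut z w)) / (1 - norm (ball_aut z w)))"

definition bergman_ball :: "complex ^ 'n \<Rightarrow> real \<Rightarrow> (complex ^ 'n) set" where
  "bergman_ball z \<gamma> = {w \<in> ball 0 1. bergman_metric z w < \<gamma>}"

definition area_fun ::
    "real \<Rightarrow> real \<Rightarrow> (complex ^ 'n \<Rightarrow> complex) \<Rightarrow> complex ^ 'n \<Rightarrow> real" where
  "area_fun q \<gamma> f z = (LINT w:bergman_ball z \<gamma>|inv_measure. cmod (f w) powr q) powr (1 / q)"

definition rho :: "complex ^ 'n \<Rightarrow> complex ^ 'n \<Rightarrow> real" where
  "rho z w =
     (if z \<noteq> 0 \<and> w \<noteq> 0
      then \<bar>norm z - norm w\<bar> + cmod (1 - 1 / complex_of_real (norm z * norm w) * cinner z w)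
      else norm z + norm w)"


section \<open>Bergman singular integral operators\<close>

text \<open>
  A kernel is a total function whose values on the diagonal and outside the ball are ignored.  In
  the smoothness condition \<open>z \<noteq> w\<close> and \<open>z \<noteq> \<zeta>\<close> just say that the four kernel values are defined.
\<close>

definition bergman_kernel ::
    "real \<Rightarrow> 'e normed_module \<Rightarrow> (complex ^ 'n \<Rightarrow> complex ^ 'n \<Rightarrow> 'e) \<Rightarrow> bool" where
  "bergman_kernel \<alpha> E K \<longleftrightarrow>
     (let B = ball 0 1; \<Omega> = {(z, w). z \<in> B \<and> w \<in> B \<and> z \<noteq> w}; N = real CARD('n) + 1 + \<alpha> in
      (\<forall>(z, w)\<in>\<Omega>. K z w \<in> carrier E) \<and>
      (\<forall>(z\<^sub>0, w\<^sub>0)\<in>\<Omega>. ((\<lambda>(z, w). nrm E (K z w \<ominus>\<^bsub>E\<^esub> K z\<^sub>0 w\<^sub>0)) \<longlongrightarrow> 0) (at (z\<^sub>0, w\<^sub>0) within \<Omega>)) \<and>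
      (\<exists>C>0. \<exists>\<delta>>0. \<exists>b>0. b \<le> 1 \<and>
        (\<forall>(z, w)\<in>\<Omega>. nrm E (K z w) \<le> C / rho z w powr N) \<and>
        (\<forall>z\<in>B. \<forall>w\<in>B. \<forall>\<zeta>\<in>B. z \<noteq> w \<longrightarrow> z \<noteq> \<zeta> \<longrightarrow> rho z \<zeta> \<ge> \<delta> * rho w \<zeta> \<longrightarrow>
          nrm E (K z w \<ominus>\<^bsub>E\<^esub> K z \<zeta>) + nrm E (K w z \<ominus>\<^bsub>E\<^esub> K \<zeta> z)
            \<le> C * rho w \<zeta> powr b / rho z \<zeta> powr (N + b))))"

text \<open>
  \<open>T f(z) = \<integral> K(z,w) f(w) dv\<^sub>\<alpha>(w)\<close> as an absolutely convergent Bochner integral, for almost every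
  \<open>z\<close>, whenever \<open>f \<in> L\<^sup>p\<^sub>\<alpha>\<close> for some \<open>1 < p < \<infinity>\<close>.
\<close>

definition bergman_sio ::
    "real \<Rightarrow> 'e normed_module \<Rightarrow> (complex ^ 'n \<Rightarrow> complex ^ 'n \<Rightarrow> 'e) \<Rightarrow>
     ((complex ^ 'n \<Rightarrow> complex) \<Rightarrow> complex ^ 'n \<Rightarrow> 'e) \<Rightarrow> bool" where
  "bergman_sio \<alpha> E K T \<longleftrightarrow>
     complex_banach_space E \<and> bergman_kernel \<alpha> E K \<and>
     (\<forall>p>1. \<forall>f\<in>Lp_fun (vol_weighted \<alpha>) p. AE z in vol_weighted \<alpha>.
        has_integral_into (vol_weighted \<alpha>) E (\<lambda>w. f w \<odot>\<^bsub>E\<^esub> K z w) (T f z))"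

definition BIO ::
    "real \<Rightarrow> 'e normed_module \<Rightarrow> ((complex ^ 'n \<Rightarrow> complex) \<Rightarrow> complex ^ 'n \<Rightarrow> 'e) set" where
  "BIO \<alpha> E =
     {T. (\<exists>K. bergman_sio \<alpha> E K T) \<and>
       (\<forall>p>1. \<exists>C. \<forall>f\<in>Lp_fun (vol_weighted \<alpha>) p.
          T f \<in> Bochner_Lp (vol_weighted \<alpha>) p E \<and>
          Bochner_Lp_norm (vol_weighted \<alpha>) p E (T f) \<le> C * Lp_norm (vol_weighted \<alpha>) p f)}"


section \<open>The tent operator\<close>

definition tent_measure :: "real \<Rightarrow> (complex ^ 'n) measure" where
  "tent_measure \<gamma> = density inv_measure (indicator (bergman_ball 0 \<gamma>))"

text \<open>
  Since \<open>1 - \<langle>\<phi>\<^sub>z(w), u\<rangle>\<close> has positive real part for \<open>z\<close>, \<open>w\<close>, \<open>u\<close> in the ball, the power is the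
  principal branch.
\<close>

definition K_tent ::
    "real \<Rightarrow> real \<Rightarrow> real \<Rightarrow> complex ^ 'n \<Rightarrow> complex ^ 'n \<Rightarrow> (complex ^ 'n \<Rightarrow> complex) set" where
  "K_tent \<alpha> \<gamma> q z u = Lp_class (tent_measure \<gamma>) q
     (\<lambda>w. (1 - cinner (ball_aut z w) u) powr (- complex_of_real (real CARD('n) + 1 + \<alpha>)))"

definition T_tent ::
    "real \<Rightarrow> real \<Rightarrow> real \<Rightarrow> (complex ^ 'n \<Rightarrow> complex) \<Rightarrow> complex ^ 'n \<Rightarrow>
     (complex ^ 'n \<Rightarrow> complex) set" where
  "T_tent \<alpha> \<gamma> q f z = Lp_class (tent_measure \<gamma>) q
     (\<lambda>w. \<integral>u. f u / (1 - cinner (ball_aut z w) u) powr complex_of_real (real CARD('n) + 1 + \<alpha>)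
        \<partial>vol_weighted \<alpha>)"

end

(*
  The smoothness and size of the kernel come from the identity
    (1 - <w,z>) (1 - <phi_z w,u>) = (1 - <z,u>) (1 - <w,phi_z u>),
  which makes |1 - <phi_z w,u>| comparable to |1 - <z,u>|, uniformly for w in D(0,gamma).  For the same
  reason |T f(z)(w)| is at most a constant times P|f|(z), where P is the positive operator with kernel
  |1 - <z,u>|^-(n+1+alpha), so no Calderon-Zygmund theory is needed: P is bounded on L^p by Schur's test.
  The Forelli-Rudin integrals are estimated by dyadic decomposition into Carleson regions, whose volumes
  are found by packing with translates and dilates.
  For holomorphic f, a sub-mean value inequality on nonisotropic balls bounds |f| on D(z,gamma) by a
  constant times P|f|(z); this replaces the reproducing formula and the invariance of tau.
*)
theory Submission
  imports Defs "HOL-Complex_Analysis.Cauchy_Integral_Formula"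
begin

section \<open>The Hermitian product and the involutions\<close>

text \<open>Everything in the tent variable reduces to sup norms: the measure behind E is finite and
  lives on |w| < tanh \<gamma>, so a bound that is uniform on that ball passes to the norm of E at
  the cost of a constant. The Hoelder exponent of the kernel is 1/2. The difference z - w, and the
  dependence of phi_w on w through sqrt (1 - |w|^2), are only controlled by \<open>rho\<close> to
  the power 1/2; the missing half power is recovered by pairing such a difference with another
  quantity of size |1 - <z,u>|^(1/2). All estimates are made with |1 - <z,u>| and converted to
  \<open>rho\<close> at the end, using that \<open>rho\<close> is at most three times as large. The
  nonisotropic balls have to be circular, because the mean value is taken on discs in complex lines
  through the centre and is then averaged by rotation invariance. Elements of E are classes with
  chosen representatives, so a Bochner integral cannot be evaluated pointwise without care; the
  approximating simple functions discretise both the value f u and the point u, with an error that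
  is uniform in w.\<close>

lemma cinner_add_left: "cinner (x + y) w = cinner x w + cinner y w"
  and cinner_add_right: "cinner w (x + y) = cinner w x + cinner w y"
  and cinner_diff_left: "cinner (x - y) w = cinner x w - cinner y w"
  and cinner_diff_right: "cinner w (x - y) = cinner w x - cinner w y"
  and cinner_minus_left: "cinner (- x) w = - cinner x w"
  and cinner_minus_right: "cinner w (- x) = - cinner w x"
  and cinner_smult_left: "cinner (c *s x) w = c * cinner x w"
  and cinner_smult_right: "cinner w (c *s x) = cnj c * cinner w x"
  and cinner_0_left: "cinner 0 w = 0"
  and cinner_0_right: "cinner w 0 = 0"
  by (simp_all add: cinner_def sum.distrib sum_subtractf sum_negf sum_distrib_left algebra_simps)

lemmas cinner_simps = cinner_add_left cinner_add_right cinner_diff_left cinner_diff_right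
  cinner_minus_left cinner_minus_right cinner_smult_left cinner_smult_right cinner_0_left cinner_0_right

lemma cnj_cinner: "cnj (cinner z w) = cinner w z"
  by (simp add: cinner_def mult.commute)

lemma cmod_cinner_commute: "cmod (cinner z w) = cmod (cinner w z)"
  by (metis cnj_cinner complex_mod_cnj)

lemma cmod_one_minus_cinner_commute: "cmod (1 - cinner z w) = cmod (1 - cinner w z)"
proof -
  have "cnj (1 - cinner z w) = 1 - cinner w z" by (simp add: cnj_cinner)
  then show ?thesis by (metis complex_mod_cnj)
qed

lemma Re_cinner: "Re (cinner z w) = z \<bullet> w"
  by (simp add: cinner_def inner_vec_def inner_complex_def)

lemma cinner_self: "cinner z z = complex_of_real ((norm z)\<^sup>2)"
proof -
  have "Im (cinner z z) = 0"
    by (simp add: cinner_def)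
  then show ?thesis
    by (simp add: complex_eq_iff Re_cinner power2_norm_eq_inner)
qed

lemma norm_vec_smult: "norm (c *s z) = cmod c * norm (z :: complex ^ 'n)"
proof -
  have "cinner (c *s z) (c *s z) = (c * cnj c) * cinner z z"
    by (simp add: cinner_simps)
  then have "complex_of_real ((norm (c *s z))\<^sup>2) = complex_of_real ((cmod c * norm z)\<^sup>2)"
    unfolding cinner_self complex_norm_square[symmetric] by (simp add: power_mult_distrib)
  then have "(norm (c *s z))\<^sup>2 = (cmod c * norm z)\<^sup>2"
    by (simp only: of_real_eq_iff)
  then show ?thesis by simp
qed

lemma scaleR_eq_smult: "a *\<^sub>R (z :: complex ^ 'n) = complex_of_real a *s z"
  by (simp add: vec_eq_iff scaleR_conv_of_real[where 'a = complex])

text \<open>A unimodular factor \<open>e\<close> rotates \<open>cinner z w\<close> onto the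
  nonnegative real axis, where it is the real inner product of \<open>e *s z\<close> and
  \<open>w\<close>; the real Cauchy-Schwarz inequality then applies.\<close>

lemma cinner_cauchy_schwarz: "cmod (cinner z w) \<le> norm z * norm w"
proof (cases "cinner z w = 0")
  case False
  define e where "e = cnj (cinner z w) / complex_of_real (cmod (cinner z w))"
  have "cmod e = 1" using False by (simp add: e_def norm_divide)
  have "cinner (e *s z) w = complex_of_real (cmod (cinner z w))"
    using False by (simp add: cinner_simps e_def complex_norm_square[symmetric] power2_eq_square mult.commute[of "cnj _"])
  then have "cmod (cinner z w) = (e *s z) \<bullet> w"
    by (metis Re_cinner Re_complex_of_real)
  also have "\<dots> \<le> norm (e *s z) * norm w" by (rule norm_cauchy_schwarz)
  finally show ?thesis using \<open>cmod e = 1\<close> by (simp add: norm_vec_smult)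
qed (use norm_ge_zero[of z] norm_ge_zero[of w] in \<open>simp\<close>)

lemma norm_diff_square: "(norm (z - w))\<^sup>2 = (norm z)\<^sup>2 + (norm w)\<^sup>2 - 2 * Re (cinner z w)"
  by (simp add: Re_cinner power2_norm_eq_inner inner_diff_left inner_diff_right inner_commute)

text \<open>Expanding the square and bounding both norms by 1 leaves 2 Re (1 - <z,w>). The Euclidean
  distance is thus only of the order of the square root of |1 - <z,w>|, the source of all square
  roots below.\<close>

lemma norm_diff_square_le:
  assumes "norm z \<le> 1" "norm w \<le> 1"
  shows "(norm (z - w))\<^sup>2 \<le> 2 * cmod (1 - cinner z w)"
proof -
  have "(norm z)\<^sup>2 \<le> 1" "(norm w)\<^sup>2 \<le> 1" using assms by (simp_all add: power_le_one)
  then show ?thesis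
    using complex_Re_le_cmod[of "1 - cinner z w"] by (simp add: norm_diff_square)
qed

lemma continuous_on_cinner [continuous_intros]:
  assumes "continuous_on S f" "continuous_on S g"
  shows "continuous_on S (\<lambda>x. cinner (f x) (g x))"
  unfolding cinner_def using assms by (intro continuous_intros)

lemma continuous_on_vec_smult [continuous_intros]:
  fixes g :: "'a::topological_space \<Rightarrow> complex ^ 'n"
  assumes "continuous_on S f" "continuous_on S g"
  shows "continuous_on S (\<lambda>x. f x *s g x)"
  unfolding vector_scalar_mult_def using assms by (intro continuous_intros)

text \<open>The quantity 1 - |z|^2 is preferred to 1 - |z| because it transforms exactly under the
  involutions; see \<open>defect_ball_aut\<close>.\<close>

definition defect :: "complex ^ 'n \<Rightarrow> real" where
  "defect z = 1 - (norm z)\<^sup>2"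

lemma defect_pos: "norm z < 1 \<Longrightarrow> 0 < defect z"
  and defect_nonneg: "norm z \<le> 1 \<Longrightarrow> 0 \<le> defect z"
  and defect_le_1: "defect z \<le> 1"
  by (simp_all add: defect_def power_less_one_iff power_le_one abs_square_less_1)

lemma continuous_on_defect [continuous_intros]:
  "continuous_on S f \<Longrightarrow> continuous_on S (\<lambda>x. defect (f x))"
  unfolding defect_def by (intro continuous_intros)

text \<open>By Cauchy-Schwarz |<z,w>| is at most the smaller of the two norms, and 1 - x^2 <= 2 (1 -
  x) turns this into a bound for the defects.\<close>

lemma defect_le_cmod:
  assumes "norm z \<le> 1" "norm w \<le> 1"
  shows "1 - norm z \<le> cmod (1 - cinner z w)" "1 - norm w \<le> cmod (1 - cinner z w)"
    "defect z \<le> 2 * cmod (1 - cinner z w)" "defect w \<le> 2 * cmod (1 - cinner z w)"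
proof -
  have "cmod (cinner z w) \<le> norm z * norm w" by (rule cinner_cauchy_schwarz)
  moreover have "norm z * norm w \<le> norm z" "norm z * norm w \<le> norm w"
    using assms by (simp_all add: mult_left_le mult_left_le_one_le)
  moreover have "1 - cmod (cinner z w) \<le> cmod (1 - cinner z w)"
    using norm_triangle_ineq2[of 1 "cinner z w"] by simp
  ultimately show 1: "1 - norm z \<le> cmod (1 - cinner z w)" "1 - norm w \<le> cmod (1 - cinner z w)"
    by linarith+
  have aux: "defect x \<le> 2 * (1 - norm x)" for x :: "complex ^ 'n"
    using zero_le_power2[of "1 - norm x"] by (simp add: defect_def power2_diff)
  show "defect z \<le> 2 * cmod (1 - cinner z w)" "defect w \<le> 2 * cmod (1 - cinner z w)"
    using 1 aux[of z] aux[of w] by (simp_all add: mult_left_mono order_trans)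
qed

text \<open>The product |z| |w| is below 1 as soon as one of the points is interior. The positive
  real part is what keeps every complex power below on the principal branch.\<close>

lemma one_minus_cinner_bounds:
  assumes "norm z \<le> 1" "norm w \<le> 1" "norm z < 1 \<or> norm w < 1"
  shows "0 < cmod (1 - cinner z w)" "1 - cinner z w \<noteq> 0" "cmod (1 - cinner z w) \<le> 2"
    "0 < Re (1 - cinner z w)"
proof -
  have *: "cmod (cinner z w) \<le> norm z * norm w" by (rule cinner_cauchy_schwarz)
  have "norm z * norm w \<le> norm z" "norm z * norm w \<le> norm w"
    using assms by (simp_all add: mult_left_le mult_left_le_one_le)
  then have "cmod (cinner z w) < 1" using assms * by linarith
  then show "0 < Re (1 - cinner z w)"
    using complex_Re_le_cmod[of "cinner z w"] by simp
  then show "1 - cinner z w \<noteq> 0" by auto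
  then show "0 < cmod (1 - cinner z w)" by simp
  show "cmod (1 - cinner z w) \<le> 2"
    using norm_triangle_ineq4[of 1 "cinner z w"] \<open>cmod (cinner z w) < 1\<close> by simp
qed

text \<open>Factoring |z|^2 = (1 + s) (1 - s) removes the division by |z|^2 from the projection. The
  resulting formula has no case distinction and stays regular at z = 0, so algebra, continuity and
  measurability are all derived from it.\<close>

lemma ball_aut_eq:
  fixes z w :: "complex ^ 'n"
  assumes "norm z < 1"
  defines "s \<equiv> complex_of_real (sqrt (defect z))"
  shows "ball_aut z w = (1 / (1 - cinner w z)) *s (z - s *s w - (cinner w z / (1 + s)) *s z)"
proof (cases "z = 0")
  case True
  then show ?thesis by (simp add: ball_aut_def s_def defect_def cinner_simps)
next
  case False
  have d: "0 < defect z" using assms by (simp add: defect_pos)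
  define x where "x = cinner w z"
  have ne: "1 + sqrt (defect z) \<noteq> 0" using d by (metis add_pos_pos less_irrefl real_sqrt_gt_zero zero_less_one)
  then have ne': "1 + s \<noteq> 0" unfolding s_def by (metis of_real_1 of_real_add of_real_eq_0_iff)
  have "s * s = complex_of_real (defect z)"
    using d by (simp add: s_def flip: of_real_mult)
  then have Z: "complex_of_real ((norm z)\<^sup>2) = (1 + s) * (1 - s)"
    by (simp add: defect_def algebra_simps)
  have Zne: "(1 + s) * (1 - s) \<noteq> 0" using False Z by (metis norm_eq_zero of_real_eq_0_iff power2_eq_square mult_eq_0_iff)
  \<comment> \<open>The projection enters with coefficient 1 - s, which cancels against |z|^2 and
    leaves 1 / (1 + s).\<close>
  have c: "x / ((1 + s) * (1 - s)) - s * (x / ((1 + s) * (1 - s))) = x / (1 + s)"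
    using Zne by (simp add: divide_simps) (simp add: algebra_simps)
  have "z - ball_proj z w - sqrt (1 - (norm z)\<^sup>2) *\<^sub>R (w - ball_proj z w)
    = z - s *s w - (x / (1 + s)) *s z"
    unfolding ball_proj_def Z x_def[symmetric] c[symmetric]
    by (simp add: scaleR_eq_smult s_def defect_def vec_eq_iff algebra_simps del: times_divide_eq_right times_divide_eq_left)
  then show ?thesis unfolding ball_aut_def x_def using False by (simp only: if_False)
qed

text \<open>This is \<open>(1 - \<langle>w,z\<rangle>) (1 - \<langle>\<phi>\<^sub>z(w),u\<rangle>)\<close>, a polynomial that is symmetric under conjugation
  and exchange of \<open>w\<close> and \<open>u\<close>.\<close>
definition aut_form :: "complex ^ 'n \<Rightarrow> complex ^ 'n \<Rightarrow> complex ^ 'n \<Rightarrow> complex" where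
  "aut_form z w u = 1 - cinner w z - cinner z u + complex_of_real (sqrt (defect z)) * cinner w u
     + cinner w z * cinner z u / (1 + complex_of_real (sqrt (defect z)))"

lemma cnj_aut_form: "cnj (aut_form z w u) = aut_form z u w"
  by (simp add: aut_form_def cnj_cinner)

lemma one_minus_cinner_aut:
  assumes "norm z < 1" "norm w \<le> 1"
  shows "(1 - cinner w z) * (1 - cinner (ball_aut z w) u) = aut_form z w u"
proof -
  have "1 - cinner w z \<noteq> 0" using assms one_minus_cinner_bounds(2)[of w z] by simp
  then show ?thesis
    unfolding ball_aut_eq[OF assms(1)] cinner_smult_left right_diff_distrib
    by (simp add: cinner_simps aut_form_def)
qed

text \<open>The right side is the conjugate of the left side with \<open>w\<close> and
  \<open>u\<close> exchanged, and \<open>aut_form\<close> is invariant under this combined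
  operation.\<close>

lemma one_minus_cinner_aut_swap:
  assumes "norm z < 1" "norm w \<le> 1" "norm u \<le> 1"
  shows "(1 - cinner w z) * (1 - cinner (ball_aut z w) u) = (1 - cinner z u) * (1 - cinner w (ball_aut z u))"
proof -
  have "(1 - cinner z u) * (1 - cinner w (ball_aut z u)) = cnj ((1 - cinner u z) * (1 - cinner (ball_aut z u) w))"
    by (simp add: cnj_cinner)
  also have "\<dots> = aut_form z w u"
    using assms by (simp add: one_minus_cinner_aut cnj_aut_form del: complex_cnj_mult)
  finally show ?thesis using assms by (simp add: one_minus_cinner_aut)
qed

text \<open>Write \<open>ball_aut z w\<close> as \<open>v\<close> divided by 1 - x. With |z|^2 = 1 -
  s^2 the expansion of \<open>cinner v v\<close> collapses to |1 - x|^2 - s^2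
  \<open>defect w\<close>.\<close>

lemma defect_ball_aut:
  assumes "norm z < 1" "norm w \<le> 1"
  shows "defect (ball_aut z w) = defect z * defect w / (cmod (1 - cinner z w))\<^sup>2"
proof -
  define x where "x = cinner w z"
  define s where "s = sqrt (defect z)"
  have d: "0 < defect z" using assms by (simp add: defect_pos)
  have s: "s > 0" "s * s = defect z" using d by (simp_all add: s_def)
  have Z: "(norm z)\<^sup>2 = 1 - s * s" by (simp add: s defect_def)
  have xne: "1 - x \<noteq> 0" using assms one_minus_cinner_bounds(2)[of w z] by (simp add: x_def)
  have zw: "cinner z w = cnj x" by (simp add: x_def cnj_cinner)
  define v where "v = z - complex_of_real s *s w - (x / (1 + complex_of_real s)) *s z"
  have "(norm v)\<^sup>2 = Re (cinner v v)" by (simp add: cinner_self)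
  have ne: "1 + complex_of_real s \<noteq> 0" using s by (metis of_real_1 of_real_add of_real_eq_0_iff add_pos_pos less_irrefl zero_less_one)
  have "cinner v v = (1 - x / (1 + complex_of_real s)) * (1 - cnj x / (1 + complex_of_real s)) * (1 - complex_of_real s * complex_of_real s)
      - complex_of_real s * (1 - x / (1 + complex_of_real s)) * cnj x
      - complex_of_real s * (1 - cnj x / (1 + complex_of_real s)) * x
      + complex_of_real s * complex_of_real s * complex_of_real ((norm w)\<^sup>2)"
  proof -
    define k S where "k = x / (1 + complex_of_real s)" and "S = complex_of_real s"
    have v: "v = (1 - k) *s z - S *s w" by (simp add: v_def k_def S_def algebra_simps)
    have kc: "cnj k = cnj x / (1 + S)" "cnj S = S" by (simp_all add: k_def S_def)
    have "cinner v v = (1 - k) * (1 - cnj k) * cinner z z - S * (1 - k) * cinner z w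
        - S * (1 - cnj k) * cinner w z + S * S * cinner w w"
      unfolding v cinner_simps complex_cnj_diff complex_cnj_one kc(2) by (simp add: algebra_simps)
    then show ?thesis
      unfolding zw x_def[symmetric] cinner_self Z kc(1) S_def[symmetric] k_def
      by (simp add: mult.assoc S_def)
  qed
  also have "\<dots> = (1 - x) * (1 - cnj x) - complex_of_real s * complex_of_real s * (1 - complex_of_real ((norm w)\<^sup>2))"
    using ne by (simp add: divide_simps) (simp add: algebra_simps)
  also have "\<dots> = complex_of_real ((cmod (1 - x))\<^sup>2 - s * s * defect w)"
    unfolding of_real_diff complex_norm_square by (simp add: defect_def)
  finally have "(norm v)\<^sup>2 = (cmod (1 - x))\<^sup>2 - s * s * defect w"
    by (metis cinner_self of_real_eq_iff)
  moreover have "ball_aut z w = (1 / (1 - x)) *s v"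
    using ball_aut_eq[OF assms(1)] by (simp add: v_def x_def s_def)
  ultimately have "(norm (ball_aut z w))\<^sup>2 = ((cmod (1 - x))\<^sup>2 - s * s * defect w) / (cmod (1 - x))\<^sup>2"
    by (simp add: norm_vec_smult norm_divide power_divide power_mult_distrib)
  then have "defect (ball_aut z w) = s * s * defect w / (cmod (1 - x))\<^sup>2"
    using xne by (simp add: defect_def field_simps)
  then show ?thesis by (simp add: s x_def cmod_one_minus_cinner_commute[of w z])
qed

lemma norm_ball_aut_less_1:
  assumes "norm z < 1" "norm w < 1"
  shows "norm (ball_aut z w) < 1"
proof -
  have "0 < defect (ball_aut z w)"
    using assms one_minus_cinner_bounds(1)[of z w] by (simp add: defect_ball_aut defect_pos)
  then have "(norm (ball_aut z w))\<^sup>2 < 1" by (simp add: defect_def)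
  then show ?thesis by (simp add: abs_square_less_1)
qed

text \<open>The definition splits at z = 0, so continuity is read off the formula of
  \<open>ball_aut_eq\<close>, whose denominators do not vanish on the ball.\<close>

lemma continuous_on_ball_aut [continuous_intros]:
  assumes "continuous_on S f" "continuous_on S g" "\<And>x. x \<in> S \<Longrightarrow> norm (f x) < 1" "\<And>x. x \<in> S \<Longrightarrow> norm (g x) \<le> 1"
  shows "continuous_on S (\<lambda>x. ball_aut (f x) (g x))"
proof (rule continuous_on_eq)
  let ?s = "\<lambda>x. complex_of_real (sqrt (defect (f x)))"
  have ne: "1 + ?s x \<noteq> 0" if "x \<in> S" for x
  proof -
    have "1 + sqrt (defect (f x)) > 0" using assms(3)[OF that] by (simp add: defect_pos add_pos_pos)
    then show ?thesis by (metis less_irrefl of_real_1 of_real_add of_real_eq_0_iff)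
  qed
  show "continuous_on S (\<lambda>x. (1 / (1 - cinner (g x) (f x))) *s (f x - ?s x *s g x - (cinner (g x) (f x) / (1 + ?s x)) *s f x))"
    using assms ne one_minus_cinner_bounds(2)[of "g _" "f _"] by (intro continuous_intros) (auto simp: less_imp_le)
qed (use assms in \<open>simp add: ball_aut_eq\<close>)

section \<open>Bergman balls\<close>

text \<open>Solving the logarithmic inequality for |phi_z(w)| identifies the Bergman ball as a
  pseudohyperbolic ball. Openness, measurability and size estimates all use this logarithm-free
  form.\<close>

lemma bergman_ball_iff:
  assumes "norm z < 1" "norm w < 1"
  shows "w \<in> bergman_ball z \<gamma> \<longleftrightarrow> norm (ball_aut z w) < tanh \<gamma>"
proof -
  let ?a = "norm (ball_aut z w)"
  have a: "0 \<le> ?a" "?a < 1" using norm_ball_aut_less_1[OF assms] by auto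
  have pos: "0 < (1 + ?a) / (1 - ?a)" by (intro divide_pos_pos) (use a in linarith)+
  have "bergman_metric z w < \<gamma> \<longleftrightarrow> ln ((1 + ?a) / (1 - ?a)) < ln (exp (2 * \<gamma>))"
    by (simp add: bergman_metric_def mult.commute)
  also have "\<dots> \<longleftrightarrow> (1 + ?a) / (1 - ?a) < exp (2 * \<gamma>)"
    using pos by (subst ln_less_cancel_iff) auto
  also have "\<dots> \<longleftrightarrow> ?a < (1 - exp (- 2 * \<gamma>)) / (1 + exp (- 2 * \<gamma>))"
  proof -
    define X where "X = exp (2 * \<gamma>)"
    have X: "X > 0" "exp (- 2 * \<gamma>) = 1 / X" by (simp_all add: X_def exp_minus field_simps)
    have "(1 - 1 / X) / (1 + 1 / X) = (X * (1 - 1 / X)) / (X * (1 + 1 / X))"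
      using X(1) by (intro mult_divide_mult_cancel_left[symmetric]) simp
    also have "\<dots> = (X - 1) / (X + 1)" using X(1) by (simp add: right_diff_distrib distrib_left)
    finally have "(1 - 1 / X) / (1 + 1 / X) = (X - 1) / (X + 1)" .
    moreover have "?a < (X - 1) / (X + 1) \<longleftrightarrow> (1 + ?a) / (1 - ?a) < X"
      using X(1) a by (simp add: pos_less_divide_eq pos_divide_less_eq algebra_simps)
    ultimately show ?thesis unfolding X(2) X_def[symmetric] by simp
  qed
  finally show ?thesis using assms by (simp add: bergman_ball_def tanh_real_altdef)
qed

lemma bergman_ball_0: "bergman_ball 0 \<gamma> = ball 0 (tanh \<gamma>)"
proof -
  have "tanh \<gamma> < 1" by (rule tanh_real_lt_1)
  moreover have "w \<in> bergman_ball 0 \<gamma> \<longleftrightarrow> norm w < tanh \<gamma>" if "norm w < 1" for w :: "complex ^ 'n"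
    using bergman_ball_iff[of 0 w \<gamma>] that by (simp add: ball_aut_def)
  moreover have "norm w < 1" if "w \<in> bergman_ball 0 \<gamma>" for w :: "complex ^ 'n"
    using that by (simp add: bergman_ball_def)
  ultimately show ?thesis by fastforce
qed

text \<open>With c = 1 - (tanh \<gamma>)^2, membership means c |1 - <z,w>|^2 <
  \<open>defect z * defect w\<close> by \<open>defect_ball_aut\<close>. Each defect is at most 2 |1
  - <z,w>|; cancelling one factor bounds c |1 - <z,w>| by twice either defect, and a second use
  compares the defects, whence the constant 4 / c.\<close>

lemma bergman_ball_geometry:
  assumes "\<gamma> > 0"
  obtains C where "C > 1" "\<And>z w. norm (z :: complex ^ 'n) < 1 \<Longrightarrow> w \<in> bergman_ball z \<gamma> \<Longrightarrow>
     norm w < 1 \<and> defect z \<le> C * defect w \<and> defect w \<le> C * defect z \<and> cmod (1 - cinner z w) \<le> C * defect w \<and> cmod (1 - cinner z w) \<le> C * defect z"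
proof
  define c where "c = 1 - (tanh \<gamma>)\<^sup>2"
  have "0 < tanh \<gamma>" "tanh \<gamma> < 1" using assms by (simp_all add: tanh_real_lt_1)
  then have c: "0 < c" "c < 1" by (simp_all add: c_def abs_square_less_1)
  show "4 / c > 1" using c by simp
  fix z w :: "complex ^ 'n" assume z: "norm z < 1" and w: "w \<in> bergman_ball z \<gamma>"
  then have w1: "norm w < 1" by (simp add: bergman_ball_def)
  let ?d = "cmod (1 - cinner z w)"
  have d0: "?d > 0" using one_minus_cinner_bounds(1)[of z w] z w1 by simp
  have "norm (ball_aut z w) < tanh \<gamma>" using bergman_ball_iff[OF z w1] w by simp
  then have "(norm (ball_aut z w))\<^sup>2 < (tanh \<gamma>)\<^sup>2" by (simp add: power_strict_mono)
  then have "c < defect z * defect w / ?d\<^sup>2"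
    using defect_ball_aut[of z w] z w1 by (simp add: c_def defect_def)
  then have *: "c * ?d\<^sup>2 < defect z * defect w" using d0 by (simp add: field_simps)
  have dz: "defect z \<le> 2 * ?d" and dw: "defect w \<le> 2 * ?d"
    using defect_le_cmod[of z w] z w1 by auto
  have pz: "0 < defect z" and pw: "0 < defect w" using z w1 by (simp_all add: defect_pos)
  have "c * ?d * ?d < 2 * defect w * ?d"
    using * mult_right_mono[OF dz, of "defect w"] pw unfolding power2_eq_square
    by (simp only: mult.assoc mult.commute mult.left_commute) linarith
  then have 1: "c * ?d < 2 * defect w" using d0 by simp
  have "c * ?d * ?d < 2 * defect z * ?d"
    using * mult_left_mono[OF dw, of "defect z"] pz unfolding power2_eq_square
    by (simp only: mult.assoc mult.commute mult.left_commute) linarith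
  then have 2: "c * ?d < 2 * defect z" using d0 by simp
  have 3: "c * defect z \<le> 2 * (c * ?d)" "c * defect w \<le> 2 * (c * ?d)"
    using dz dw c by (metis mult.left_commute mult_left_mono less_imp_le)+
  show "norm w < 1 \<and> defect z \<le> 4 / c * defect w \<and> defect w \<le> 4 / c * defect z \<and> ?d \<le> 4 / c * defect w \<and> ?d \<le> 4 / c * defect z"
  proof -
    have "c * defect z \<le> 4 * defect w" "c * defect w \<le> 4 * defect z" "c * ?d \<le> 4 * defect w" "c * ?d \<le> 4 * defect z"
      using 1 2 3 pz pw by linarith+
    then show ?thesis using w1 c by (simp add: le_divide_eq mult.commute)
  qed
qed

section \<open>Volumes of Carleson regions\<close>

lemma fmeasurable_lborel_bounded:
  "A \<in> sets borel \<Longrightarrow> bounded A \<Longrightarrow> A \<in> fmeasurable lborel" for A :: "'a::euclidean_space set"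
  using emeasure_bounded_finite[of A] by (intro fmeasurableI) simp_all

lemma borel_measurable_cinner [measurable (raw)]:
  assumes "f \<in> borel_measurable M" "g \<in> borel_measurable M"
  shows "(\<lambda>x. cinner (f x) (g x)) \<in> borel_measurable M"
  by (rule borel_measurable_continuous_Pair[OF assms]) (intro continuous_intros)

lemma borel_measurable_defect [measurable (raw)]:
  assumes "f \<in> borel_measurable M"
  shows "(\<lambda>x. defect (f x)) \<in> borel_measurable M"
  unfolding defect_def using assms by measurable

lemma power_powr_commute: "x \<ge> 0 \<Longrightarrow> (x ^ j) powr b = (x powr b) ^ j" for x b :: real
  by (induct j) (simp_all add: powr_mult)

lemma measure_lborel_translate:
  fixes A :: "'a::euclidean_space set"
  assumes "A \<in> sets borel"
  shows "measure lborel {x. x - c \<in> A} = measure lborel A"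
proof -
  have "measure lborel A = measure (distr lborel borel ((+) (- c))) A"
    by (simp add: lborel_distr_plus)
  also have "\<dots> = measure lborel {x. x - c \<in> A}"
    using assms by (subst measure_distr) (auto intro!: arg_cong[where f = "measure lborel"])
  finally show ?thesis ..
qed

lemma measure_lborel_scale:
  fixes A :: "'a::euclidean_space set"
  assumes A: "A \<in> sets borel" and r: "r > 0"
  shows "measure lborel {x. (1 / r) *\<^sub>R x \<in> A} = r ^ DIM('a) * measure lborel A"
proof -
  have "(lborel :: 'a measure) = density (distr lborel borel (\<lambda>x. 0 + (1 / r) *\<^sub>R x)) (\<lambda>_. ennreal (\<bar>1 / r\<bar> ^ DIM('a)))"
    by (rule lborel_affine) (use r in auto)
  then have "emeasure lborel A = emeasure (density (distr lborel borel (\<lambda>x::'a. (1 / r) *\<^sub>R x)) (\<lambda>_. ennreal ((1 / r) ^ DIM('a)))) A"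
    using r by simp
  also have "\<dots> = ennreal ((1 / r) ^ DIM('a)) * emeasure (distr lborel borel (\<lambda>x::'a. (1 / r) *\<^sub>R x)) A"
    using A by (subst emeasure_density) (auto simp: nn_integral_cmult)
  also have "emeasure (distr lborel borel (\<lambda>x::'a. (1 / r) *\<^sub>R x)) A = emeasure lborel {x. (1 / r) *\<^sub>R x \<in> A}"
    using A by (subst emeasure_distr) (auto intro!: arg_cong[where f = "emeasure lborel"])
  finally have "measure lborel A = (1 / r) ^ DIM('a) * measure lborel {x. (1 / r) *\<^sub>R x \<in> A}"
    using r by (simp add: measure_def enn2real_mult)
  then show ?thesis using r by (simp add: field_simps)
qed

text \<open>The counting step shared by the two packing arguments: the number of disjoint copies
  that fit into a set of known volume bounds the volume of a single copy from above.\<close>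

lemma disjoint_family_measure_le:
  assumes "finite I" "\<And>i. i \<in> I \<Longrightarrow> A i \<in> sets M" "disjoint_family_on A I"
    and "\<And>i. i \<in> I \<Longrightarrow> A i \<subseteq> B" and "B \<in> fmeasurable M" and "\<And>i. i \<in> I \<Longrightarrow> m \<le> measure M (A i)"
  shows "real (card I) * m \<le> measure M B"
proof -
  have fin: "A i \<in> fmeasurable M" if "i \<in> I" for i
    using that assms by (meson fmeasurableI2)
  have "real (card I) * m \<le> (\<Sum>i\<in>I. measure M (A i))"
    using sum_mono[OF assms(6), of I "\<lambda>i. i"] by simp
  also have "\<dots> = measure M (\<Union>i\<in>I. A i)"
    using assms fin by (intro measure_finite_Union[symmetric]) (auto simp: fmeasurable_def less_top)
  also have "\<dots> \<le> measure M B"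
    using assms by (intro measure_mono_fmeasurable) auto
  finally show ?thesis .
qed

text \<open>A Carleson region with its centre \<open>z\<close> inside the ball instead of on the
  sphere; for such \<open>z\<close> it is empty unless 1 - |z| < t.\<close>

definition carleson :: "complex ^ 'n \<Rightarrow> real \<Rightarrow> (complex ^ 'n) set" where
  "carleson z t = {u \<in> ball 0 1. cmod (1 - cinner z u) < t}"

lemma open_carleson: "open (carleson z t)"
proof -
  have "open {u. cmod (1 - cinner z u) < t}"
    by (intro open_Collect_less continuous_intros)
  then have "open (ball 0 1 \<inter> {u. cmod (1 - cinner z u) < t})" by (intro open_Int) auto
  then show ?thesis by (simp add: carleson_def Int_def)
qed

lemma borel_carleson [measurable]: "carleson z t \<in> sets borel"
  using open_carleson by (rule borel_open)

lemma carleson_subset: "carleson z t \<subseteq> ball 0 1"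
  by (auto simp: carleson_def)

lemma carleson_fmeasurable: "carleson z t \<in> fmeasurable lborel"
  by (rule fmeasurable_lborel_bounded[OF borel_carleson bounded_subset[OF bounded_ball carleson_subset]])

lemma power_even_sqrt: "t \<ge> 0 \<Longrightarrow> (c * sqrt t) ^ (2 * n) = (c\<^sup>2) ^ n * t ^ n"
  by (simp add: power_mult power_mult_distrib)

text \<open>Packing: the translates of a Carleson region by \<open>4 t m z\<close>, for the about \<open>1 / t\<close> Gaussian
  integers \<open>m\<close> of size \<open>1 / \<surd>t\<close>, are disjoint and lie in a ball of radius \<open>10 \<surd>t\<close>.\<close>
lemma measure_carleson_le:
  obtains C where "C > 0"
    "\<And>(z :: complex ^ 'n) t. norm z < 1 \<Longrightarrow> t > 0 \<Longrightarrow> measure lborel (carleson z t) \<le> C * t ^ (CARD('n) + 1)"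
proof
  let ?n = "CARD('n)"
  define V where "V = measure lborel (ball (0 :: complex ^ 'n) 1)"
  have V: "V > 0" by (simp add: V_def)
  have ball: "measure lborel (ball (c :: complex ^ 'n) r) = r ^ (2 * ?n) * V" if "r \<ge> 0" for c r
    using content_ball_conv_unit_ball[OF that, of c] by (simp add: V_def mult.commute)
  let ?C = "V * 4 ^ (?n + 1) + V * 100 ^ ?n"
  show "?C > 0" using V by (simp add: add_pos_pos)
  fix z :: "complex ^ 'n" and t :: real assume z: "norm z < 1" and t: "t > 0"
  let ?A = "carleson z t"
  show "measure lborel ?A \<le> ?C * t ^ (?n + 1)"
  \<comment> \<open>For large \<open>t\<close> the volume of the whole ball is good enough; this
    case accounts for the first summand of the constant.\<close>
  proof (cases "t > 1/4 \<or> ?A = {}")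
    case True
    then consider "t > 1/4" | "?A = {}" by blast
    then show ?thesis
    proof cases
      case 1
      then have "1 \<le> (4 * t) ^ (?n + 1)" by (intro one_le_power) simp
      have "measure lborel ?A \<le> V"
        unfolding V_def by (intro measure_mono_fmeasurable carleson_subset fmeasurable_lborel_bounded) auto
      also have "\<dots> \<le> V * (4 * t) ^ (?n + 1)" using V \<open>1 \<le> _\<close> by simp
      also have "\<dots> = V * 4 ^ (?n + 1) * t ^ (?n + 1)" by (simp only: power_mult_distrib mult.assoc)
      also have "\<dots> \<le> ?C * t ^ (?n + 1)" using V t by (intro mult_right_mono) auto
      finally show ?thesis .
    next
      case 2
      then show ?thesis using V t by simp
    qed
  next
    case False
    then obtain u0 where "u0 \<in> ?A" and t4: "t \<le> 1/4" by auto
    then have "1 - norm z < t" using defect_le_cmod(1)[of z u0] z by (auto simp: carleson_def)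
    \<comment> \<open>A nonempty small region forces \<open>z\<close> near the sphere, so a shift by
      a multiple of \<open>z\<close> really changes \<open>cinner z\<close>.\<close>
    then have z34: "norm z > 3/4" using t4 by simp
    have z916: "(norm z)\<^sup>2 \<ge> 9/16" using power_mono[of "3/4" "norm z" 2] z34 by (simp add: power2_eq_square)
    define M where "M = nat \<lfloor>1 / sqrt t\<rfloor>"
    have M: "real M \<le> 1 / sqrt t" "1 / sqrt t \<le> real M + 1"
      using t of_nat_floor[of "1 / sqrt t"] unfolding M_def by simp_all
    define c where "c = (\<lambda>(j::nat, k::nat). Complex (4 * t * real j) (4 * t * real k))"
    define I where "I = {0..M} \<times> {0..M}"
    define A where "A i = {x. x - c i *s z \<in> ?A}" for i
    have sep: "4 * t \<le> cmod (c i - c i')" if ne: "i \<noteq> i'" for i i'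
    proof -
      obtain j k j' k' where [simp]: "i = (j, k)" "i' = (j', k')" by fastforce
      have "1 \<le> \<bar>real j - real j'\<bar> \<or> 1 \<le> \<bar>real k - real k'\<bar>" using ne by auto
      then have "4 * t \<le> \<bar>4 * t * (real j - real j')\<bar> \<or> 4 * t \<le> \<bar>4 * t * (real k - real k')\<bar>"
        using t by (auto simp: abs_mult)
      moreover have "Re (c i - c i') = 4 * t * (real j - real j')" "Im (c i - c i') = 4 * t * (real k - real k')"
        by (simp_all add: c_def algebra_simps)
      ultimately show ?thesis
        using abs_Re_le_cmod[of "c i - c i'"] abs_Im_le_cmod[of "c i - c i'"] by argo
    qed
    have "real (card I) * measure lborel ?A \<le> measure lborel (ball z (10 * sqrt t))"
    proof (rule disjoint_family_measure_le)
      show "finite I" by (simp add: I_def)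
      show "A i \<in> sets lborel" for i
        unfolding A_def using measurable_sets[of "\<lambda>x. x - c i *s z" borel borel ?A] by (simp add: vimage_def)
      show "disjoint_family_on A I"
        unfolding disjoint_family_on_def
      proof (intro ballI impI, rule ccontr)
        fix i i' assume "i \<noteq> i'" "A i \<inter> A i' \<noteq> {}"
        then obtain x where x: "x - c i *s z \<in> ?A" "x - c i' *s z \<in> ?A" by (auto simp: A_def)
        then have "cmod ((1 - cinner z (x - c i *s z)) - (1 - cinner z (x - c i' *s z))) < 2 * t"
          using norm_triangle_ineq4[of "1 - cinner z (x - c i *s z)" "1 - cinner z (x - c i' *s z)"]
          by (auto simp: carleson_def)
        moreover have "(1 - cinner z (x - c i *s z)) - (1 - cinner z (x - c i' *s z)) = cnj (c i - c i') * complex_of_real ((norm z)\<^sup>2)"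
          by (simp add: cinner_simps cinner_self algebra_simps)
        ultimately have "cmod (c i - c i') * (norm z)\<^sup>2 < 2 * t"
          by (simp add: norm_mult norm_power del: complex_cnj_diff)
        \<comment> \<open>Spacing 4 t and |z|^2 >= 9/16 separate the values by 9/4 t, more than the
          2 t that a common point of two copies would allow.\<close>
        moreover have "4 * t * (9/16) \<le> cmod (c i - c i') * (norm z)\<^sup>2"
          using sep[OF \<open>i \<noteq> i'\<close>] z916 t by (intro mult_mono) auto
        ultimately show False using t by simp
      qed
      show "A i \<subseteq> ball z (10 * sqrt t)" if "i \<in> I" for i
      proof
        fix x assume "x \<in> A i"
        then have x: "norm (x - c i *s z) < 1" "cmod (1 - cinner z (x - c i *s z)) < t"
          by (auto simp: A_def carleson_def)
        have "(norm (z - (x - c i *s z)))\<^sup>2 \<le> (2 * sqrt t)\<^sup>2"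
          using norm_diff_square_le[of z "x - c i *s z"] x z t by (simp add: power_mult_distrib)
        then have 1: "norm (z - (x - c i *s z)) \<le> 2 * sqrt t"
          by (rule power2_le_imp_le) (use t in simp)
        obtain j k where ijk: "i = (j, k)" by (cases i)
        then have i: "i = (j, k)" "real j \<le> M" "real k \<le> M" using that by (simp_all add: I_def)
        have "cmod (c i) \<le> 4 * t * real j + 4 * t * real k"
          using cmod_le[of "c i"] t by (simp add: c_def i)
        also have "\<dots> \<le> 4 * t * (1 / sqrt t) + 4 * t * (1 / sqrt t)"
          using t M i by (intro add_mono mult_left_mono) auto
        also have "\<dots> = 8 * sqrt t" using t by (simp add: field_simps)
        finally have "norm (c i *s z) \<le> 8 * sqrt t * norm z"
          by (simp add: norm_vec_smult mult_right_mono)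
        also have "\<dots> < 8 * sqrt t" using z t by simp
        finally have "norm (z - x) < 10 * sqrt t"
          using 1 norm_triangle_ineq4[of "z - (x - c i *s z)" "c i *s z"] by simp
        then show "x \<in> ball z (10 * sqrt t)" by (simp add: dist_norm)
      qed
      show "ball z (10 * sqrt t) \<in> fmeasurable lborel"
        by (rule fmeasurable_lborel_bounded) auto
      show "measure lborel ?A \<le> measure lborel (A i)" for i
        unfolding A_def by (simp add: measure_lborel_translate)
    qed
    also have "\<dots> = V * 100 ^ ?n * t ^ ?n"
    proof -
      have "(10 :: real)\<^sup>2 = 100" by simp
      then have "(10 * sqrt t) ^ (2 * ?n) = 100 ^ ?n * t ^ ?n"
        using power_even_sqrt[of t 10 ?n] t by (simp only: less_imp_le)
      then show ?thesis using t by (subst ball) (simp_all only: mult.assoc mult.commute[of _ V] real_sqrt_ge_0_iff mult_nonneg_nonneg zero_le_numeral less_imp_le)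
    qed
    finally have 1: "real (card I) * measure lborel ?A \<le> V * 100 ^ ?n * t ^ ?n" .
    \<comment> \<open>The index set has (M + 1)^2 >= 1 / t elements. This count supplies the factor
      t beyond the t^n that comes from the ball of radius 10 sqrt t.\<close>
    have "1 / t = (1 / sqrt t)\<^sup>2" using t by (simp add: power_divide)
    also have "\<dots> \<le> (real M + 1)\<^sup>2" using M t by (intro power_mono) auto
    also have "\<dots> = real (card I)" by (simp add: I_def power2_eq_square algebra_simps)
    finally have "1 / t * measure lborel ?A \<le> real (card I) * measure lborel ?A"
      by (intro mult_right_mono) auto
    then have "1 / t * measure lborel ?A \<le> V * 100 ^ ?n * t ^ ?n" using 1 by (rule order_trans)
    then have "t * (1 / t * measure lborel ?A) \<le> t * (V * 100 ^ ?n * t ^ ?n)"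
      using t by (intro mult_left_mono) auto
    then have "measure lborel ?A \<le> V * 100 ^ ?n * t ^ (?n + 1)"
      using t by (simp add: mult.left_commute)
    also have "\<dots> \<le> ?C * t ^ (?n + 1)" using V t by (intro mult_right_mono) auto
    finally show ?thesis .
  qed
qed

text \<open>The layer of a Carleson region next to the sphere. Its volume controls integrals of
  \<open>defect u powr a\<close>, which is unbounded there when a < 0.\<close>

definition carleson_shell :: "complex ^ 'n \<Rightarrow> real \<Rightarrow> real \<Rightarrow> (complex ^ 'n) set" where
  "carleson_shell z t \<tau> = carleson z t \<inter> {u. defect u < \<tau>}"

lemma borel_carleson_shell [measurable]: "carleson_shell z t \<tau> \<in> sets borel"
proof -
  have "open {u :: complex ^ 'n. defect u < \<tau>}"
    by (intro open_Collect_less continuous_intros)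
  then show ?thesis unfolding carleson_shell_def by (intro sets.Int borel_carleson borel_open)
qed

lemma carleson_shell_fmeasurable: "carleson_shell z t \<tau> \<in> fmeasurable lborel"
  by (rule fmeasurable_lborel_bounded[OF borel_carleson_shell bounded_subset[OF bounded_ball[of 0 1]]])
    (auto simp: carleson_shell_def carleson_def)

text \<open>Packing again: the dilates of the shell by the powers of \<open>\<surd>(1 - \<tau>)\<close> are disjoint.\<close>
lemma measure_carleson_shell_le:
  obtains C where "C > 0"
    "\<And>(z :: complex ^ 'n) t \<tau>. norm z < 1 \<Longrightarrow> t > 0 \<Longrightarrow> \<tau> > 0 \<Longrightarrow>
       measure lborel (carleson_shell z t \<tau>) \<le> C * t ^ CARD('n) * \<tau>"
proof -
  let ?n = "CARD('n)"
  obtain C1 where C1: "C1 > 0"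
    "\<And>(z :: complex ^ 'n) t. norm z < 1 \<Longrightarrow> t > 0 \<Longrightarrow> measure lborel (carleson z t) \<le> C1 * t ^ (?n + 1)"
    using measure_carleson_le by blast
  let ?C = "3 * C1 + 16 * real ?n * 2 ^ (?n + 1) * C1"
  have n: "real ?n \<ge> 1" using zero_less_card_finite[where 'a='n] by linarith
  show ?thesis
  proof
    show "?C > 0" using C1 by (intro add_pos_nonneg) auto
    fix z :: "complex ^ 'n" and t \<tau> :: real assume z: "norm z < 1" and t0: "t > 0" and \<tau>: "\<tau> > 0"
    \<comment> \<open>Since |1 - <z,u>| <= 2 on the ball, the regions stop growing beyond size 3.
      The cap makes 1 - t' / 4 at least 1/4, the volume factor used for the dilates.\<close>
    define t' where "t' = min t 3"
    have t': "0 < t'" "t' \<le> 3" "t' \<le> t" using t0 by (auto simp: t'_def)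
    have shell_eq: "carleson_shell z t \<tau> = carleson_shell z t' \<tau>"
    proof -
      have "cmod (1 - cinner z u) < 3" if "norm u < 1" for u
        using one_minus_cinner_bounds(3)[of z u] z that by simp
      then show ?thesis by (auto simp: carleson_shell_def carleson_def t'_def)
    qed
    let ?A = "carleson_shell z t' \<tau>"
    have "measure lborel ?A \<le> ?C * t' ^ ?n * \<tau>"
    proof (cases "\<tau> \<ge> 1")
      case True
      have "measure lborel ?A \<le> measure lborel (carleson z t')"
        by (rule measure_mono_fmeasurable[OF _ _ carleson_fmeasurable]) (simp_all add: carleson_shell_def[of z t' \<tau>] borel_carleson_shell[unfolded carleson_shell_def])
      also have "\<dots> \<le> C1 * t' ^ (?n + 1)" by (rule C1(2)[OF z t'(1)])
      also have "\<dots> = C1 * t' ^ ?n * t'" by simp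
      also have "\<dots> \<le> C1 * t' ^ ?n * (3 * \<tau>)" using C1 t' True by (intro mult_left_mono) auto
      also have "\<dots> = 3 * C1 * (t' ^ ?n * \<tau>)" by simp
      also have "\<dots> \<le> ?C * (t' ^ ?n * \<tau>)" using C1 t' \<tau> by (intro mult_right_mono) auto
      finally show ?thesis by (simp only: mult.assoc)
    next
      case False
      define r where "r = sqrt (1 - \<tau>)"
      have r: "0 < r" "r < 1" "r\<^sup>2 = 1 - \<tau>" using False \<tau> by (auto simp: r_def)
      have r1: "1 - \<tau> \<le> r" using r by (metis less_imp_le mult_left_le power2_eq_square)
      \<comment> \<open>Chosen so that n k \<tau> <= t' / 4 for all k <= K. Then K + 1 dilations
        move 1 - <z,x> by at most t' / 4 each, hence stay in the region of size 2 t', and keep a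
        quarter of the volume.\<close>
      define K where "K = nat \<lfloor>t' / (4 * real ?n * \<tau>)\<rfloor>"
      have K0: "0 \<le> t' / (4 * real ?n * \<tau>)" using t' \<tau> by simp
      have K: "real K \<le> t' / (4 * real ?n * \<tau>)" "t' / (4 * real ?n * \<tau>) \<le> real (card {..K})"
        using K0 unfolding K_def by (simp_all, linarith+)
      have k\<tau>: "real ?n * real k * \<tau> \<le> t' / 4" if "k \<le> K" for k
      proof -
        have "real k \<le> t' / (4 * real ?n * \<tau>)" using that K by linarith
        then show ?thesis using n \<tau> by (simp add: field_simps)
      qed
      define A where "A k = {x. (1 / r ^ k) *\<^sub>R x \<in> ?A}" for k
      \<comment> \<open>The shell lies in r < |u| < 1, so its k-th dilate lies between the radii
        r^(k+1) and r^k; this is the disjointness.\<close>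
      have rng: "r * r ^ k < norm x \<and> norm x < r ^ k" if "x \<in> A k" for x k
      proof -
        let ?u = "(1 / r ^ k) *\<^sub>R x"
        have u: "norm ?u < 1" "defect ?u < \<tau>" using that by (auto simp: A_def carleson_shell_def carleson_def)
        then have "r\<^sup>2 < (norm ?u)\<^sup>2" by (simp add: defect_def r)
        then have "r < norm ?u" by (rule power2_less_imp_less) simp
        then show ?thesis using u r by (simp add: field_simps)
      qed
      have "real (card {..K}) * (1/4 * measure lborel ?A) \<le> measure lborel (carleson z (2 * t'))"
      proof (rule disjoint_family_measure_le)
        show "A k \<in> sets lborel" for k
          unfolding A_def using measurable_sets[of "\<lambda>x. (1 / r ^ k) *\<^sub>R x" borel borel ?A] by (simp add: vimage_def)
        show "disjoint_family_on A {..K}"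
          unfolding disjoint_family_on_def
        proof (intro ballI impI, rule ccontr)
          fix k l assume "k \<noteq> l" "A k \<inter> A l \<noteq> {}"
          then obtain x where x: "x \<in> A k" "x \<in> A l" by auto
          have False if "k < l" "x \<in> A k" "x \<in> A l" for k l
          proof -
            have "r ^ l \<le> r ^ Suc k" using that r by (intro power_decreasing) auto
            then show False using rng[OF that(2)] rng[OF that(3)] by simp
          qed
          then show False using x \<open>k \<noteq> l\<close> by (metis nat_neq_iff)
        qed
        show "A k \<subseteq> carleson z (2 * t')" if "k \<in> {..K}" for k
        proof
          fix x assume x: "x \<in> A k"
          let ?u = "(1 / r ^ k) *\<^sub>R x"
          have u: "norm ?u < 1" "cmod (1 - cinner z ?u) < t'" using x by (auto simp: A_def carleson_shell_def carleson_def)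
          have xu: "x = complex_of_real (r ^ k) *s ?u" using r by (simp add: scaleR_eq_smult)
          have "1 - real k * \<tau> \<le> (1 - \<tau>) ^ k"
            using Bernoulli_inequality[of "- \<tau>" k] False by simp
          also have "\<dots> \<le> r ^ k" using r1 False by (intro power_mono) auto
          finally have 1: "1 - r ^ k \<le> real k * \<tau>" by simp
          have "real k * \<tau> \<le> real ?n * (real k * \<tau>)" using n \<tau> mult_right_mono[OF n, of "real k * \<tau>"] by simp
          then have 2: "1 - r ^ k \<le> t' / 4" using 1 k\<tau>[of k] that by (simp add: mult.assoc)
          have rk: "r ^ k \<le> 1" "0 \<le> r ^ k" using r by (auto simp: power_le_one)
          have "1 - cinner z x = (1 - cinner z ?u) + complex_of_real (1 - r ^ k) * cinner z ?u"
            by (subst (1) xu) (simp add: cinner_simps algebra_simps del: of_real_power)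
          then have "cmod (1 - cinner z x) \<le> cmod (1 - cinner z ?u) + \<bar>1 - r ^ k\<bar> * cmod (cinner z ?u)"
            by (metis norm_mult norm_of_real norm_triangle_ineq)
          also have "\<dots> \<le> cmod (1 - cinner z ?u) + (1 - r ^ k) * 1"
            using cinner_cauchy_schwarz[of z ?u] z u rk mult_le_one[of "norm z" "norm ?u"]
            by (intro add_left_mono mult_mono) auto
          also have "\<dots> \<le> cmod (1 - cinner z ?u) + t' / 4"
            using 2 by (simp only: mult_1_right add_le_cancel_left)
          finally have 3: "cmod (1 - cinner z x) \<le> cmod (1 - cinner z ?u) + t' / 4" .
          have "A < 2 * T" if "A \<le> U + T / 4" "U < T" "0 < T" for A U T :: real
            using that by linarith
          from this[OF 3 u(2) t'(1)] have "cmod (1 - cinner z x) < 2 * t'" .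
          moreover have "norm x < 1" using rng[OF x] rk by linarith
          ultimately show "x \<in> carleson z (2 * t')" by (simp add: carleson_def)
        qed
        show "carleson z (2 * t') \<in> fmeasurable lborel" by (rule carleson_fmeasurable)
        show "1/4 * measure lborel ?A \<le> measure lborel (A k)" if "k \<in> {..K}" for k
        proof -
          have "measure lborel (A k) = (r ^ k) ^ (2 * ?n) * measure lborel ?A"
            unfolding A_def using r by (subst measure_lborel_scale) (auto simp: mult.commute)
          also have "(r ^ k) ^ (2 * ?n) = (1 - \<tau>) ^ (?n * k)"
            by (simp only: power_mult[symmetric] r(3)[symmetric]) (simp add: ac_simps)
          finally have 1: "measure lborel (A k) = (1 - \<tau>) ^ (?n * k) * measure lborel ?A" .
          \<comment> \<open>Dilation by r^k in real dimension 2 n multiplies volume by (1 -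
            \<tau>)^(n k), which Bernoulli's inequality bounds below by 1 - n k \<tau>.\<close>
          have "1/4 \<le> 1 - t' / 4" using t' by simp
          also have "\<dots> \<le> 1 - real (?n * k) * \<tau>" using k\<tau>[of k] that by simp
          also have "\<dots> \<le> (1 - \<tau>) ^ (?n * k)"
            using Bernoulli_inequality[of "- \<tau>" "?n * k"] False by simp
          finally show ?thesis unfolding 1 by (intro mult_right_mono) auto
        qed
      qed simp
      also have "\<dots> \<le> C1 * (2 * t') ^ (?n + 1)" by (rule C1(2)) (use z t' in auto)
      finally have 1: "real (card {..K}) * (1/4 * measure lborel ?A) \<le> C1 * (2 * t') ^ (?n + 1)" .
      have "t' / (4 * real ?n * \<tau>) * (1/4 * measure lborel ?A) \<le> real (card {..K}) * (1/4 * measure lborel ?A)"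
        using K(2) by (intro mult_right_mono) auto
      then have "t' / (4 * real ?n * \<tau>) * (1/4 * measure lborel ?A) \<le> C1 * 2 ^ (?n + 1) * t' ^ ?n * t'"
        using 1 by (simp add: power_mult_distrib algebra_simps)
      then have "t' * measure lborel ?A \<le> t' * (16 * real ?n * 2 ^ (?n + 1) * C1 * t' ^ ?n * \<tau>)"
        using \<tau> n by (simp add: field_simps)
      then have "measure lborel ?A \<le> 16 * real ?n * 2 ^ (?n + 1) * C1 * t' ^ ?n * \<tau>"
        using t' by simp
      also have "\<dots> \<le> ?C * t' ^ ?n * \<tau>" using C1 t' \<tau> by (intro mult_right_mono) auto
      finally show ?thesis .
    qed
    also have "\<dots> \<le> ?C * t ^ ?n * \<tau>"
      using C1 t' \<tau> by (intro mult_right_mono mult_left_mono power_mono) auto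
    finally show "measure lborel (carleson_shell z t \<tau>) \<le> ?C * t ^ ?n * \<tau>" by (simp add: shell_eq)
  qed
qed

section \<open>The Forelli-Rudin estimate\<close>

lemma dyadic_below:
  fixes x T :: real
  assumes "0 < x" "x < T"
  shows "\<exists>j. T / 2 ^ Suc j \<le> x \<and> x < T / 2 ^ j"
proof -
  have ex: "\<exists>j. T / 2 ^ j \<le> x"
  proof -
    obtain j where "(1/2) ^ j < x / T" using real_arch_pow_inv[of "x / T" "1/2"] assms by auto
    then show ?thesis using assms by (intro exI[of _ j]) (simp add: field_simps power_divide)
  qed
  define k where "k = (LEAST j. T / 2 ^ j \<le> x)"
  have k: "T / 2 ^ k \<le> x" unfolding k_def using ex by (rule LeastI_ex)
  then obtain j where j: "k = Suc j" using assms by (cases k) auto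
  have "\<not> T / 2 ^ j \<le> x" using not_less_Least[of j "\<lambda>j. T / 2 ^ j \<le> x"] j k_def by auto
  then show ?thesis using k j by auto
qed

lemma dyadic_above:
  fixes x T :: real
  assumes "0 < T" "T / 2 \<le> x"
  shows "\<exists>j. 2 ^ j * T / 2 \<le> x \<and> x < 2 ^ j * T"
proof -
  obtain m where "x / T < 2 ^ m" using real_arch_pow[of 2 "x / T"] by auto
  then have ex: "\<exists>j. x < 2 ^ j * T" using assms by (intro exI[of _ m]) (simp add: field_simps)
  define k where "k = (LEAST j. x < 2 ^ j * T)"
  have k: "x < 2 ^ k * T" unfolding k_def using ex by (rule LeastI_ex)
  have "2 ^ k * T / 2 \<le> x"
  proof (cases k)
    case 0 then show ?thesis using assms by simp
  next
    case (Suc j)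
    then have "\<not> x < 2 ^ j * T" using not_less_Least[of j "\<lambda>j. x < 2 ^ j * T"] k_def by auto
    then show ?thesis using Suc by simp
  qed
  then show ?thesis using k by blast
qed

text \<open>The function is dominated by the sum of \<open>c j\<close> times the indicator of
  \<open>A j\<close>. The layers only have to cover its support; overlaps merely enlarge the sum, so
  whole regions may be used instead of their differences.\<close>

lemma nn_integral_le_geometric_layers:
  assumes A: "\<And>j::nat. A j \<in> sets M" and q: "0 \<le> q" "q < 1" and B: "B \<ge> 0"
    and f: "\<And>x. x \<in> space M \<Longrightarrow> f x \<noteq> 0 \<Longrightarrow> \<exists>j. x \<in> A j \<and> f x \<le> c j"
    and m: "\<And>j. c j * emeasure M (A j) \<le> ennreal (B * q ^ j)"
  shows "(\<integral>\<^sup>+x. f x \<partial>M) \<le> ennreal (B / (1 - q))"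
proof -
  have "f x \<le> (\<Sum>j. c j * indicator (A j) x)" if "x \<in> space M" for x
  proof (cases "f x = 0")
    case False
    then obtain j where j: "x \<in> A j" "f x \<le> c j" using f \<open>x \<in> space M\<close> by blast
    have "c j * indicator (A j) x = sum (\<lambda>j. c j * indicator (A j) x) {j}" by (subst sum.insert) auto
    also have "\<dots> \<le> (\<Sum>j. c j * indicator (A j) x)" by (intro sum_le_suminf summableI) auto
    finally show ?thesis using j by (auto intro: order_trans)
  qed simp
  then have "(\<integral>\<^sup>+x. f x \<partial>M) \<le> (\<integral>\<^sup>+x. (\<Sum>j. c j * indicator (A j) x) \<partial>M)"
    by (rule nn_integral_mono)
  also have "\<dots> = (\<Sum>j. c j * emeasure M (A j))"
    using A by (subst nn_integral_suminf) (auto simp: nn_integral_cmult)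
  also have "\<dots> \<le> (\<Sum>j. ennreal (B * q ^ j))"
    using m by (intro suminf_le summableI) auto
  also have "\<dots> = ennreal (B * (1 / (1 - q)))"
    using q B by (intro suminf_ennreal_eq sums_mult geometric_sums) auto
  finally show ?thesis by simp
qed

text \<open>Split dyadically by distance to the sphere. The shell of thickness \<tau> contributes a
  constant times \<tau>^a t^n \<tau>, and \<tau>^(a+1) is geometrically summable exactly because a >
  -1.\<close>

lemma nn_integral_carleson_le:
  fixes a :: real
  assumes a: "a > -1"
  obtains C where "C > 0"
    "\<And>(z :: complex ^ 'n) t. norm z < 1 \<Longrightarrow> t > 0 \<Longrightarrow>
      (\<integral>\<^sup>+u. ennreal (defect u powr a) * indicator (carleson z t) u \<partial>lborel) \<le> ennreal (C * t powr (real CARD('n) + 1 + a))"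
proof -
  let ?n = "CARD('n)"
  obtain C2 where C2: "C2 > 0"
    "\<And>(z :: complex ^ 'n) t \<tau>. norm z < 1 \<Longrightarrow> t > 0 \<Longrightarrow> \<tau> > 0 \<Longrightarrow>
       measure lborel (carleson_shell z t \<tau>) \<le> C2 * t ^ ?n * \<tau>"
    using measure_carleson_shell_le by blast
  \<comment> \<open>On a layer \<tau> / 2 <= \<open>defect u\<close> < \<tau>; the summand 1 serves
    a >= 0 and 2 powr (- a) serves a < 0.\<close>
  define Ca where "Ca = 1 + 2 powr (- a)"
  have Ca: "Ca > 0" by (simp add: Ca_def add_pos_pos)
  define q :: real where "q = 2 powr (- (a + 1))"
  have q: "0 \<le> q" "q < 1" using a powr_less_mono[of "- (a + 1)" 0 2] by (simp_all add: q_def)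
  let ?C = "Ca * C2 * 2 powr (a + 1) / (1 - q)"
  show ?thesis
  proof
    show "?C > 0" using Ca C2 q by simp
    fix z :: "complex ^ 'n" and t :: real assume z: "norm z < 1" and t: "t > 0"
    \<comment> \<open>The starting thickness 2 t covers the region, as \<open>defect u\<close> <= 2
      |1 - <z,u>| < 2 t there.\<close>
    define \<tau> where "\<tau> j = 2 * t / 2 ^ j" for j :: nat
    have \<tau>: "\<tau> j > 0" for j using t by (simp add: \<tau>_def)
    let ?B = "Ca * C2 * t ^ ?n * (2 * t) powr (a + 1)"
    have "(\<integral>\<^sup>+u. ennreal (defect u powr a) * indicator (carleson z t) u \<partial>lborel) \<le> ennreal (?B / (1 - q))"
    proof (rule nn_integral_le_geometric_layers[where A = "\<lambda>j. carleson_shell z t (\<tau> j)" and c = "\<lambda>j. ennreal (Ca * \<tau> j powr a)"])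
      show "?B \<ge> 0" using Ca C2 t by simp
      fix u assume "ennreal (defect u powr a) * indicator (carleson z t) u \<noteq> 0"
      then have uc: "u \<in> carleson z t" by (auto simp: indicator_def split: if_splits)
      then have u: "norm u < 1" "cmod (1 - cinner z u) < t" by (auto simp: carleson_def)
      have "0 < defect u" "defect u < 2 * t"
        using u z defect_le_cmod(4)[of z u] by (auto simp: defect_pos)
      then obtain j where j: "2 * t / 2 ^ Suc j \<le> defect u" "defect u < 2 * t / 2 ^ j"
        using dyadic_below by blast
      have "defect u powr a \<le> Ca * \<tau> j powr a"
      proof (cases "a \<ge> 0")
        case True
        then have "defect u powr a \<le> \<tau> j powr a" using j \<open>0 < defect u\<close> by (intro powr_mono2) (auto simp: \<tau>_def)
        also have "\<dots> \<le> Ca * \<tau> j powr a" by (simp add: Ca_def algebra_simps)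
        finally show ?thesis .
      next
        case False
        then have "defect u powr a \<le> (\<tau> j / 2) powr a" using j \<tau>[of j] by (intro powr_mono2') (auto simp: \<tau>_def)
        also have "\<dots> = 2 powr (- a) * \<tau> j powr a" using \<tau>[of j] by (simp add: powr_divide powr_minus field_simps)
        also have "\<dots> \<le> Ca * \<tau> j powr a" by (simp add: Ca_def algebra_simps)
        finally show ?thesis .
      qed
      then show "\<exists>j. u \<in> carleson_shell z t (\<tau> j) \<and> ennreal (defect u powr a) * indicator (carleson z t) u \<le> ennreal (Ca * \<tau> j powr a)"
        using uc j by (intro exI[of _ j]) (auto simp: carleson_shell_def \<tau>_def intro: ennreal_leI)
    next
      fix j
      have "emeasure lborel (carleson_shell z t (\<tau> j)) = ennreal (measure lborel (carleson_shell z t (\<tau> j)))"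
        using carleson_shell_fmeasurable by (rule emeasure_eq_measure2)
      also have "\<dots> \<le> ennreal (C2 * t ^ ?n * \<tau> j)"
        by (intro ennreal_leI C2(2) z t \<tau>)
      finally have "ennreal (Ca * \<tau> j powr a) * emeasure lborel (carleson_shell z t (\<tau> j)) \<le> ennreal (Ca * \<tau> j powr a) * ennreal (C2 * t ^ ?n * \<tau> j)"
        by (rule mult_left_mono) simp
      also have "\<dots> = ennreal (Ca * \<tau> j powr a * (C2 * t ^ ?n * \<tau> j))"
        using Ca C2 t \<tau>[of j] by (simp add: ennreal_mult)
      also have "Ca * \<tau> j powr a * (C2 * t ^ ?n * \<tau> j) = Ca * C2 * t ^ ?n * \<tau> j powr (a + 1)"
        using \<tau>[of j] by (simp add: powr_add)
      also have "\<tau> j powr (a + 1) = (2 * t) powr (a + 1) * q ^ j"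
      proof -
        have 1: "\<tau> j = (2 * t) * (1 / 2) ^ j" by (simp add: \<tau>_def power_divide)
        have 2: "(1 / 2) powr (a + 1) = q"
          unfolding q_def by (subst powr_minus_divide) (simp add: powr_divide)
        have 3: "((1 / 2) ^ j) powr (a + 1) = q ^ j"
          using power_powr_commute[of "1 / 2" j "a + 1"] unfolding 2 by simp
        have "((2 * t) * (1 / 2) ^ j) powr (a + 1) = (2 * t) powr (a + 1) * ((1 / 2) ^ j) powr (a + 1)"
          using t by (intro powr_mult)
        then show ?thesis unfolding 1 3 .
      qed
      finally show "ennreal (Ca * \<tau> j powr a) * emeasure lborel (carleson_shell z t (\<tau> j)) \<le> ennreal (?B * q ^ j)"
        by (simp add: mult.assoc)
    qed (use q in auto)
    also have "?B / (1 - q) = ?C * t powr (real ?n + 1 + a)"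
    proof -
      have "t powr (real ?n + 1 + a) = t ^ ?n * t powr (a + 1)"
        using t by (simp add: powr_add powr_realpow)
      then show ?thesis using t by (simp add: powr_mult)
    qed
    finally show "(\<integral>\<^sup>+u. ennreal (defect u powr a) * indicator (carleson z t) u \<partial>lborel) \<le> ennreal (?C * t powr (real ?n + 1 + a))" .
  qed
qed

text \<open>Let d = \<open>defect z\<close>, so that |1 - <z,u>| >= d / 2 throughout. Where |1 -
  <z,u>| is about 2^j d, the kernel has size (2^j d)^-(n+1+b) and the weighted volume is of order
  (2^j d)^(n+1+a); the products (2^j d)^(a-b) are summable because a < b.\<close>

lemma forelli_rudin:
  fixes a b :: real
  assumes a: "a > -1" and ab: "a < b"
  obtains C where "C > 0"
    "\<And>z :: complex ^ 'n. norm z < 1 \<Longrightarrow>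
      (\<integral>\<^sup>+u. ennreal (defect u powr a / cmod (1 - cinner z u) powr (real CARD('n) + 1 + b)) * indicator (ball 0 1) u \<partial>lborel)
        \<le> ennreal (C * defect z powr (a - b))"
proof -
  let ?n = "CARD('n)"
  obtain C3 where C3: "C3 > 0"
    "\<And>(z :: complex ^ 'n) t. norm z < 1 \<Longrightarrow> t > 0 \<Longrightarrow>
      (\<integral>\<^sup>+u. ennreal (defect u powr a) * indicator (carleson z t) u \<partial>lborel) \<le> ennreal (C3 * t powr (real CARD('n) + 1 + a))"
    using nn_integral_carleson_le[OF a] by blast
  define N where "N = real ?n + 1 + b"
  have N: "N > 0" using a ab by (simp add: N_def)
  define q :: real where "q = 2 powr (a - b)"
  have q: "0 \<le> q" "q < 1" using ab powr_less_mono[of "a - b" 0 2] by (simp_all add: q_def)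
  let ?C = "2 powr N * C3 / (1 - q)"
  \<comment> \<open>The weight is absorbed into the measure, so that
    \<open>nn_integral_carleson_le\<close> becomes a bound on the measure of the layers.\<close>
  define M :: "(complex ^ 'n) measure" where "M = density lborel (\<lambda>u. ennreal (defect u powr a))"
  have emM: "emeasure M A = (\<integral>\<^sup>+u. ennreal (defect u powr a) * indicator A u \<partial>lborel)" if "A \<in> sets borel" for A
    unfolding M_def using that by (subst emeasure_density) auto
  show ?thesis
  proof
    show "?C > 0" using C3 q by simp
    fix z :: "complex ^ 'n" assume z: "norm z < 1"
    define d where "d = defect z"
    have d: "d > 0" using z by (simp add: d_def defect_pos)
    let ?B = "2 powr N * C3 * d powr (a - b)"
    let ?f = "\<lambda>u. ennreal (1 / cmod (1 - cinner z u) powr N) * indicator (ball 0 1) u"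
    have "(\<integral>\<^sup>+u. ennreal (defect u powr a / cmod (1 - cinner z u) powr N) * indicator (ball 0 1) u \<partial>lborel) = (\<integral>\<^sup>+u. ?f u \<partial>M)"
    proof -
      have [measurable]: "ball (0 :: complex ^ 'n) 1 \<in> sets borel" by simp
      have "?f \<in> borel_measurable lborel" by measurable
      then show ?thesis
        unfolding M_def
        by (subst nn_integral_density) (auto intro!: nn_integral_cong simp: ennreal_mult[symmetric] mult.assoc[symmetric])
    qed
    also have "\<dots> \<le> ennreal (?B / (1 - q))"
    proof (rule nn_integral_le_geometric_layers[where A = "\<lambda>j. carleson z (2 ^ j * d)" and c = "\<lambda>j. ennreal (1 / (2 ^ j * d / 2) powr N)"])
      show "?B \<ge> 0" using C3 d by simp
      show "carleson z (2 ^ j * d) \<in> sets M" for j by (simp add: M_def)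
      fix u assume "?f u \<noteq> 0"
      then have u: "norm u < 1" by (auto simp: indicator_def split: if_splits)
      then have "d / 2 \<le> cmod (1 - cinner z u)" using defect_le_cmod(3)[of z u] z by (simp add: d_def)
      then obtain j where j: "2 ^ j * d / 2 \<le> cmod (1 - cinner z u)" "cmod (1 - cinner z u) < 2 ^ j * d"
        using dyadic_above[OF d] by blast
      have "1 / cmod (1 - cinner z u) powr N \<le> 1 / (2 ^ j * d / 2) powr N"
      proof -
        have pos: "0 < 2 ^ j * d / 2" using d by simp
        then have "0 < cmod (1 - cinner z u)" using j(1) by linarith
        then have "0 < (2 ^ j * d / 2) powr N" "0 < cmod (1 - cinner z u) powr N" using pos by auto
        then show ?thesis using pos j(1) N by (intro divide_left_mono powr_mono2 mult_pos_pos) auto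
      qed
      then show "\<exists>j. u \<in> carleson z (2 ^ j * d) \<and> ?f u \<le> ennreal (1 / (2 ^ j * d / 2) powr N)"
        using u j by (intro exI[of _ j]) (auto simp: carleson_def intro: ennreal_leI)
    next
      fix j :: nat
      have td: "2 ^ j * d > 0" using d by simp
      have "ennreal (1 / (2 ^ j * d / 2) powr N) * emeasure M (carleson z (2 ^ j * d)) \<le>
          ennreal (1 / (2 ^ j * d / 2) powr N) * ennreal (C3 * (2 ^ j * d) powr (real ?n + 1 + a))"
        using C3(2)[OF z td] by (intro mult_left_mono) (auto simp: emM)
      also have "\<dots> = ennreal (1 / (2 ^ j * d / 2) powr N * (C3 * (2 ^ j * d) powr (real ?n + 1 + a)))"
        using C3(1) by (subst ennreal_mult[symmetric]) auto
      also have "1 / (2 ^ j * d / 2) powr N * (C3 * (2 ^ j * d) powr (real ?n + 1 + a)) = 2 powr N * C3 * (2 ^ j * d) powr (a - b)"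
      proof -
        have "(2 ^ j * d) powr (real ?n + 1 + a) = (2 ^ j * d) powr N * (2 ^ j * d) powr (a - b)"
        proof -
          have "real ?n + 1 + a = N + (a - b)" by (simp add: N_def)
          then show ?thesis by (simp only: powr_add)
        qed
        moreover have "(2 ^ j * d / 2) powr N = (2 ^ j * d) powr N / 2 powr N"
          using d by (simp add: powr_divide)
        ultimately show ?thesis using d by simp
      qed
      also have "(2 ^ j * d) powr (a - b) = d powr (a - b) * q ^ j"
      proof -
        have "(2 ^ j) powr (a - b) = q ^ j"
          by (simp add: q_def power_powr_commute)
        then show ?thesis using d by (simp add: powr_mult)
      qed
      finally show "ennreal (1 / (2 ^ j * d / 2) powr N) * emeasure M (carleson z (2 ^ j * d)) \<le> ennreal (?B * q ^ j)"
        by (simp add: mult.assoc)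
    qed (use q in auto)
    finally show "(\<integral>\<^sup>+u. ennreal (defect u powr a / cmod (1 - cinner z u) powr (real CARD('n) + 1 + b)) * indicator (ball 0 1) u \<partial>lborel)
        \<le> ennreal (?C * defect z powr (a - b))"
      by (simp add: N_def d_def)
  qed
qed

section \<open>Weighted measures on the ball\<close>

lemma space_vol_ball [simp]: "space (vol_ball :: (complex ^ 'n) measure) = ball 0 1"
  by (simp add: vol_ball_def space_restrict_space)

lemma sets_vol_ball: "sets (vol_ball :: (complex ^ 'n) measure) = sets (restrict_space borel (ball 0 1))"
  unfolding vol_ball_def by (rule sets_restrict_space_cong) simp

lemma space_weighted [simp]:
  "space (vol_weighted \<alpha> :: (complex ^ 'n) measure) = ball 0 1"
  "space (inv_measure :: (complex ^ 'n) measure) = ball 0 1"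
  "space (tent_measure \<gamma> :: (complex ^ 'n) measure) = ball 0 1"
  by (simp_all add: vol_weighted_def inv_measure_def tent_measure_def)

lemma sets_weighted:
  "sets (vol_weighted \<alpha> :: (complex ^ 'n) measure) = sets (restrict_space borel (ball 0 1))"
  "sets (inv_measure :: (complex ^ 'n) measure) = sets (restrict_space borel (ball 0 1))"
  "sets (tent_measure \<gamma> :: (complex ^ 'n) measure) = sets (restrict_space borel (ball 0 1))"
  by (simp_all add: vol_weighted_def inv_measure_def tent_measure_def sets_vol_ball)

text \<open>All these measures share the Borel sets of the ball, so measurability proved for one of
  them transfers to the others.\<close>

lemma measurable_weighted_eq:
  "measurable (vol_weighted \<alpha> :: (complex ^ 'n) measure) N = measurable (restrict_space borel (ball 0 1)) N"
  "measurable (inv_measure :: (complex ^ 'n) measure) N = measurable (restrict_space borel (ball 0 1)) N"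
  "measurable (tent_measure \<gamma> :: (complex ^ 'n) measure) N = measurable (restrict_space borel (ball 0 1)) N"
  "measurable (vol_ball :: (complex ^ 'n) measure) N = measurable (restrict_space borel (ball 0 1)) N"
  by (simp_all add: measurable_def sets_weighted sets_vol_ball space_restrict_space)

lemma borel_measurable_id_restrict: "(\<lambda>x. x) \<in> borel_measurable (restrict_space borel A)"
  by (intro measurable_restrict_space1) simp

lemma borel_measurable_id_weighted:
  "(\<lambda>x. x) \<in> borel_measurable (vol_weighted \<alpha> :: (complex ^ 'n) measure)"
  "(\<lambda>x. x) \<in> borel_measurable (inv_measure :: (complex ^ 'n) measure)"
  "(\<lambda>x. x) \<in> borel_measurable (tent_measure \<gamma> :: (complex ^ 'n) measure)"
  "(\<lambda>x. x) \<in> borel_measurable (vol_ball :: (complex ^ 'n) measure)"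
  by (simp_all add: measurable_weighted_eq borel_measurable_id_restrict)

lemma nn_integral_vol_ball:
  fixes g :: "complex ^ 'n \<Rightarrow> ennreal"
  assumes "g \<in> borel_measurable (restrict_space borel (ball 0 1))"
  shows "(\<integral>\<^sup>+u. g u \<partial>vol_ball) =
    ennreal (1 / measure lborel (ball (0 :: complex ^ 'n) 1)) * (\<integral>\<^sup>+u. g u * indicator (ball 0 1) u \<partial>lborel)"
proof -
  let ?B = "ball (0 :: complex ^ 'n) 1"
  have g: "(\<lambda>u. g u * indicator ?B u) \<in> borel_measurable borel"
    using assms by (simp add: borel_measurable_restrict_space_iff_ennreal)
  have V: "0 < measure lborel ?B" by simp
  have "emeasure lborel ?B = ennreal (measure lborel ?B)"
    by (rule emeasure_eq_measure2[OF fmeasurable_lborel_bounded]) auto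
  then have inv: "x / emeasure lborel ?B = ennreal (1 / measure lborel ?B) * x" for x
    using V by (simp add: divide_ennreal_def inverse_ennreal mult.commute divide_inverse)
  have "(\<integral>\<^sup>+u. g u \<partial>vol_ball) = (\<integral>\<^sup>+u. g u * indicator ?B u \<partial>uniform_measure lborel ?B)"
    unfolding vol_ball_def by (subst nn_integral_restrict_space) auto
  also have "\<dots> = (\<integral>\<^sup>+u. g u * indicator ?B u * indicator ?B u \<partial>lborel) / emeasure lborel ?B"
    using g by (subst nn_integral_uniform_measure) auto
  also have "(\<lambda>u. g u * indicator ?B u * indicator ?B u) = (\<lambda>u. g u * indicator ?B u)"
    by (auto simp: indicator_def)
  finally show ?thesis by (simp add: inv)
qed

lemma weight_const_pos: "\<alpha> > -1 \<Longrightarrow> weight_const n \<alpha> > 0"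
  unfolding weight_const_def by (intro divide_pos_pos mult_pos_pos Gamma_real_pos) auto

text \<open>The full factor between dv_\<alpha> and \<open>defect powr \<alpha>\<close> times
  Lebesgue measure, including the normalisation of dv; the type argument supplies the
  dimension.\<close>

definition weighted_const :: "'n::finite itself \<Rightarrow> real \<Rightarrow> real" where
  "weighted_const n \<alpha> = weight_const CARD('n) \<alpha> / measure lborel (ball (0 :: complex ^ 'n) 1)"

lemma weighted_const_pos: "\<alpha> > -1 \<Longrightarrow> weighted_const TYPE('n::finite) \<alpha> > 0"
  by (simp add: weighted_const_def weight_const_pos)

lemma nn_integral_vol_weighted:
  fixes g :: "complex ^ 'n \<Rightarrow> ennreal"
  assumes \<alpha>: "\<alpha> > -1" and g: "g \<in> borel_measurable (vol_weighted \<alpha>)"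
  shows "(\<integral>\<^sup>+u. g u \<partial>vol_weighted \<alpha>) =
    ennreal (weighted_const TYPE('n) \<alpha>) * (\<integral>\<^sup>+u. ennreal (defect u powr \<alpha>) * g u * indicator (ball 0 1) u \<partial>lborel)"
proof -
  let ?R = "restrict_space borel (ball (0 :: complex ^ 'n) 1)"
  note [measurable] = borel_measurable_id_restrict
  have c: "weight_const CARD('n) \<alpha> > 0" using \<alpha> by (rule weight_const_pos)
  have [measurable]: "g \<in> borel_measurable ?R" using g by (simp add: measurable_weighted_eq)
  have [measurable]: "(\<lambda>u. ennreal (weight_const CARD('n) \<alpha> * defect u powr \<alpha>)) \<in> borel_measurable ?R"
    by measurable
  have gB: "(\<lambda>u. ennreal (defect u powr \<alpha>) * g u * indicator (ball 0 1) u) \<in> borel_measurable lborel"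
    using borel_measurable_restrict_space_iff_ennreal[of "ball 0 1" borel "\<lambda>u. ennreal (defect u powr \<alpha>) * g u"] by simp
  have "(\<integral>\<^sup>+u. g u \<partial>vol_weighted \<alpha>) = (\<integral>\<^sup>+u. ennreal (weight_const CARD('n) \<alpha> * defect u powr \<alpha>) * g u \<partial>vol_ball)"
    unfolding vol_weighted_def defect_def[symmetric]
    by (subst nn_integral_density) (simp_all add: measurable_weighted_eq)
  also have "\<dots> = ennreal (1 / measure lborel (ball (0 :: complex ^ 'n) 1)) * (\<integral>\<^sup>+u. ennreal (weight_const CARD('n) \<alpha> * defect u powr \<alpha>) * g u * indicator (ball 0 1) u \<partial>lborel)"
    by (rule nn_integral_vol_ball) measurable
  also have "(\<lambda>u. ennreal (weight_const CARD('n) \<alpha> * defect u powr \<alpha>) * g u * indicator (ball 0 1) u)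
      = (\<lambda>u. ennreal (weight_const CARD('n) \<alpha>) * (ennreal (defect u powr \<alpha>) * g u * indicator (ball 0 1) u))"
    using c by (simp add: ennreal_mult mult.assoc)
  also have "(\<integral>\<^sup>+u. ennreal (weight_const CARD('n) \<alpha>) * (ennreal (defect u powr \<alpha>) * g u * indicator (ball 0 1) u) \<partial>lborel)
      = ennreal (weight_const CARD('n) \<alpha>) * (\<integral>\<^sup>+u. ennreal (defect u powr \<alpha>) * g u * indicator (ball 0 1) u \<partial>lborel)"
    using gB by (rule nn_integral_cmult)
  finally show ?thesis
    using c by (simp add: weighted_const_def mult.assoc[symmetric] ennreal_mult[symmetric])
qed

lemma nn_integral_inv_measure:
  fixes g :: "complex ^ 'n \<Rightarrow> ennreal"
  assumes g: "g \<in> borel_measurable inv_measure"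
  shows "(\<integral>\<^sup>+u. g u \<partial>inv_measure) =
    ennreal (1 / measure lborel (ball (0 :: complex ^ 'n) 1)) *
      (\<integral>\<^sup>+u. ennreal (1 / defect u ^ (CARD('n) + 1)) * g u * indicator (ball 0 1) u \<partial>lborel)"
proof -
  let ?R = "restrict_space borel (ball (0 :: complex ^ 'n) 1)"
  note [measurable] = borel_measurable_id_restrict
  have [measurable]: "g \<in> borel_measurable ?R" using g by (simp add: measurable_weighted_eq)
  have [measurable]: "(\<lambda>u. ennreal (1 / defect u ^ (CARD('n) + 1))) \<in> borel_measurable ?R"
    by measurable
  have "(\<integral>\<^sup>+u. g u \<partial>inv_measure) = (\<integral>\<^sup>+u. ennreal (1 / defect u ^ (CARD('n) + 1)) * g u \<partial>vol_ball)"
    unfolding inv_measure_def defect_def[symmetric]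
    by (subst nn_integral_density) (simp_all only: measurable_weighted_eq, measurable)
  also have "\<dots> = ennreal (1 / measure lborel (ball (0 :: complex ^ 'n) 1)) * (\<integral>\<^sup>+u. ennreal (1 / defect u ^ (CARD('n) + 1)) * g u * indicator (ball 0 1) u \<partial>lborel)"
    by (rule nn_integral_vol_ball) measurable
  finally show ?thesis .
qed

text \<open>The Carleson region with centre 0 and size 2 is the whole ball, so finiteness is a
  special case of the weighted Carleson estimate.\<close>

lemma finite_measure_vol_weighted:
  assumes \<alpha>: "\<alpha> > -1"
  shows "finite_measure (vol_weighted \<alpha> :: (complex ^ 'n) measure)"
proof (rule finite_measureI)
  let ?M = "vol_weighted \<alpha> :: (complex ^ 'n) measure"
  obtain C where C: "C > 0"
    "\<And>(z :: complex ^ 'n) t. norm z < 1 \<Longrightarrow> t > 0 \<Longrightarrow>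
      (\<integral>\<^sup>+u. ennreal (defect u powr \<alpha>) * indicator (carleson z t) u \<partial>lborel) \<le> ennreal (C * t powr (real CARD('n) + 1 + \<alpha>))"
    using nn_integral_carleson_le[OF \<alpha>] by blast
  have "(carleson 0 2 :: (complex ^ 'n) set) = ball 0 1" by (auto simp: carleson_def cinner_simps)
  then have le: "(\<integral>\<^sup>+u. ennreal (defect u powr \<alpha>) * indicator (ball (0 :: complex ^ 'n) 1) u \<partial>lborel) \<le> ennreal (C * 2 powr (real CARD('n) + 1 + \<alpha>))"
    using C(2)[of 0 2] by simp
  have "emeasure ?M (space ?M) = (\<integral>\<^sup>+u. 1 \<partial>?M)" by simp
  also have "\<dots> = ennreal (weighted_const TYPE('n) \<alpha>) * (\<integral>\<^sup>+u. ennreal (defect u powr \<alpha>) * 1 * indicator (ball (0 :: complex ^ 'n) 1) u \<partial>lborel)"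
    using \<alpha> by (subst nn_integral_vol_weighted) auto
  also have "\<dots> < \<infinity>"
    using le_less_trans[OF le] by (simp add: ennreal_mult_less_top)
  finally show "emeasure ?M (space ?M) \<noteq> \<infinity>" by simp
qed

text \<open>The density is finite everywhere on the ball and dv is finite. Sigma-finiteness is what
  makes the area function measurable in \<open>z\<close>.\<close>

lemma sigma_finite_inv_measure: "sigma_finite_measure (inv_measure :: (complex ^ 'n) measure)"
proof -
  note [measurable] = borel_measurable_id_restrict
  interpret V: finite_measure "vol_ball :: (complex ^ 'n) measure"
  proof (rule finite_measureI)
    have "emeasure (vol_ball :: (complex ^ 'n) measure) (space vol_ball) = (\<integral>\<^sup>+u. 1 \<partial>(vol_ball :: (complex ^ 'n) measure))" by simp
    also have "\<dots> = ennreal (1 / measure lborel (ball (0 :: complex ^ 'n) 1)) * emeasure lborel (ball (0 :: complex ^ 'n) 1)"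
      by (subst nn_integral_vol_ball) auto
    also have "\<dots> < \<infinity>"
      using emeasure_lborel_ball_finite[of "0 :: complex ^ 'n" 1] by (simp add: ennreal_mult_less_top)
    finally show "emeasure (vol_ball :: (complex ^ 'n) measure) (space vol_ball) \<noteq> \<infinity>" by simp
  qed
  have "(\<lambda>z :: complex ^ 'n. ennreal (1 / defect z ^ (CARD('n) + 1))) \<in> borel_measurable vol_ball"
    unfolding measurable_weighted_eq by measurable
  then show ?thesis
    unfolding inv_measure_def defect_def[symmetric]
    by (subst V.sigma_finite_iff_density_finite) (auto simp: defect_def)
qed

lemma bergman_ball_sets: "norm z < 1 \<Longrightarrow> bergman_ball z \<gamma> \<in> sets (inv_measure :: (complex ^ 'n) measure)"
  for z :: "complex ^ 'n"
proof -
  assume z: "norm z < 1"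
  have "bergman_ball z \<gamma> = ball 0 1 \<inter> (\<lambda>w. norm (ball_aut z w)) -` {..<tanh \<gamma>}"
    using bergman_ball_iff[OF z] by (auto simp: bergman_ball_def)
  moreover have "open \<dots>"
    using z by (intro continuous_open_preimage continuous_intros) (auto simp: less_imp_le)
  ultimately have "bergman_ball z \<gamma> \<in> sets borel" by (metis borel_open)
  then show ?thesis
    by (auto simp: sets_weighted sets_restrict_space_iff bergman_ball_def)
qed

text \<open>On the Bergman ball of \<open>z\<close> the invariant density is comparable to \<open>defect z\<close> to the power \<open>-(n + 1)\<close>,
  and the ball lies in a Carleson region of size comparable to \<open>defect z\<close>.\<close>
lemma emeasure_bergman_ball_le:
  assumes "\<gamma> > 0"
  obtains C where "C > 0"
    "\<And>z :: complex ^ 'n. norm z < 1 \<Longrightarrow> emeasure inv_measure (bergman_ball z \<gamma>) \<le> ennreal C"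
proof -
  let ?n = "CARD('n)"
  obtain C0 where C0: "C0 > 1" "\<And>z w. norm (z :: complex ^ 'n) < 1 \<Longrightarrow> w \<in> bergman_ball z \<gamma> \<Longrightarrow>
     norm w < 1 \<and> defect z \<le> C0 * defect w \<and> defect w \<le> C0 * defect z \<and> cmod (1 - cinner z w) \<le> C0 * defect w \<and> cmod (1 - cinner z w) \<le> C0 * defect z"
    using bergman_ball_geometry[OF assms, where 'n='n] by blast
  obtain C1 where C1: "C1 > 0"
    "\<And>(z :: complex ^ 'n) t. norm z < 1 \<Longrightarrow> t > 0 \<Longrightarrow> measure lborel (carleson z t) \<le> C1 * t ^ (?n + 1)"
    using measure_carleson_le by blast
  define V where "V = measure lborel (ball (0 :: complex ^ 'n) 1)"
  have V: "V > 0" by (simp add: V_def)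
  let ?C = "1 / V * (C0 ^ (?n + 1) * (C1 * (2 * C0) ^ (?n + 1)))"
  show ?thesis
  proof
    show "?C > 0" using V C0 C1 by simp
    fix z :: "complex ^ 'n" assume z: "norm z < 1"
    \<comment> \<open>Doubling the size turns the weak bound |1 - <z,u>| <= C0
      \<open>defect z\<close> into the strict one in the definition of the region.\<close>
    let ?D = "bergman_ball z \<gamma>" and ?t = "2 * C0 * defect z"
    have dz: "defect z > 0" using z by (rule defect_pos)
    have t: "?t > 0" using C0 dz by simp
    have [measurable]: "?D \<in> sets (inv_measure :: (complex ^ 'n) measure)" using z by (rule bergman_ball_sets)
    have "emeasure inv_measure ?D = (\<integral>\<^sup>+u. indicator ?D u \<partial>inv_measure)" by simp
    also have "\<dots> = ennreal (1 / V) * (\<integral>\<^sup>+u. ennreal (1 / defect u ^ (?n + 1)) * indicator ?D u * indicator (ball 0 1) u \<partial>lborel)"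
      unfolding V_def by (rule nn_integral_inv_measure) measurable
    also have "\<dots> \<le> ennreal (1 / V) * (\<integral>\<^sup>+u. ennreal ((C0 / defect z) ^ (?n + 1)) * indicator (carleson z ?t) u \<partial>lborel)"
    proof (intro mult_left_mono nn_integral_mono)
      fix u :: "complex ^ 'n"
      show "ennreal (1 / defect u ^ (?n + 1)) * indicator ?D u * indicator (ball 0 1) u \<le> ennreal ((C0 / defect z) ^ (?n + 1)) * indicator (carleson z ?t) u"
      proof (cases "u \<in> ?D")
        case True
        from C0(2)[OF z True] have u: "norm u < 1" "defect z \<le> C0 * defect u" "cmod (1 - cinner z u) \<le> C0 * defect z" by auto
        have "cmod (1 - cinner z u) < ?t" using u(3) t by linarith
        then have "u \<in> carleson z ?t" using u by (simp add: carleson_def)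
        moreover have "1 / defect u ^ (?n + 1) \<le> (C0 / defect z) ^ (?n + 1)"
        proof -
          have "1 / defect u \<le> C0 / defect z" using u(2) dz defect_pos[OF u(1)] by (simp add: field_simps)
          then have "(1 / defect u) ^ (?n + 1) \<le> (C0 / defect z) ^ (?n + 1)"
            using defect_pos[OF u(1)] by (intro power_mono) auto
          then show ?thesis by (simp add: power_divide)
        qed
        ultimately show ?thesis using True u by (simp add: ennreal_leI)
      qed simp
    qed simp
    also have "(\<integral>\<^sup>+u. ennreal ((C0 / defect z) ^ (?n + 1)) * indicator (carleson z ?t) u \<partial>lborel) = ennreal ((C0 / defect z) ^ (?n + 1)) * emeasure lborel (carleson z ?t)"
      by (rule nn_integral_cmult_indicator) simp
    also have "emeasure lborel (carleson z ?t) = ennreal (measure lborel (carleson z ?t))"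
      by (rule emeasure_eq_measure2[OF carleson_fmeasurable])
    also have "ennreal (1 / V) * (ennreal ((C0 / defect z) ^ (?n + 1)) * \<dots>) \<le> ennreal (1 / V) * (ennreal ((C0 / defect z) ^ (?n + 1)) * ennreal (C1 * ?t ^ (?n + 1)))"
      by (intro mult_left_mono ennreal_leI C1 z t) auto
    also have "\<dots> = ennreal (1 / V * ((C0 / defect z) ^ (?n + 1) * (C1 * ?t ^ (?n + 1))))"
      using V C0 C1 dz by (subst ennreal_mult[symmetric]; (subst ennreal_mult[symmetric])?) auto
    also have "(C0 / defect z) ^ (?n + 1) * (C1 * ?t ^ (?n + 1)) = C0 ^ (?n + 1) * (C1 * (2 * C0) ^ (?n + 1))"
      using dz by (simp only: power_divide power_mult_distrib) (simp add: field_simps)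
    finally show "emeasure inv_measure ?D \<le> ennreal ?C" .
  qed
qed

text \<open>This confines the tent variable to a ball of radius below 1, on which the kernel is
  comparable to |1 - <z,u>|^-(n+1+\<alpha>) uniformly.\<close>

lemma tent_measure_AE:
  assumes "\<gamma> > 0"
  shows "AE w in (tent_measure \<gamma> :: (complex ^ 'n) measure). norm w < tanh \<gamma>"
proof -
  have [measurable]: "bergman_ball 0 \<gamma> \<in> sets (inv_measure :: (complex ^ 'n) measure)"
    by (rule bergman_ball_sets) simp
  show ?thesis
    unfolding tent_measure_def
    by (subst AE_density, measurable) (auto simp: bergman_ball_0 indicator_def split: if_splits)
qed

lemma finite_measure_tent:
  assumes "\<gamma> > 0"
  shows "finite_measure (tent_measure \<gamma> :: (complex ^ 'n) measure)"
proof (rule finite_measureI)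
  have [measurable]: "bergman_ball 0 \<gamma> \<in> sets (inv_measure :: (complex ^ 'n) measure)"
    by (rule bergman_ball_sets) simp
  obtain C where C: "\<And>z :: complex ^ 'n. norm z < 1 \<Longrightarrow> emeasure inv_measure (bergman_ball z \<gamma>) \<le> ennreal C"
    using emeasure_bergman_ball_le[OF assms] by blast
  have "emeasure (tent_measure \<gamma> :: (complex ^ 'n) measure) (space (tent_measure \<gamma>)) = (\<integral>\<^sup>+u. indicator (bergman_ball 0 \<gamma>) u * indicator (ball 0 1) u \<partial>(inv_measure :: (complex ^ 'n) measure))"
    unfolding tent_measure_def
    using sets.top[of "inv_measure :: (complex ^ 'n) measure"] by (subst emeasure_density) (measurable, simp_all)
  also have "\<dots> = emeasure inv_measure (bergman_ball (0 :: complex ^ 'n) \<gamma>)"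
  proof -
    have "(\<lambda>u. indicator (bergman_ball 0 \<gamma>) u * indicator (ball 0 1) u) = (indicator (bergman_ball 0 \<gamma>) :: complex ^ 'n \<Rightarrow> ennreal)"
      by (auto simp: fun_eq_iff indicator_def bergman_ball_def)
    then show ?thesis by simp
  qed
  also have "\<dots> \<le> ennreal C" using C[of 0] by simp
  finally show "emeasure (tent_measure \<gamma> :: (complex ^ 'n) measure) (space (tent_measure \<gamma>)) \<noteq> \<infinity>"
    by (auto simp: top_unique)
qed

section \<open>The positive Bergman operator\<close>

abbreviation abs_kernel :: "real \<Rightarrow> complex ^ 'n \<Rightarrow> complex ^ 'n \<Rightarrow> real" where
  "abs_kernel \<alpha> z u \<equiv> 1 / cmod (1 - cinner z u) powr (real CARD('n) + 1 + \<alpha>)"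

definition abs_bergman :: "real \<Rightarrow> (complex ^ 'n \<Rightarrow> complex) \<Rightarrow> complex ^ 'n \<Rightarrow> real" where
  "abs_bergman \<alpha> f z = (LINT u|vol_weighted \<alpha>. abs_kernel \<alpha> z u * cmod (f u))"

lemma abs_bergman_nonneg: "0 \<le> abs_bergman \<alpha> f z"
  unfolding abs_bergman_def by (intro integral_nonneg_AE AE_I2) simp

lemma abs_kernel_commute: "abs_kernel \<alpha> z u = abs_kernel \<alpha> u z"
  by (simp add: cmod_one_minus_cinner_commute[of z u])

lemma abs_kernel_le:
  fixes z u :: "complex ^ 'n"
  assumes "\<alpha> > -1" "norm z < 1" "norm u < 1"
  shows "abs_kernel \<alpha> z u \<le> 1 / (1 - norm z) powr (real CARD('n) + 1 + \<alpha>)"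
  using assms defect_le_cmod(1)[of z u] by (intro divide_left_mono powr_mono2 mult_pos_pos) auto

lemma integrable_abs_kernel:
  fixes z :: "complex ^ 'n"
  assumes \<alpha>: "\<alpha> > -1" and z: "norm z < 1" and g: "integrable (vol_weighted \<alpha>) (g :: complex ^ 'n \<Rightarrow> real)"
  shows "integrable (vol_weighted \<alpha>) (\<lambda>u. abs_kernel \<alpha> z u * g u)"
proof (rule Bochner_Integration.integrable_bound)
  let ?c = "1 / (1 - norm z) powr (real CARD('n) + 1 + \<alpha>)"
  show "integrable (vol_weighted \<alpha>) (\<lambda>u. ?c * g u)" using g by simp
  note [measurable] = borel_measurable_integrable[OF g] borel_measurable_id_weighted(1)[of \<alpha>]
  show "(\<lambda>u. abs_kernel \<alpha> z u * g u) \<in> borel_measurable (vol_weighted \<alpha>)" by measurable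
  show "AE u in vol_weighted \<alpha>. norm (abs_kernel \<alpha> z u * g u) \<le> norm (?c * g u)"
  proof (rule AE_I2)
    fix u :: "complex ^ 'n" assume "u \<in> space (vol_weighted \<alpha>)"
    then have "abs_kernel \<alpha> z u \<le> ?c" using \<alpha> z by (intro abs_kernel_le) auto
    then show "norm (abs_kernel \<alpha> z u * g u) \<le> norm (?c * g u)"
      unfolding norm_mult by (intro mult_right_mono) auto
  qed
qed

text \<open>The measure is finite and x <= 1 + x^p for x >= 0, so one integrability statement serves
  all exponents.\<close>

lemma Lp_fun_integrable_vol_weighted:
  fixes f :: "complex ^ 'n \<Rightarrow> 'b::{real_normed_vector,second_countable_topology}"
  assumes "\<alpha> > -1" "p > 1" "f \<in> Lp_fun (vol_weighted \<alpha>) p"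
  shows "integrable (vol_weighted \<alpha>) (\<lambda>u. norm (f u))"
proof -
  interpret finite_measure "vol_weighted \<alpha> :: (complex ^ 'n) measure"
    using assms(1) by (rule finite_measure_vol_weighted)
  note [measurable] = Lp_fun_measurable[OF assms(3)]
  show ?thesis
  proof (rule Bochner_Integration.integrable_bound)
    show "integrable (vol_weighted \<alpha>) (\<lambda>u. 1 + norm (f u) powr p)"
      using Lp_fun_integrable[OF assms(3)] by simp
    have "x \<le> 1 + x powr p" if "x \<ge> 0" for x :: real
      using that assms(2) powr_mono[of 1 p x] powr_ge_zero[of x p] by (cases "x \<le> 1") (simp_all add: add_increasing2)
    then show "AE u in vol_weighted \<alpha>. norm (norm (f u)) \<le> norm (1 + norm (f u) powr p)"
      by (intro AE_I2) auto
  qed measurable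
qed

text \<open>The case a = \<alpha> - s, b = \<alpha> of the Forelli-Rudin estimate; the two bounds on
  \<open>s\<close> are precisely a < b and a > -1. It says that a power of the defect is, up to a
  constant, a supersolution for the positive operator.\<close>

lemma forelli_rudin_weighted:
  fixes s :: real
  assumes \<alpha>: "\<alpha> > -1" and s: "0 < s" "s < \<alpha> + 1"
  obtains C where "C > 0"
    "\<And>z :: complex ^ 'n. norm z < 1 \<Longrightarrow>
      (\<integral>\<^sup>+u. ennreal (abs_kernel \<alpha> z u * defect u powr (- s)) \<partial>vol_weighted \<alpha>) \<le> ennreal (C * defect z powr (- s))"
proof -
  obtain C where C: "C > 0" "\<And>z :: complex ^ 'n. norm z < 1 \<Longrightarrow>
      (\<integral>\<^sup>+u. ennreal (defect u powr (\<alpha> - s) / cmod (1 - cinner z u) powr (real CARD('n) + 1 + \<alpha>)) * indicator (ball 0 1) u \<partial>lborel)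
        \<le> ennreal (C * defect z powr (\<alpha> - s - \<alpha>))"
    using forelli_rudin[of "\<alpha> - s" \<alpha>, where 'n='n] s by (auto simp del: powr_diff)
  let ?w = "weighted_const TYPE('n) \<alpha>"
  have w: "?w > 0" using \<alpha> by (rule weighted_const_pos)
  show ?thesis
  proof
    show "?w * C > 0" using w C by simp
    fix z :: "complex ^ 'n" assume z: "norm z < 1"
    note [measurable] = borel_measurable_id_weighted(1)[of \<alpha>, where 'n='n]
    have "(\<integral>\<^sup>+u. ennreal (abs_kernel \<alpha> z u * defect u powr (- s)) \<partial>vol_weighted \<alpha>)
      = ennreal ?w * (\<integral>\<^sup>+u. ennreal (defect u powr \<alpha>) * ennreal (abs_kernel \<alpha> z u * defect u powr (- s)) * indicator (ball 0 1) u \<partial>lborel)"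
      by (rule nn_integral_vol_weighted[OF \<alpha>]) measurable
    also have "(\<lambda>u. ennreal (defect u powr \<alpha>) * ennreal (abs_kernel \<alpha> z u * defect u powr (- s)) * indicator (ball 0 1) u)
      = (\<lambda>u. ennreal (defect u powr (\<alpha> - s) / cmod (1 - cinner z u) powr (real CARD('n) + 1 + \<alpha>)) * indicator (ball 0 1) u)"
      by (auto simp: fun_eq_iff indicator_def ennreal_mult[symmetric] powr_diff powr_minus divide_inverse ac_simps)
    also have "ennreal ?w * (\<integral>\<^sup>+u. \<dots> u \<partial>lborel) \<le> ennreal ?w * ennreal (C * defect z powr (\<alpha> - s - \<alpha>))"
      by (intro mult_left_mono C(2) z) simp
    also have "\<dots> = ennreal (?w * C * defect z powr (- s))"
      using w C by (subst ennreal_mult[symmetric]) (auto simp: mult.assoc)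
    finally show "(\<integral>\<^sup>+u. ennreal (abs_kernel \<alpha> z u * defect u powr (- s)) \<partial>vol_weighted \<alpha>) \<le> ennreal (?w * C * defect z powr (- s))" .
  qed
qed

text \<open>Schur test with the weight \<open>H = defect powr (- s)\<close>; Young's inequality is used in the crude form
  \<open>x \<le> c + x\<^sup>p c\<^sup>1\<^sup>-\<^sup>p\<close>, optimised over \<open>c\<close>.\<close>
lemma abs_bergman_pointwise:
  fixes f :: "complex ^ 'n \<Rightarrow> complex"
  assumes \<alpha>: "\<alpha> > -1" and p: "p > 1" and f: "f \<in> Lp_fun (vol_weighted \<alpha>) p"
    and C: "C > 0" and z: "norm z < 1" and s: "s > 0"
    and FR: "(\<integral>\<^sup>+u. ennreal (abs_kernel \<alpha> z u * defect u powr (- s)) \<partial>vol_weighted \<alpha>) \<le> ennreal (C * defect z powr (- s))"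
  shows "abs_bergman \<alpha> f z powr p \<le> (C + 1) powr p * defect z powr (- (s * (p - 1))) *
    (LINT u|vol_weighted \<alpha>. abs_kernel \<alpha> z u * (defect u powr (s * (p - 1)) * cmod (f u) powr p))"
proof -
  let ?M = "vol_weighted \<alpha> :: (complex ^ 'n) measure"
  note [measurable] = borel_measurable_id_weighted(1)[of \<alpha>, where 'n='n] Lp_fun_measurable[OF f]
  define A where "A = (LINT u|?M. abs_kernel \<alpha> z u * (defect u powr (s * (p - 1)) * cmod (f u) powr p))"
  define H where "H = defect z powr (- s)"
  have H: "H > 0" using defect_pos[OF z] by (simp add: H_def)
  have A0: "A \<ge> 0" unfolding A_def by (intro integral_nonneg_AE AE_I2) simp
  have i1: "integrable ?M (\<lambda>u. abs_kernel \<alpha> z u * cmod (f u))"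
    by (intro integrable_abs_kernel \<alpha> z Lp_fun_integrable_vol_weighted[OF \<alpha> p f])
  have i2: "integrable ?M (\<lambda>u. abs_kernel \<alpha> z u * (defect u powr (s * (p - 1)) * cmod (f u) powr p))"
  proof (intro integrable_abs_kernel \<alpha> z Bochner_Integration.integrable_bound[OF Lp_fun_integrable[OF f]] AE_I2)
    fix u :: "complex ^ 'n" assume "u \<in> space ?M"
    then have "defect u powr (s * (p - 1)) \<le> 1"
      using s p defect_le_1[of u] defect_pos[of u] by (intro powr_le1) auto
    then show "norm (defect u powr (s * (p - 1)) * cmod (f u) powr p) \<le> norm (cmod (f u) powr p)"
      by (simp add: mult_left_le_one_le)
  qed measurable
  have i3: "integrable ?M (\<lambda>u. abs_kernel \<alpha> z u * defect u powr (- s))"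
  proof (rule integrableI_bounded)
    have "(\<integral>\<^sup>+u. ennreal (norm (abs_kernel \<alpha> z u * defect u powr (- s))) \<partial>?M) \<le> ennreal (C * defect z powr (- s))"
      using FR by simp
    then show "(\<integral>\<^sup>+u. ennreal (norm (abs_kernel \<alpha> z u * defect u powr (- s))) \<partial>?M) < \<infinity>"
      by (rule le_less_trans) simp
  qed measurable
  have l3: "(LINT u|?M. abs_kernel \<alpha> z u * defect u powr (- s)) \<le> C * H"
  proof -
    have "ennreal (LINT u|?M. abs_kernel \<alpha> z u * defect u powr (- s)) \<le> ennreal (C * H)"
      using FR nn_integral_eq_integral[OF i3] by (simp add: H_def)
    then show ?thesis using C H by (subst (asm) ennreal_le_iff) auto
  qed
  have main: "abs_bergman \<alpha> f z \<le> c * (C * H) + c powr (1 - p) * A" if c: "c > 0" for c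
  proof -
    have "abs_bergman \<alpha> f z \<le> (LINT u|?M. c * (abs_kernel \<alpha> z u * defect u powr (- s)) +
        c powr (1 - p) * (abs_kernel \<alpha> z u * (defect u powr (s * (p - 1)) * cmod (f u) powr p)))"
      unfolding abs_bergman_def
    proof (rule integral_mono)
      fix u assume u: "u \<in> space ?M"
      define h where "h = defect u powr (- s)"
      have h: "h > 0" using defect_pos[of u] u by (simp add: h_def)
      \<comment> \<open>Young's inequality is applied to |f| relative to the Schur weight
        \<open>h\<close>.\<close>
      define x where "x = cmod (f u) / h"
      have x: "x \<ge> 0" "cmod (f u) = x * h" using h by (simp_all add: x_def)
      \<comment> \<open>If x > c then (x / c)^(p-1) >= 1, so the second summand alone exceeds
        x.\<close>
      have "x \<le> c + c powr (1 - p) * x powr p"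
      proof (cases "x \<le> c")
        case False
        then have "1 = x powr (1 - p) * x powr (p - 1)" using c by (simp flip: powr_add)
        also have "\<dots> \<le> c powr (1 - p) * x powr (p - 1)"
          using False c p by (intro mult_right_mono powr_mono2') auto
        finally have "1 \<le> c powr (1 - p) * x powr (p - 1)" .
        then have "1 * x \<le> c powr (1 - p) * x powr (p - 1) * x" using x by (intro mult_right_mono) auto
        moreover have "x powr (p - 1) * x = x powr p" using False c powr_mult_base[of x "p - 1"] by (simp add: mult.commute)
        ultimately have "x \<le> c powr (1 - p) * x powr p" by (simp add: mult.assoc)
        then show ?thesis using c by linarith
      qed (simp add: add_increasing2)
      then have "cmod (f u) \<le> (c + c powr (1 - p) * x powr p) * h" unfolding x(2) using h by (intro mult_right_mono) auto
      also have "\<dots> = c * h + c powr (1 - p) * (defect u powr (s * (p - 1)) * cmod (f u) powr p)"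
      proof -
        have "x powr p * h = cmod (f u) powr p * h powr (1 - p)"
          using h by (simp add: x_def powr_divide powr_diff)
        also have "h powr (1 - p) = defect u powr (s * (p - 1))"
          by (simp add: h_def powr_powr algebra_simps)
        finally show ?thesis by (simp add: algebra_simps)
      qed
      finally have "abs_kernel \<alpha> z u * cmod (f u) \<le> abs_kernel \<alpha> z u * (c * h + c powr (1 - p) * (defect u powr (s * (p - 1)) * cmod (f u) powr p))"
        by (rule mult_left_mono) simp
      then show "abs_kernel \<alpha> z u * cmod (f u) \<le> c * (abs_kernel \<alpha> z u * defect u powr (- s)) +
        c powr (1 - p) * (abs_kernel \<alpha> z u * (defect u powr (s * (p - 1)) * cmod (f u) powr p))"
        by (simp only: h_def distrib_left mult.left_commute)
    qed (intro i1 Bochner_Integration.integrable_add i2 i3 integrable_mult_right)+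
    also have "\<dots> = c * (LINT u|?M. abs_kernel \<alpha> z u * defect u powr (- s)) + c powr (1 - p) * A"
      unfolding A_def using i2 i3 by (subst Bochner_Integration.integral_add) (auto simp only: integral_mult_right_zero integrable_mult_right)
    also have "\<dots> \<le> c * (C * H) + c powr (1 - p) * A"
      using l3 c by simp
    finally show ?thesis .
  qed
  have "abs_bergman \<alpha> f z powr p \<le> (C + 1) powr p * H powr (p - 1) * A"
  proof (cases "A = 0")
    \<comment> \<open>No optimal \<open>c\<close> exists when A = 0; letting \<open>c\<close> tend
      to 0 shows that the left side vanishes.\<close>
    case True
    have "abs_bergman \<alpha> f z \<le> 0 + e" if "e > 0" for e
      using main[of "e / (C * H)"] that C H True by simp
    then have "abs_bergman \<alpha> f z \<le> 0" by (rule field_le_epsilon)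
    then have "abs_bergman \<alpha> f z = 0" using abs_bergman_nonneg[of \<alpha> f z] by simp
    then show ?thesis using True by simp
  next
    case False
    then have A: "A > 0" using A0 by simp
    \<comment> \<open>The value at which the two terms c H and c^(1-p) A are equal.\<close>
    define c where "c = (A / H) powr (1 / p)"
    have c: "c > 0" using A H by (simp add: c_def)
    have cp: "c powr p = A / H" using A H p by (simp add: c_def powr_powr)
    then have "A = c powr p * H" using H by simp
    then have "c powr (1 - p) * A = c * H" using c by (simp add: powr_diff)
    then have "abs_bergman \<alpha> f z \<le> (C + 1) * (c * H)" using main[OF c] by (simp add: algebra_simps)
    then have "abs_bergman \<alpha> f z powr p \<le> ((C + 1) * (c * H)) powr p"
      using p abs_bergman_nonneg by (intro powr_mono2) auto
    also have "\<dots> = (C + 1) powr p * (A / H * H powr p)" using C c H by (simp add: powr_mult cp)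
    also have "A / H * H powr p = H powr (p - 1) * A" using H by (simp add: powr_diff)
    finally show ?thesis by (simp add: mult.assoc)
  qed
  also have "H powr (p - 1) = defect z powr (- (s * (p - 1)))" by (simp add: H_def powr_powr)
  finally show ?thesis by (simp add: A_def)
qed

lemma measurable_weighted_borel:
  "g \<in> measurable N (vol_weighted \<alpha> :: (complex ^ 'n) measure) \<Longrightarrow> g \<in> borel_measurable N"
  by (rule measurable_compose[OF _ borel_measurable_id_weighted(1)])

text \<open>A non-integrable function has integral 0 by convention, so the inequality holds in that
  case too and integrability need not be established before Tonelli is applied.\<close>

lemma ennreal_integral_le_nn_integral:
  assumes "\<And>x. 0 \<le> g x"
  shows "ennreal (LINT x|M. g x) \<le> (\<integral>\<^sup>+x. ennreal (g x) \<partial>M)"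
proof (cases "integrable M g")
  case True
  then show ?thesis using assms by (simp add: nn_integral_eq_integral)
next
  case False
  then show ?thesis by (simp add: not_integrable_integral_eq)
qed

text \<open>Second half of the Schur test: integrate the pointwise estimate, exchange the integrals,
  and apply Forelli-Rudin once more, now in \<open>z\<close> and with the exponent s (p -
  1).\<close>

lemma abs_bergman_bounded:
  assumes \<alpha>: "\<alpha> > -1" and p: "p > 1"
  obtains C where "C > 0"
    "\<And>f :: complex ^ 'n \<Rightarrow> complex. f \<in> Lp_fun (vol_weighted \<alpha>) p \<Longrightarrow>
      (\<integral>\<^sup>+z. ennreal (abs_bergman \<alpha> f z powr p) \<partial>vol_weighted \<alpha>) \<le> ennreal (C * Lp_norm (vol_weighted \<alpha>) p f powr p)"
proof -
  let ?M = "vol_weighted \<alpha> :: (complex ^ 'n) measure"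
  \<comment> \<open>With s p = (\<alpha> + 1) / 2, both s and s (p - 1) lie in the range allowed by
    \<open>forelli_rudin_weighted\<close>.\<close>
  define s where "s = (\<alpha> + 1) / (2 * p)"
  have s: "s > 0" using \<alpha> p by (simp add: s_def)
  have "(\<alpha> + 1) / (2 * p) < (\<alpha> + 1) / 1" "(\<alpha> + 1) * (p - 1) / (2 * p) < \<alpha> + 1"
    using \<alpha> p by (intro divide_strict_left_mono, simp_all) (simp add: divide_less_eq)
  then have s1: "s < \<alpha> + 1" "s * (p - 1) < \<alpha> + 1" by (simp_all add: s_def)
  have s2: "s * (p - 1) > 0" using s p by simp
  obtain C1 where C1: "C1 > 0"
    "\<And>z :: complex ^ 'n. norm z < 1 \<Longrightarrow>
      (\<integral>\<^sup>+u. ennreal (abs_kernel \<alpha> z u * defect u powr (- s)) \<partial>?M) \<le> ennreal (C1 * defect z powr (- s))"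
    using forelli_rudin_weighted[OF \<alpha> s s1(1)] by blast
  obtain C2 where C2: "C2 > 0"
    "\<And>z :: complex ^ 'n. norm z < 1 \<Longrightarrow>
      (\<integral>\<^sup>+u. ennreal (abs_kernel \<alpha> z u * defect u powr (- (s * (p - 1)))) \<partial>?M) \<le> ennreal (C2 * defect z powr (- (s * (p - 1))))"
    using forelli_rudin_weighted[OF \<alpha> s2 s1(2)] by blast
  define r where "r = s * (p - 1)"
  interpret M: finite_measure ?M using \<alpha> by (rule finite_measure_vol_weighted)
  interpret MM: pair_sigma_finite ?M ?M ..
  show ?thesis
  proof
    show "(C1 + 1) powr p * C2 > 0" using C1 C2 by simp
    fix f :: "complex ^ 'n \<Rightarrow> complex" assume f: "f \<in> Lp_fun ?M p"
    note fm[measurable] = Lp_fun_measurable[OF f]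
    note [measurable] = borel_measurable_id_weighted(1)[of \<alpha>, where 'n='n]
    note [measurable (raw)] = measurable_weighted_borel
    define k where "k u = ennreal (defect u powr r * cmod (f u) powr p)" for u
    have [measurable]: "k \<in> borel_measurable ?M" unfolding k_def by measurable
    have kint: "ennreal (LINT u|?M. abs_kernel \<alpha> z u * (defect u powr r * cmod (f u) powr p)) \<le> (\<integral>\<^sup>+u. ennreal (abs_kernel \<alpha> z u) * k u \<partial>?M)" for z
    proof -
      have "ennreal (LINT u|?M. abs_kernel \<alpha> z u * (defect u powr r * cmod (f u) powr p)) \<le> (\<integral>\<^sup>+u. ennreal (abs_kernel \<alpha> z u * (defect u powr r * cmod (f u) powr p)) \<partial>?M)"
        by (rule ennreal_integral_le_nn_integral) simp
      also have "\<dots> = (\<integral>\<^sup>+u. ennreal (abs_kernel \<alpha> z u) * k u \<partial>?M)"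
        by (intro nn_integral_cong) (auto simp: k_def ennreal_mult[symmetric])
      finally show ?thesis .
    qed
    have "(\<integral>\<^sup>+z. ennreal (abs_bergman \<alpha> f z powr p) \<partial>?M) \<le>
        (\<integral>\<^sup>+z. ennreal ((C1 + 1) powr p) * (\<integral>\<^sup>+u. ennreal (abs_kernel \<alpha> z u * defect z powr (- r)) * k u \<partial>?M) \<partial>?M)"
    proof (rule nn_integral_mono)
      fix z assume "z \<in> space ?M"
      then have z: "norm z < 1" by simp
      have "ennreal (abs_bergman \<alpha> f z powr p) \<le> ennreal ((C1 + 1) powr p * defect z powr (- r) *
         (LINT u|?M. abs_kernel \<alpha> z u * (defect u powr r * cmod (f u) powr p)))"
        unfolding r_def by (intro ennreal_leI abs_bergman_pointwise \<alpha> p f C1 z s)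
      also have "\<dots> = ennreal ((C1 + 1) powr p) * (ennreal (defect z powr (- r)) * ennreal (LINT u|?M. abs_kernel \<alpha> z u * (defect u powr r * cmod (f u) powr p)))"
        by (subst ennreal_mult'[symmetric], simp)+ (simp only: mult.assoc)
      also have "\<dots> \<le> ennreal ((C1 + 1) powr p) * (ennreal (defect z powr (- r)) * (\<integral>\<^sup>+u. ennreal (abs_kernel \<alpha> z u) * k u \<partial>?M))"
        by (intro mult_left_mono kint) auto
      also have "ennreal (defect z powr (- r)) * (\<integral>\<^sup>+u. ennreal (abs_kernel \<alpha> z u) * k u \<partial>?M) = (\<integral>\<^sup>+u. ennreal (defect z powr (- r)) * (ennreal (abs_kernel \<alpha> z u) * k u) \<partial>?M)"
        by (rule nn_integral_cmult[symmetric]) measurable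
      also have "\<dots> = (\<integral>\<^sup>+u. ennreal (abs_kernel \<alpha> z u * defect z powr (- r)) * k u \<partial>?M)"
        by (intro nn_integral_cong, subst ennreal_mult, simp, simp, simp only: ac_simps)
      finally show "ennreal (abs_bergman \<alpha> f z powr p) \<le> ennreal ((C1 + 1) powr p) * (\<integral>\<^sup>+u. ennreal (abs_kernel \<alpha> z u * defect z powr (- r)) * k u \<partial>?M)" .
    qed
    also have "\<dots> = ennreal ((C1 + 1) powr p) * (\<integral>\<^sup>+z. (\<integral>\<^sup>+u. ennreal (abs_kernel \<alpha> z u * defect z powr (- r)) * k u \<partial>?M) \<partial>?M)"
      by (rule nn_integral_cmult) measurable
    also have "(\<integral>\<^sup>+z. (\<integral>\<^sup>+u. ennreal (abs_kernel \<alpha> z u * defect z powr (- r)) * k u \<partial>?M) \<partial>?M)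
        = (\<integral>\<^sup>+u. (\<integral>\<^sup>+z. ennreal (abs_kernel \<alpha> z u * defect z powr (- r)) * k u \<partial>?M) \<partial>?M)"
      by (rule MM.Fubini'[symmetric]) measurable
    \<comment> \<open>The kernel has symmetric modulus, so the inner integral is a Forelli-Rudin
      integral centred at \<open>u\<close>; the resulting \<open>defect u powr (- r)\<close> cancels
      the weight in \<open>k u\<close>.\<close>
    also have "\<dots> \<le> (\<integral>\<^sup>+u. ennreal C2 * ennreal (cmod (f u) powr p) \<partial>?M)"
    proof (rule nn_integral_mono)
      fix u assume "u \<in> space ?M"
      then have u: "norm u < 1" by simp
      have "(\<integral>\<^sup>+z. ennreal (abs_kernel \<alpha> z u * defect z powr (- r)) * k u \<partial>?M) = (\<integral>\<^sup>+z. ennreal (abs_kernel \<alpha> z u * defect z powr (- r)) \<partial>?M) * k u"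
        by (rule nn_integral_multc) measurable
      also have "\<dots> \<le> ennreal (C2 * defect u powr (- r)) * k u"
        using C2(2)[OF u] by (intro mult_right_mono) (simp_all only: r_def abs_kernel_commute[of _ u], simp)
      also have "\<dots> = ennreal (C2 * cmod (f u) powr p)"
        unfolding k_def using C2(1) defect_pos[OF u] by (subst ennreal_mult[symmetric]) (auto simp: powr_minus field_simps)
      finally show "(\<integral>\<^sup>+z. ennreal (abs_kernel \<alpha> z u * defect z powr (- r)) * k u \<partial>?M) \<le> ennreal C2 * ennreal (cmod (f u) powr p)"
        using C2(1) by (simp add: ennreal_mult)
    qed
    also have "\<dots> = ennreal C2 * ennreal (Lp_norm ?M p f powr p)"
      using nn_integral_Lp_norm[OF _ f] p by (subst nn_integral_cmult) auto
    also have "ennreal ((C1 + 1) powr p) * \<dots> = ennreal ((C1 + 1) powr p * C2 * Lp_norm ?M p f powr p)"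
      using C2(1) by (simp add: ennreal_mult[symmetric] mult.assoc)
    finally show "(\<integral>\<^sup>+z. ennreal (abs_bergman \<alpha> f z powr p) \<partial>?M) \<le> ennreal ((C1 + 1) powr p * C2 * Lp_norm ?M p f powr p)"
      by (simp add: mult_left_mono)
  qed
qed

section \<open>A sub-mean value inequality on nonisotropic balls\<close>

lemma nn_integral_lborel_translate:
  fixes h :: "'a::euclidean_space \<Rightarrow> ennreal"
  assumes [measurable]: "h \<in> borel_measurable borel"
  shows "(\<integral>\<^sup>+y. h (c + y) \<partial>lborel) = (\<integral>\<^sup>+y. h y \<partial>lborel)"
proof -
  have "(\<integral>\<^sup>+y. h y \<partial>lborel) = (\<integral>\<^sup>+y. h y \<partial>distr lborel borel ((+) c))"
    by (simp add: lborel_distr_plus)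
  also have "\<dots> = (\<integral>\<^sup>+y. h (c + y) \<partial>lborel)"
    using assms by (subst nn_integral_distr) simp_all
  finally show ?thesis ..
qed

lemma borel_measurable_vec_smult [measurable (raw)]:
  fixes g :: "'a \<Rightarrow> complex ^ 'n"
  assumes "f \<in> borel_measurable M" "g \<in> borel_measurable M"
  shows "(\<lambda>x. f x *s g x) \<in> borel_measurable M"
  by (rule borel_measurable_continuous_Pair[OF assms]) (intro continuous_intros)

text \<open>Uniqueness of Haar measure, with the unit ball as the reference set on which Lebesgue measure
  and its image under the rotation agree.\<close>
lemma nn_integral_lborel_rotate:
  fixes h :: "complex ^ 'n \<Rightarrow> ennreal"
  assumes h[measurable]: "h \<in> borel_measurable borel" and e: "cmod e = 1"
  shows "(\<integral>\<^sup>+y. h (e *s y) \<partial>lborel) = (\<integral>\<^sup>+y. h y \<partial>lborel)"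
proof -
  let ?B = "ball (0 :: complex ^ 'n) 1"
  define b :: "complex ^ 'n \<Rightarrow> ennreal" where "b = indicator ?B"
  have [measurable]: "?B \<in> sets borel" by simp
  have [measurable]: "b \<in> borel_measurable borel" unfolding b_def by measurable
  have ee: "cnj e * e = 1" "e * cnj e = 1" using e by (simp_all add: complex_norm_square[symmetric] mult.commute[of "cnj e"])
  have rot: "e *s (cnj e *s x) = x" for x :: "complex ^ 'n"
    unfolding vector_smult_assoc ee by simp

  have Bfin: "emeasure lborel ?B \<noteq> \<infinity>" "emeasure lborel ?B \<noteq> 0"
    using emeasure_lborel_ball_finite[of "0 :: complex ^ 'n" 1] content_ball_gt_0_iff[of "0 :: complex ^ 'n" 1]
    by (auto simp: measure_def)
  have bint: "(\<integral>\<^sup>+y. b (x - e *s y) \<partial>lborel) = emeasure lborel ?B" for x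
  proof -
    have "norm (x - e *s y) = norm (cnj e *s x - y)" for y
    proof -
      have "x - e *s y = e *s (cnj e *s x - y)" unfolding vector_ssub_ldistrib rot ..
      then have "norm (x - e *s y) = norm (e *s (cnj e *s x - y))" by (rule arg_cong)
      then show ?thesis unfolding norm_vec_smult e by simp
    qed
    moreover have "norm (e *s y - x) = norm (x - e *s y)" for y by (rule norm_minus_commute)
    ultimately have "(\<lambda>y. b (x - e *s y)) = indicator (ball (cnj e *s x) 1)"
      by (auto simp: b_def fun_eq_iff indicator_def dist_norm)
    then have "(\<integral>\<^sup>+y. b (x - e *s y) \<partial>lborel) = emeasure lborel (ball (cnj e *s x) 1)"
      by simp
    also have "\<dots> = emeasure lborel ?B"
      using content_ball_conv_unit_ball[of 1 "cnj e *s x"]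
      by (simp add: emeasure_eq_measure2[OF fmeasurable_lborel_bounded])
    finally show ?thesis .
  qed
  \<comment> \<open>The double integral of \<open>b x * h (x + e *s y)\<close> is evaluated in both
    orders. Integrating first in \<open>y\<close> removes the shift by \<open>x\<close>;
    substituting in \<open>x\<close> first leaves an integral of \<open>b (x - e *s y)\<close> over
    \<open>y\<close>, which is the volume of a unit ball.\<close>
  have "emeasure lborel ?B * (\<integral>\<^sup>+y. h (e *s y) \<partial>lborel) = (\<integral>\<^sup>+x. b x \<partial>lborel) * (\<integral>\<^sup>+y. h (e *s y) \<partial>lborel)"
    by (simp add: b_def)
  also have "\<dots> = (\<integral>\<^sup>+x. b x * (\<integral>\<^sup>+y. h (e *s y) \<partial>lborel) \<partial>lborel)"
    by (rule nn_integral_multc[symmetric]) measurable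
  also have "\<dots> = (\<integral>\<^sup>+x. (\<integral>\<^sup>+y. b x * h (x + e *s y) \<partial>lborel) \<partial>lborel)"
  proof (rule nn_integral_cong)
    fix x :: "complex ^ 'n"
    have "(\<integral>\<^sup>+y. h (e *s y) \<partial>lborel) = (\<integral>\<^sup>+y. h (e *s (cnj e *s x + y)) \<partial>lborel)"
      by (rule nn_integral_lborel_translate[symmetric]) measurable
    also have "\<dots> = (\<integral>\<^sup>+y. h (x + e *s y) \<partial>lborel)"
      by (simp only: vector_add_ldistrib rot)
    finally show "b x * (\<integral>\<^sup>+y. h (e *s y) \<partial>lborel) = (\<integral>\<^sup>+y. b x * h (x + e *s y) \<partial>lborel)"
      by (simp add: nn_integral_cmult)
  qed
  also have "\<dots> = (\<integral>\<^sup>+y. (\<integral>\<^sup>+x. b x * h (x + e *s y) \<partial>lborel) \<partial>lborel)"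
    by (rule lborel_pair.Fubini'[symmetric]) measurable
  also have "\<dots> = (\<integral>\<^sup>+y. (\<integral>\<^sup>+x. b (x - e *s y) * h x \<partial>lborel) \<partial>lborel)"
  proof (rule nn_integral_cong)
    fix y :: "complex ^ 'n"
    have "(\<lambda>x. b (x - e *s y) * h x) \<in> borel_measurable borel" by measurable
    from nn_integral_lborel_translate[OF this, of "e *s y"]
    show "(\<integral>\<^sup>+x. b x * h (x + e *s y) \<partial>lborel) = (\<integral>\<^sup>+x. b (x - e *s y) * h x \<partial>lborel)"
      by (simp add: add.commute)
  qed
  also have "\<dots> = (\<integral>\<^sup>+x. (\<integral>\<^sup>+y. b (x - e *s y) * h x \<partial>lborel) \<partial>lborel)"
    by (rule lborel_pair.Fubini') measurable
  also have "\<dots> = (\<integral>\<^sup>+x. emeasure lborel ?B * h x \<partial>lborel)"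
    by (intro nn_integral_cong) (subst nn_integral_multc, auto simp: bint)
  also have "\<dots> = emeasure lborel ?B * (\<integral>\<^sup>+x. h x \<partial>lborel)"
    by (rule nn_integral_cmult) measurable
  finally show ?thesis
    using Bfin by (simp add: ennreal_mult_cancel_left)
qed

text \<open>Cauchy's formula at the centre, with moduli taken. The circle is parametrised by the
  unit interval and the result stated for nonnegative integrals, ready for Tonelli.\<close>

lemma circle_sub_mean_value:
  assumes hol: "g holomorphic_on ball 0 1" and cont: "continuous_on (cball 0 1) g"
  shows "ennreal (cmod (g 0)) \<le> (\<integral>\<^sup>+t. ennreal (cmod (g (exp (2 * of_real pi * \<i> * of_real t)))) * indicator {0..1} t \<partial>lborel)"
proof -
  let ?e = "\<lambda>t :: real. exp (2 * of_real pi * \<i> * of_real t)"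
  have ne: "cmod (?e t) = 1" for t by (simp add: norm_exp_eq_Re)
  have cg: "continuous_on S (\<lambda>t. g (?e t))" for S
    by (rule continuous_on_compose2[OF cont]) (auto intro!: continuous_intros simp: ne)
  have "((\<lambda>u. g u / (u - 0)) has_contour_integral (2 * of_real pi * \<i> * g 0)) (circlepath 0 1)"
    by (rule Cauchy_integral_circlepath[OF cont hol]) simp
  then have "((\<lambda>t. g (?e t) / ?e t * (2 * pi * \<i> * ?e t)) has_integral (2 * of_real pi * \<i> * g 0)) {0..1}"
    unfolding has_contour_integral_def
  proof (rule has_integral_eq[rotated])
    fix t :: real assume t: "t \<in> {0..1}"
    have "circlepath 0 1 t = ?e t" by (simp add: circlepath)
    then show "g (circlepath 0 1 t) / (circlepath 0 1 t - 0) * vector_derivative (circlepath 0 1) (at t within {0..1}) =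
        g (?e t) / ?e t * (2 * pi * \<i> * ?e t)"
      using vector_derivative_circlepath01[of t 0 1] t by simp
  qed
  then have "((\<lambda>t. (2 * of_real pi * \<i>) * g (?e t)) has_integral (2 * of_real pi * \<i> * g 0)) {0..1}"
    by (rule has_integral_eq[rotated]) simp
  from has_integral_mult_right[OF this, of "1 / (2 * of_real pi * \<i>)"]
  have int: "((\<lambda>t. g (?e t)) has_integral g 0) {0..1}" by simp
  have int2: "((\<lambda>t. cmod (g (?e t))) has_integral integral {0..1} (\<lambda>t. cmod (g (?e t)))) {0..1}"
    by (intro integrable_integral integrable_continuous_interval continuous_on_norm cg)
  have "cmod (g 0) \<le> integral {0..1} (\<lambda>t. cmod (g (?e t)))"
    using int int2 by (metis (no_types, lifting) integral_norm_bound_integral has_integral_integrable integral_unique order_refl)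
  moreover have "(\<integral>\<^sup>+t. ennreal (cmod (g (?e t)) * indicator {0..1} t) \<partial>lborel) = ennreal (integral {0..1} (\<lambda>t. cmod (g (?e t))))"
  proof (rule nn_integral_has_integral_lborel)
    show "(\<lambda>t. cmod (g (?e t)) * indicator {0..1} t) \<in> borel_measurable borel"
      by (intro borel_measurable_times[OF borel_measurable_continuous_onI] continuous_on_norm cg) simp
    show "((\<lambda>t. cmod (g (?e t)) * indicator {0..1} t) has_integral integral {0..1} (\<lambda>t. cmod (g (?e t)))) UNIV"
      using int2 by (subst (asm) has_integral_restrict_UNIV[symmetric])
        (auto elim!: has_integral_eq[rotated] simp: indicator_def)
  qed simp
  ultimately show ?thesis
    by (simp add: ennreal_mult' ennreal_indicator ennreal_leI)
qed

text \<open>Displacements of size \<open>defect w\<close> in the complex direction of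
  \<open>w\<close> and of size sqrt (\<open>defect w\<close>) in general: the shape of a Carleson
  region centred at \<open>w\<close>. The factor 1/8 keeps w + v in the ball with comparable defect.
  Invariance under multiplication by |c| <= 1 allows discs in complex lines.\<close>

definition nonisotropic :: "complex ^ 'n \<Rightarrow> (complex ^ 'n) set" where
  "nonisotropic w = {v. cmod (cinner v w) < defect w / 8 \<and> (norm v)\<^sup>2 < defect w / 8}"

lemma open_nonisotropic: "open (nonisotropic w)"
  unfolding nonisotropic_def by (intro open_Collect_conj open_Collect_less continuous_intros)

lemma nonisotropic_smult:
  assumes "v \<in> nonisotropic w" "cmod c \<le> 1"
  shows "c *s v \<in> nonisotropic w"
proof -
  have "cmod c * cmod (cinner v w) \<le> cmod (cinner v w)" "cmod c * norm v \<le> norm v"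
    using assms(2) by (simp_all add: mult_left_le_one_le)
  then have "cmod (cinner (c *s v) w) \<le> cmod (cinner v w)" "(norm (c *s v))\<^sup>2 \<le> (norm v)\<^sup>2"
    by (simp_all add: cinner_simps norm_mult norm_vec_smult)
  then have "cmod (cinner (c *s v) w) < defect w / 8" "(norm (c *s v))\<^sup>2 < defect w / 8"
    using assms(1) unfolding nonisotropic_def mem_Collect_eq by linarith+
  then show ?thesis by (simp only: nonisotropic_def mem_Collect_eq)
qed

lemma nonisotropic_defect:
  assumes "norm w < 1" "v \<in> nonisotropic w"
  shows "norm (w + v) < 1" "defect w / 2 \<le> defect (w + v)" "defect (w + v) \<le> 2 * defect w"
proof -
  have d: "defect w > 0" using assms by (simp add: defect_pos)
  have v: "cmod (cinner v w) < defect w / 8" "(norm v)\<^sup>2 < defect w / 8" using assms(2) by (auto simp: nonisotropic_def)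
  have "\<bar>v \<bullet> w\<bar> < defect w / 8" using v(1) abs_Re_le_cmod[of "cinner v w"] by (simp add: Re_cinner)
  moreover have "defect (w + v) = defect w - 2 * (v \<bullet> w) - (norm v)\<^sup>2"
    by (simp add: defect_def power2_norm_eq_inner inner_add_left inner_add_right inner_commute)
  moreover have "0 \<le> (norm v)\<^sup>2" by simp
  ultimately show "defect w / 2 \<le> defect (w + v)" "defect (w + v) \<le> 2 * defect w"
    using v(2) d by linarith+
  then have "(norm (w + v))\<^sup>2 < 1" using d by (simp add: defect_def)
  then show "norm (w + v) < 1" by (simp add: abs_square_less_1)
qed

lemma bounded_nonisotropic: "bounded (nonisotropic w)"
proof (rule boundedI)
  fix v assume "v \<in> nonisotropic w"
  then have "(norm v)\<^sup>2 < defect w / 8" by (simp add: nonisotropic_def)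
  also have "\<dots> \<le> 1\<^sup>2" using defect_le_1[of w] by simp
  finally show "norm v \<le> 1" by (simp add: abs_square_less_1 less_imp_le)
qed

lemma nonisotropic_fmeasurable: "nonisotropic w \<in> fmeasurable lborel"
  by (intro fmeasurable_lborel_bounded bounded_nonisotropic borel_open open_nonisotropic)

text \<open>The ball of radius \<open>\<surd>(d/8)/2\<close> splits into about \<open>1/d\<close> cells on which \<open>\<langle>v,w\<rangle>\<close> varies by less than \<open>d/8\<close>;
  each cell is contained in a translate of the nonisotropic ball.\<close>
lemma measure_nonisotropic_ge:
  obtains c where "c > 0"
    "\<And>w :: complex ^ 'n. norm w < 1 \<Longrightarrow> c * defect w ^ (CARD('n) + 1) \<le> measure lborel (nonisotropic w)"
proof -
  let ?n = "CARD('n)"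
  define V where "V = measure lborel (ball (0 :: complex ^ 'n) 1)"
  have V: "V > 0" by (simp add: V_def)
  show ?thesis
  proof
    let ?c = "V / (32 ^ ?n * 3200)"
    show "?c > 0" using V by simp
    fix w :: "complex ^ 'n" assume w: "norm w < 1"
    define d where "d = defect w"
    have d: "0 < d" "d \<le> 1" using w by (simp_all add: d_def defect_pos defect_le_1)
    \<comment> \<open>Half of sqrt (d / 8), so that the difference of two points of the ball meets
      the norm condition.\<close>
    define R where "R = sqrt (d / 8) / 2"
    have R: "R > 0" "R\<^sup>2 = d / 32" using d by (simp_all add: R_def power_divide)
    \<comment> \<open>Real and imaginary parts each vary by less than d / 16 on a cell, hence the
      modulus by less than d / 8.\<close>
    define \<sigma> where "\<sigma> = d / 16"
    have \<sigma>: "\<sigma> > 0" using d by (simp add: \<sigma>_def)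
    define m where "m v = (\<lfloor>Re (cinner v w) / \<sigma>\<rfloor>, \<lfloor>Im (cinner v w) / \<sigma>\<rfloor>)" for v :: "complex ^ 'n"
    define K where "K = \<lceil>R / \<sigma>\<rceil>"
    define I where "I = {-K..K} \<times> {-K..K}"
    have "0 < R / \<sigma>" using R \<sigma> by simp
    then have K0: "0 \<le> K" unfolding K_def by linarith
    define Q where "Q i = {v \<in> ball (0 :: complex ^ 'n) R. m v = i}" for i
    have [measurable]: "ball (0 :: complex ^ 'n) R \<in> sets borel" by simp
    have Qm: "Q i \<in> sets borel" for i
    proof -
      have "Q i = {v \<in> space borel. v \<in> ball (0 :: complex ^ 'n) R \<and> \<lfloor>Re (cinner v w) / \<sigma>\<rfloor> = fst i \<and> \<lfloor>Im (cinner v w) / \<sigma>\<rfloor> = snd i}"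
        by (cases i) (auto simp: Q_def m_def)
      also have "\<dots> \<in> sets borel" by measurable
      finally show ?thesis .
    qed
    have mI: "m v \<in> I" if "v \<in> ball 0 R" for v
    proof -
      have "cmod (cinner v w) \<le> norm v * norm w" by (rule cinner_cauchy_schwarz)
      also have "\<dots> \<le> R" using that w by (intro mult_left_le[THEN order_trans]) auto
      finally have "\<bar>Re (cinner v w)\<bar> \<le> R" "\<bar>Im (cinner v w)\<bar> \<le> R"
        using abs_Re_le_cmod abs_Im_le_cmod order_trans by blast+
      moreover have "-K \<le> \<lfloor>x / \<sigma>\<rfloor> \<and> \<lfloor>x / \<sigma>\<rfloor> \<le> K" if "\<bar>x\<bar> \<le> R" for x
      proof -
        have "x / \<sigma> \<le> R / \<sigma>" "- (R / \<sigma>) \<le> x / \<sigma>" using that \<sigma> by (auto simp: field_simps)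
        moreover have "0 < R / \<sigma>" using R \<sigma> by simp
        ultimately show ?thesis unfolding K_def by linarith
      qed
      ultimately show ?thesis by (simp add: m_def I_def)
    qed
    have cell: "measure lborel (Q i) \<le> measure lborel (nonisotropic w)" for i
    proof (cases "Q i = {}")
      case False
      then obtain v0 where v0: "v0 \<in> Q i" by auto
      have "measure lborel (Q i) \<le> measure lborel {v. v - v0 \<in> nonisotropic w}"
      proof (rule measure_mono_fmeasurable)
        show "Q i \<subseteq> {v. v - v0 \<in> nonisotropic w}"
        proof
          fix v assume v: "v \<in> Q i"
          have fl: "\<bar>x - y\<bar> < \<sigma>" if "\<lfloor>x / \<sigma>\<rfloor> = \<lfloor>y / \<sigma>\<rfloor>" for x y
          proof -
            have "\<bar>x / \<sigma> - y / \<sigma>\<bar> < 1" using that by linarith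
            then show ?thesis using \<sigma> by (simp add: diff_divide_distrib[symmetric] abs_divide)
          qed
          have "\<bar>Re (cinner (v - v0) w)\<bar> < \<sigma>" "\<bar>Im (cinner (v - v0) w)\<bar> < \<sigma>"
            using v v0 by (auto simp: Q_def m_def cinner_simps intro!: fl)
          then have 1: "cmod (cinner (v - v0) w) < d / 8"
            using cmod_le[of "cinner (v - v0) w"] by (simp add: \<sigma>_def)
          have "norm (v - v0) < 2 * R"
            using v v0 norm_triangle_ineq4[of v v0] by (simp add: Q_def)
          then have "(norm (v - v0))\<^sup>2 < (2 * R)\<^sup>2" by (intro power_strict_mono) auto
          also have "\<dots> = d / 8" by (simp add: power_mult_distrib R)
          finally show "v \<in> {v. v - v0 \<in> nonisotropic w}" using 1 by (simp add: nonisotropic_def d_def)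
        qed
        show "Q i \<in> sets lborel" using Qm by simp
        have "{v. v - v0 \<in> nonisotropic w} = (\<lambda>v. v0 + v) ` nonisotropic w"
          by (auto simp: image_iff) (metis add_diff_cancel_left' diff_add_cancel add.commute)
        then have "bounded {v. v - v0 \<in> nonisotropic w}"
          using bounded_translation[OF bounded_nonisotropic] by metis
        moreover have "{v. v - v0 \<in> nonisotropic w} \<in> sets borel"
        proof -
          have [measurable]: "nonisotropic w \<in> sets borel" by (intro borel_open open_nonisotropic)
          have "{v \<in> space borel. v - v0 \<in> nonisotropic w} \<in> sets borel" by measurable
          then show ?thesis by simp
        qed
        ultimately show "{v. v - v0 \<in> nonisotropic w} \<in> fmeasurable lborel"
          by (intro fmeasurable_lborel_bounded)
      qed
      also have "\<dots> = measure lborel (nonisotropic w)"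
        by (intro measure_lborel_translate borel_open open_nonisotropic)
      finally show ?thesis .
    qed simp
    have "R ^ (2 * ?n) * V = measure lborel (ball (0 :: complex ^ 'n) R)"
      using content_ball_conv_unit_ball[of R "0 :: complex ^ 'n"] R by (simp add: V_def mult.commute)
    also have "\<dots> \<le> measure lborel (\<Union>i\<in>I. Q i)"
    proof (rule measure_mono_fmeasurable)
      show "ball 0 R \<subseteq> (\<Union>i\<in>I. Q i)" using mI by (auto simp: Q_def)
      show "(\<Union>i\<in>I. Q i) \<in> fmeasurable lborel"
      proof (rule fmeasurable_lborel_bounded)
        show "bounded (\<Union>i\<in>I. Q i)" by (rule bounded_subset[OF bounded_ball[of 0 R]]) (auto simp: Q_def)
        show "(\<Union>i\<in>I. Q i) \<in> sets borel" by (rule sets.finite_UN) (auto simp: I_def Qm)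
      qed
    qed simp
    also have "\<dots> \<le> (\<Sum>i\<in>I. measure lborel (Q i))"
    proof (rule measure_UNION_le)
      show "finite I" by (simp add: I_def)
    qed (simp add: Qm)
    also have "\<dots> \<le> (\<Sum>i\<in>I. measure lborel (nonisotropic w))" by (intro sum_mono cell)
    also have "\<dots> = real (card I) * measure lborel (nonisotropic w)" by simp
    also have "\<dots> \<le> 3200 / d * measure lborel (nonisotropic w)"
    proof (intro mult_right_mono)
      \<comment> \<open>Because R^2 = d / 32, the number R / \<sigma> equals 1 / (2 R), so there are
        at most 100 / R^2 = 3200 / d cells.\<close>
      have "real (card I) = (2 * real_of_int K + 1)\<^sup>2"
        using K0 by (simp add: I_def power2_eq_square algebra_simps)
      also have "\<dots> \<le> (10 * (1 / R))\<^sup>2"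
      proof (intro power_mono)
        have "R / \<sigma> = 1 / (2 * R)" using R d by (simp add: \<sigma>_def field_simps power2_eq_square)
        then have "real_of_int K \<le> 1 / (2 * R) + 1" unfolding K_def by linarith
        moreover have "1 \<le> 1 / R"
        proof -
          have "R\<^sup>2 \<le> 1\<^sup>2" using R d by simp
          then have "R \<le> 1" by (rule power2_le_imp_le) simp
          then show ?thesis using R by simp
        qed
        ultimately show "2 * real_of_int K + 1 \<le> 10 * (1 / R)" by (simp add: field_simps)
      qed (use K0 in simp)
      also have "\<dots> = 3200 / d" unfolding power_mult_distrib power_divide R(2) using d by simp
      finally show "real (card I) \<le> 3200 / d" .
    qed simp
    finally have 1: "R ^ (2 * ?n) * V \<le> 3200 / d * measure lborel (nonisotropic w)" .
    have "R ^ (2 * ?n) = d ^ ?n / 32 ^ ?n" by (simp only: power_mult R(2) power_divide)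
    then have "d * (d ^ ?n / 32 ^ ?n * V) \<le> d * (3200 / d * measure lborel (nonisotropic w))"
      using 1 d by (intro mult_left_mono) auto
    then show "?c * defect w ^ (?n + 1) \<le> measure lborel (nonisotropic w)"
      using d by (simp add: d_def[symmetric] field_simps)
  qed
qed

section \<open>Holomorphic functions on complex lines and the averaged mean value\<close>

lemma holomorphic_Cn_continuous_on:
  assumes "holomorphic_Cn_on f S"
  shows "continuous_on S f"
  using assms unfolding holomorphic_Cn_on_def
  by (intro continuous_at_imp_continuous_on ballI) (blast dest: has_derivative_continuous)

text \<open>Chain rule: complex homogeneity of the Frechet derivative \<open>D\<close> makes the
  derivative in \<open>c\<close> multiplication by \<open>D v\<close>.\<close>

lemma holomorphic_Cn_line:
  assumes "holomorphic_Cn_on f S" "\<And>c. c \<in> T \<Longrightarrow> w + c *s v \<in> S" "open T"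
  shows "(\<lambda>c. f (w + c *s v)) holomorphic_on T"
proof (rule holomorphic_onI)
  fix c assume c: "c \<in> T"
  then obtain D where D: "(f has_derivative D) (at (w + c *s v))" "\<And>c v. D (c *s v) = c * D v"
    using assms(1,2) unfolding holomorphic_Cn_on_def by blast
  have "bounded_linear (\<lambda>c. c *s v)"
    by (rule bounded_linear_intro[where K = "norm v"])
       (simp_all add: vector_sadd_rdistrib scaleR_eq_smult norm_vec_smult vector_smult_assoc scaleR_conv_of_real[where 'a = complex])
  then have "((\<lambda>c. w + c *s v) has_derivative (\<lambda>c. 0 + c *s v)) (at c)"
    by (intro has_derivative_add has_derivative_const bounded_linear_imp_has_derivative)
  then have "((\<lambda>c. w + c *s v) has_derivative (\<lambda>c. c *s v)) (at c)" by simp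
  from has_derivative_compose[OF this D(1)]
  have "((\<lambda>c. f (w + c *s v)) has_derivative (\<lambda>c. D v * c)) (at c)" by (simp add: D(2) mult.commute)
  then have "((\<lambda>c. f (w + c *s v)) has_field_derivative D v) (at c)"
    by (simp add: has_field_derivative_def)
  then show "(\<lambda>c. f (w + c *s v)) field_differentiable at c within T"
    using field_differentiable_at_within field_differentiable_def by blast
qed

text \<open>For each admissible \<open>v\<close> the circle inequality is applied to c -> f (w + c
  v). After integration over \<open>v\<close>, rotation invariance makes the inner integral
  independent of the angle, so the average over the circle disappears.\<close>

lemma nonisotropic_sub_mean_value:
  fixes f :: "complex ^ 'n \<Rightarrow> complex"
  assumes f: "holomorphic_Cn_on f (ball 0 1)" and w: "norm w < 1"
  shows "ennreal (cmod (f w)) * ennreal (measure lborel (nonisotropic w))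
    \<le> (\<integral>\<^sup>+u. ennreal (cmod (f u)) * indicator (nonisotropic w) (u - w) \<partial>lborel)"
proof -
  let ?S = "nonisotropic w"
  let ?e = "\<lambda>t :: real. exp (2 * of_real pi * \<i> * of_real t)"
  have ne: "cmod (?e t) = 1" for t by (simp add: norm_exp_eq_Re)
  \<comment> \<open>Extension by zero: the values of \<open>f\<close> outside the ball are
    arbitrary, while the invariance lemmas require a Borel function on the whole space.\<close>
  define F where "F u = indicator (ball 0 1) u *\<^sub>R f u" for u
  have F[measurable]: "F \<in> borel_measurable borel"
    unfolding F_def by (intro borel_measurable_continuous_on_indicator holomorphic_Cn_continuous_on f) simp
  have S[measurable]: "?S \<in> sets borel" by (intro borel_open open_nonisotropic)
  define h where "h v = ennreal (cmod (F (w + v))) * indicator ?S v" for v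
  have [measurable]: "h \<in> borel_measurable borel" unfolding h_def by measurable
  have in_ball: "w + c *s v \<in> ball 0 1" if "v \<in> ?S" "cmod c \<le> 1" for v c
    using nonisotropic_defect(1)[OF w nonisotropic_smult[OF that]] by simp
  have "ennreal (cmod (f w)) * ennreal (measure lborel ?S) = ennreal (cmod (f w)) * emeasure lborel ?S"
    by (simp add: emeasure_eq_measure2[OF nonisotropic_fmeasurable])
  also have "\<dots> = (\<integral>\<^sup>+v. ennreal (cmod (f w)) * indicator ?S v \<partial>lborel)"
    by (rule nn_integral_cmult_indicator[symmetric]) simp
  also have "\<dots> \<le> (\<integral>\<^sup>+v. (\<integral>\<^sup>+t. h (?e t *s v) * indicator {0..1} t \<partial>lborel) \<partial>lborel)"
  proof (rule nn_integral_mono)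
    fix v :: "complex ^ 'n"
    show "ennreal (cmod (f w)) * indicator ?S v \<le> (\<integral>\<^sup>+t. h (?e t *s v) * indicator {0..1} t \<partial>lborel)"
    proof (cases "v \<in> ?S")
      case True
      let ?g = "\<lambda>c. f (w + c *s v)"
      have "?g holomorphic_on ball 0 1"
        by (rule holomorphic_Cn_line[OF f]) (use in_ball[OF True] in auto)
      moreover have "continuous_on (cball 0 1) ?g"
        by (rule continuous_on_compose2[OF holomorphic_Cn_continuous_on[OF f]])
          (use in_ball[OF True] in \<open>auto intro!: continuous_intros\<close>)
      ultimately have "ennreal (cmod (?g 0)) \<le> (\<integral>\<^sup>+t. ennreal (cmod (?g (?e t))) * indicator {0..1} t \<partial>lborel)"
        by (rule circle_sub_mean_value)
      also have "\<dots> = (\<integral>\<^sup>+t. h (?e t *s v) * indicator {0..1} t \<partial>lborel)"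
      proof (intro nn_integral_cong)
        fix t
        have "w + ?e t *s v \<in> ball 0 1" "?e t *s v \<in> ?S"
          using in_ball[OF True, of "?e t"] nonisotropic_smult[OF True, of "?e t"] ne[of t] by simp_all
        then show "ennreal (cmod (?g (?e t))) * indicator {0..1} t = h (?e t *s v) * indicator {0..1} t"
          by (simp add: h_def F_def)
      qed
      finally show ?thesis using True by simp
    qed simp
  qed
  also have "\<dots> = (\<integral>\<^sup>+t. (\<integral>\<^sup>+v. h (?e t *s v) * indicator {0..1} t \<partial>lborel) \<partial>lborel)"
    by (rule lborel_pair.Fubini'[symmetric]) measurable
  also have "\<dots> = (\<integral>\<^sup>+t. (\<integral>\<^sup>+v. h v \<partial>lborel) * indicator {0..1::real} t \<partial>lborel)"
  proof (rule nn_integral_cong)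
    fix t :: real
    have "(\<integral>\<^sup>+v. h (?e t *s v) * indicator {0..1} t \<partial>lborel) = (\<integral>\<^sup>+v. h (?e t *s v) \<partial>lborel) * indicator {0..1} t"
      by (rule nn_integral_multc) measurable
    then show "(\<integral>\<^sup>+v. h (?e t *s v) * indicator {0..1} t \<partial>lborel) = (\<integral>\<^sup>+v. h v \<partial>lborel) * indicator {0..1} t"
      by (simp add: nn_integral_lborel_rotate ne)
  qed
  also have "\<dots> = (\<integral>\<^sup>+v. h v \<partial>lborel)"
    by (subst nn_integral_cmult_indicator) auto
  also have "\<dots> = (\<integral>\<^sup>+u. h (- w + u) \<partial>lborel)"
    by (rule nn_integral_lborel_translate[symmetric]) measurable
  also have "\<dots> = (\<integral>\<^sup>+u. ennreal (cmod (f u)) * indicator ?S (u - w) \<partial>lborel)"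
  proof (rule nn_integral_cong)
    fix u :: "complex ^ 'n"
    show "h (- w + u) = ennreal (cmod (f u)) * indicator ?S (u - w)"
      using in_ball[of "u - w" 1] by (cases "u - w \<in> ?S") (auto simp: h_def F_def add.commute)
  qed
  finally show ?thesis .
qed

section \<open>The area function\<close>

text \<open>Let d = \<open>defect w\<close>. On the nonisotropic ball around \<open>w\<close> the
  weight is of order d^\<alpha> and the kernel centred at \<open>z\<close> is at least of order
  d^-(n+1+\<alpha>), while the volume of that ball is at least of order d^(n+1). The sub-mean value
  inequality therefore sees only part of the integral defining \<open>abs_bergman\<close>.\<close>

lemma holomorphic_le_abs_bergman:
  assumes \<alpha>: "\<alpha> > -1" and \<gamma>: "\<gamma> > 0" and p: "p > 1"
  obtains C where "C > 0"
    "\<And>f z w. f \<in> bergman_space \<alpha> p \<Longrightarrow> norm (z :: complex ^ 'n) < 1 \<Longrightarrow> w \<in> bergman_ball z \<gamma> \<Longrightarrow>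
       cmod (f w) \<le> C * abs_bergman \<alpha> f z"
proof -
  let ?n = "CARD('n)"
  let ?N = "real ?n + 1 + \<alpha>"
  obtain C0 where C0: "C0 > 1" "\<And>z w. norm (z :: complex ^ 'n) < 1 \<Longrightarrow> w \<in> bergman_ball z \<gamma> \<Longrightarrow>
     norm w < 1 \<and> defect z \<le> C0 * defect w \<and> defect w \<le> C0 * defect z \<and> cmod (1 - cinner z w) \<le> C0 * defect w \<and> cmod (1 - cinner z w) \<le> C0 * defect z"
    using bergman_ball_geometry[OF \<gamma>, where 'n='n] by blast
  obtain c where c: "c > 0"
    "\<And>w :: complex ^ 'n. norm w < 1 \<Longrightarrow> c * defect w ^ (?n + 1) \<le> measure lborel (nonisotropic w)"
    using measure_nonisotropic_ge by blast
  define C1 where "C1 = 2 * C0 + 1"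
  \<comment> \<open>The factor 1 + 2 powr |\<alpha>| compares d^\<alpha> with
    \<open>defect u powr \<alpha>\<close> for either sign of \<alpha>.\<close>
  define C2 where "C2 = (1 + 2 powr \<bar>\<alpha>\<bar>) * C1 powr ?N"
  have C12: "C1 > 0" "C2 > 0" using C0 by (auto simp: C1_def C2_def intro!: mult_pos_pos add_pos_pos)
  let ?w = "weighted_const TYPE('n) \<alpha>"
  have w0: "?w > 0" using \<alpha> by (rule weighted_const_pos)
  show ?thesis
  proof
    show "C2 / (c * ?w) > 0" using C12 c w0 by simp
    fix f :: "complex ^ 'n \<Rightarrow> complex" and z w :: "complex ^ 'n"
    assume f: "f \<in> bergman_space \<alpha> p" and z: "norm z < 1" and wD: "w \<in> bergman_ball z \<gamma>"
    from f have fL: "f \<in> Lp_fun (vol_weighted \<alpha>) p" and fh: "holomorphic_Cn_on f (ball 0 1)"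
      by (auto simp: bergman_space_def)
    from C0(2)[OF z wD] have w: "norm w < 1" and zw: "cmod (1 - cinner z w) \<le> C0 * defect w" by auto
    define d where "d = defect w"
    have d: "d > 0" using w by (simp add: d_def defect_pos)
    note [measurable] = borel_measurable_id_weighted(1)[of \<alpha>, where 'n='n] Lp_fun_measurable[OF fL]
    have key: "ennreal (cmod (f u)) * indicator (nonisotropic w) (u - w) \<le>
        ennreal (C2 * d ^ (?n + 1)) * (ennreal (defect u powr \<alpha>) * ennreal (abs_kernel \<alpha> z u * cmod (f u)) * indicator (ball 0 1) u)" for u
    proof (cases "u - w \<in> nonisotropic w")
      case True
      let ?v = "u - w"
      have u: "norm u < 1" "d / 2 \<le> defect u" "defect u \<le> 2 * d"
        using nonisotropic_defect[OF w True] by (simp_all add: d_def)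
      have v: "cmod (cinner ?v w) < d / 8" "(norm ?v)\<^sup>2 < d / 8" using True by (auto simp: nonisotropic_def d_def)
      have zu: "cmod (1 - cinner z u) \<le> C1 * d"
      proof -
        have "(norm (z - w))\<^sup>2 \<le> 2 * (C0 * d)"
          using norm_diff_square_le[of z w] z w zw by (simp add: d_def)
        have "(norm (z - w) * norm ?v)\<^sup>2 \<le> (2 * (C0 * d)) * (d / 8)"
          unfolding power_mult_distrib using v(2) \<open>(norm (z - w))\<^sup>2 \<le> 2 * (C0 * d)\<close> C0 d by (intro mult_mono) auto
        also have "\<dots> \<le> (C0 * d)\<^sup>2"
        proof -
          have "C0 * d * d \<le> C0 * (C0 * d * d)" using C0(1) d by simp
          then show ?thesis using C0(1) d by (simp add: power2_eq_square algebra_simps)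
        qed
        finally have 1: "norm (z - w) * norm ?v \<le> C0 * d" by (rule power2_le_imp_le) (use C0 d in simp)
        \<comment> \<open>The middle term is of order d by the condition along \<open>w\<close>; in
          the last one both vectors have size of order sqrt d.\<close>
        have "1 - cinner z u = (1 - cinner z w) - cinner w ?v - cinner (z - w) ?v"
          by (simp add: cinner_simps)
        then have "cmod (1 - cinner z u) \<le> cmod (1 - cinner z w) + cmod (cinner w ?v) + cmod (cinner (z - w) ?v)"
          using norm_triangle_ineq4[of "(1 - cinner z w) - cinner w ?v" "cinner (z - w) ?v"]
            norm_triangle_ineq4[of "1 - cinner z w" "cinner w ?v"] by (simp only:)
        also have "\<dots> \<le> C0 * d + d / 8 + C0 * d"
          using zw v(1) 1 cinner_cauchy_schwarz[of "z - w" ?v] cmod_cinner_commute[of w ?v] by (intro add_mono) (auto simp: d_def)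
        also have "\<dots> \<le> C1 * d" using d by (simp add: C1_def algebra_simps)
        finally show ?thesis .
      qed
      have pz: "0 < cmod (1 - cinner z u)" using one_minus_cinner_bounds(1)[of z u] z u by simp
      have k: "1 / (C1 * d) powr ?N \<le> abs_kernel \<alpha> z u"
        using zu pz \<alpha> C12 d by (intro divide_left_mono powr_mono2 mult_pos_pos) auto
      have du: "0 < defect u" using u(1) by (rule defect_pos)
      have da: "d powr \<alpha> \<le> (1 + 2 powr \<bar>\<alpha>\<bar>) * defect u powr \<alpha>"
      proof (cases "\<alpha> \<ge> 0")
        case True
        have "d powr \<alpha> \<le> (2 * defect u) powr \<alpha>" using u(2) d True by (intro powr_mono2) auto
        also have "\<dots> = 2 powr \<bar>\<alpha>\<bar> * defect u powr \<alpha>" using du True by (simp add: powr_mult)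
        finally show ?thesis by (simp add: algebra_simps add_increasing)
      next
        case False
        have "d powr \<alpha> \<le> (defect u / 2) powr \<alpha>" using u(3) d du False by (intro powr_mono2') auto
        also have "\<dots> = 2 powr \<bar>\<alpha>\<bar> * defect u powr \<alpha>" using du False by (simp add: powr_divide powr_minus field_simps)
        finally show ?thesis by (simp add: algebra_simps add_increasing)
      qed
      have dN: "d powr ?N = d ^ (?n + 1) * d powr \<alpha>"
        using d powr_realpow[OF d, of "?n + 1"] by (simp add: powr_add)
      have "1 = C1 powr ?N * d powr ?N * (1 / (C1 * d) powr ?N)"
        using C12 d by (simp add: powr_mult)
      also have "\<dots> \<le> C1 powr ?N * d powr ?N * abs_kernel \<alpha> z u"
        using k by (intro mult_left_mono) auto
      also have "\<dots> = C1 powr ?N * d ^ (?n + 1) * abs_kernel \<alpha> z u * d powr \<alpha>"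
        unfolding dN by (simp only: ac_simps)
      also have "\<dots> \<le> C1 powr ?N * d ^ (?n + 1) * abs_kernel \<alpha> z u * ((1 + 2 powr \<bar>\<alpha>\<bar>) * defect u powr \<alpha>)"
        using da d by (intro mult_left_mono) auto
      also have "\<dots> = C2 * d ^ (?n + 1) * (defect u powr \<alpha> * abs_kernel \<alpha> z u)"
        unfolding C2_def by (simp only: ac_simps)
      finally have "1 * cmod (f u) \<le> C2 * d ^ (?n + 1) * (defect u powr \<alpha> * abs_kernel \<alpha> z u) * cmod (f u)"
        by (rule mult_right_mono) simp
      then have "ennreal (cmod (f u)) \<le> ennreal (C2 * d ^ (?n + 1) * (defect u powr \<alpha> * (abs_kernel \<alpha> z u * cmod (f u))))"
        by (intro ennreal_leI) (simp only: mult_1_left mult.assoc)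
      also have "\<dots> = ennreal (C2 * d ^ (?n + 1)) * (ennreal (defect u powr \<alpha>) * ennreal (abs_kernel \<alpha> z u * cmod (f u)))"
        using C12 d by (subst ennreal_mult; (subst ennreal_mult)?) auto
      finally show ?thesis using True u(1) by simp
    qed simp
    have int: "integrable (vol_weighted \<alpha>) (\<lambda>u. abs_kernel \<alpha> z u * cmod (f u))"
      by (intro integrable_abs_kernel \<alpha> z Lp_fun_integrable_vol_weighted[OF \<alpha> p fL])
    have "ennreal (cmod (f w)) * ennreal (c * d ^ (?n + 1)) \<le> ennreal (cmod (f w)) * ennreal (measure lborel (nonisotropic w))"
      using c(2)[OF w] by (intro mult_left_mono ennreal_leI) (auto simp: d_def)
    also have "\<dots> \<le> (\<integral>\<^sup>+u. ennreal (cmod (f u)) * indicator (nonisotropic w) (u - w) \<partial>lborel)"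
      by (rule nonisotropic_sub_mean_value[OF fh w])
    also have "\<dots> \<le> (\<integral>\<^sup>+u. ennreal (C2 * d ^ (?n + 1)) * (ennreal (defect u powr \<alpha>) * ennreal (abs_kernel \<alpha> z u * cmod (f u)) * indicator (ball 0 1) u) \<partial>lborel)"
      by (intro nn_integral_mono key)
    also have "\<dots> = ennreal (C2 * d ^ (?n + 1)) * (\<integral>\<^sup>+u. ennreal (defect u powr \<alpha>) * ennreal (abs_kernel \<alpha> z u * cmod (f u)) * indicator (ball 0 1) u \<partial>lborel)"
    proof (rule nn_integral_cmult)
      have "(\<lambda>u. ennreal (defect u powr \<alpha>) * ennreal (abs_kernel \<alpha> z u * cmod (f u))) \<in> borel_measurable (vol_weighted \<alpha>)"
        by measurable
      then show "(\<lambda>u. ennreal (defect u powr \<alpha>) * ennreal (abs_kernel \<alpha> z u * cmod (f u)) * indicator (ball 0 1) u) \<in> borel_measurable lborel"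
        by (simp add: measurable_weighted_eq borel_measurable_restrict_space_iff_ennreal)
    qed
    finally have 1: "ennreal (cmod (f w)) * ennreal (c * d ^ (?n + 1)) \<le> ennreal (C2 * d ^ (?n + 1)) *
        (\<integral>\<^sup>+u. ennreal (defect u powr \<alpha>) * ennreal (abs_kernel \<alpha> z u * cmod (f u)) * indicator (ball 0 1) u \<partial>lborel)" .
    have "ennreal ?w * (ennreal (cmod (f w)) * ennreal (c * d ^ (?n + 1))) \<le> ennreal ?w * (ennreal (C2 * d ^ (?n + 1)) *
        (\<integral>\<^sup>+u. ennreal (defect u powr \<alpha>) * ennreal (abs_kernel \<alpha> z u * cmod (f u)) * indicator (ball 0 1) u \<partial>lborel))"
      by (rule mult_left_mono[OF 1]) simp
    also have "\<dots> = ennreal (C2 * d ^ (?n + 1)) * (\<integral>\<^sup>+u. ennreal (abs_kernel \<alpha> z u * cmod (f u)) \<partial>vol_weighted \<alpha>)"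
    proof -
      have "(\<integral>\<^sup>+u. ennreal (abs_kernel \<alpha> z u * cmod (f u)) \<partial>vol_weighted \<alpha>) =
          ennreal ?w * (\<integral>\<^sup>+u. ennreal (defect u powr \<alpha>) * ennreal (abs_kernel \<alpha> z u * cmod (f u)) * indicator (ball 0 1) u \<partial>lborel)"
        by (rule nn_integral_vol_weighted[OF \<alpha>]) measurable
      then show ?thesis by (simp only: mult.left_commute)
    qed
    also have "(\<integral>\<^sup>+u. ennreal (abs_kernel \<alpha> z u * cmod (f u)) \<partial>vol_weighted \<alpha>) = ennreal (abs_bergman \<alpha> f z)"
      unfolding abs_bergman_def by (rule nn_integral_eq_integral[OF int]) simp
    finally have "ennreal (?w * (cmod (f w) * (c * d ^ (?n + 1)))) \<le> ennreal (C2 * d ^ (?n + 1) * abs_bergman \<alpha> f z)"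
      using w0 c(1) d C12 abs_bergman_nonneg[of \<alpha> f z] by (simp add: ennreal_mult)
    then have "?w * (cmod (f w) * (c * d ^ (?n + 1))) \<le> C2 * d ^ (?n + 1) * abs_bergman \<alpha> f z"
      using C12 d abs_bergman_nonneg[of \<alpha> f z] by (subst (asm) ennreal_le_iff) auto
    then have "(?w * (cmod (f w) * c)) * d ^ (?n + 1) \<le> (C2 * abs_bergman \<alpha> f z) * d ^ (?n + 1)"
      by (simp only: ac_simps)
    then have "?w * (cmod (f w) * c) \<le> C2 * abs_bergman \<alpha> f z"
      using d by (subst (asm) mult_le_cancel_right_pos) auto
    then show "cmod (f w) \<le> C2 / (c * ?w) * abs_bergman \<alpha> f z"
      using w0 c(1) by (simp add: field_simps)
  qed
qed

section \<open>Norms, measurability and boundedness of the area function\<close>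

lemma Lp_fun_bounded:
  assumes M: "finite_measure M" and f[measurable]: "f \<in> borel_measurable M" and q: "q > 0" and c: "c \<ge> 0"
    and b: "AE x in M. norm (f x) \<le> c"
  shows "f \<in> Lp_fun M q" "Lp_norm M q f \<le> c * measure M (space M) powr (1 / q)"
proof -
  interpret finite_measure M by fact
  have b': "AE x in M. norm (f x) powr q \<le> c powr q"
    using b by eventually_elim (use q in \<open>auto intro: powr_mono2\<close>)
  have int: "integrable M (\<lambda>x. norm (f x) powr q)"
    using b' by (intro integrable_const_bound[of _ "c powr q"]) auto
  then show "f \<in> Lp_fun M q" using f by (intro Lp_funI)
  have "(\<integral>x. norm (f x) powr q \<partial>M) \<le> (\<integral>x. c powr q \<partial>M)"
    using int b' by (intro integral_mono_AE) auto
  also have "\<dots> = c powr q * measure M (space M)" by simp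
  finally have "Lp_norm M q f \<le> (c powr q * measure M (space M)) powr (1 / q)"
    unfolding Lp_norm_def using q by (intro powr_mono2) auto
  also have "\<dots> = c * measure M (space M) powr (1 / q)"
    using q c by (simp add: powr_mult powr_powr)
  finally show "Lp_norm M q f \<le> c * measure M (space M) powr (1 / q)" .
qed

lemma Lp_fun_nn_integral_le:
  assumes f[measurable]: "f \<in> borel_measurable M" and p: "p > 0" and c: "c \<ge> 0"
    and le: "(\<integral>\<^sup>+x. ennreal (norm (f x) powr p) \<partial>M) \<le> ennreal (c powr p)"
  shows "f \<in> Lp_fun M p" "Lp_norm M p f \<le> c"
proof -
  have "integrable M (\<lambda>x. norm (f x) powr p)"
    using le by (intro integrableI_bounded) (auto simp: le_less_trans)
  then show fL: "f \<in> Lp_fun M p" using f by (intro Lp_funI)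
  have "Lp_norm M p f powr p \<le> c powr p"
    using le nn_integral_Lp_norm[OF p fL] by (simp add: ennreal_le_iff)
  then show "Lp_norm M p f \<le> c"
    using p c powr_less_mono2[of p c "Lp_norm M p f"] by (meson not_le)
qed

lemma measurable_inv_borel:
  "g \<in> measurable N (inv_measure :: (complex ^ 'n) measure) \<Longrightarrow> g \<in> borel_measurable N"
  by (rule measurable_compose[OF _ borel_measurable_id_weighted(2)])

text \<open>The domain of integration moves with \<open>z\<close>, so its indicator must be
  measurable in both variables jointly; the inequality with tanh \<gamma> in
  \<open>bergman_ball_iff\<close> provides this.\<close>

lemma area_fun_measurable:
  fixes f :: "complex ^ 'n \<Rightarrow> complex"
  assumes f: "f \<in> borel_measurable (inv_measure :: (complex ^ 'n) measure)"
  shows "area_fun q \<gamma> f \<in> borel_measurable (vol_weighted \<alpha>)"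
proof -
  let ?I = "inv_measure :: (complex ^ 'n) measure" and ?M = "vol_weighted \<alpha> :: (complex ^ 'n) measure"
  interpret I: sigma_finite_measure ?I by (rule sigma_finite_inv_measure)
  note [measurable (raw)] = measurable_weighted_borel measurable_inv_borel
  note [measurable] = f
  \<comment> \<open>The expression from \<open>ball_aut_eq\<close>: it is jointly Borel without a
    case split and agrees with \<open>ball_aut\<close> on the ball.\<close>
  define A :: "complex ^ 'n \<Rightarrow> complex ^ 'n \<Rightarrow> complex ^ 'n" where
    "A z w = (1 / (1 - cinner w z)) *s (z - complex_of_real (sqrt (defect z)) *s w
      - (cinner w z / (1 + complex_of_real (sqrt (defect z)))) *s z)" for z w
  have [measurable]: "(\<lambda>x. A (fst x) (snd x)) \<in> borel_measurable (?M \<Otimes>\<^sub>M ?I)"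
    unfolding A_def by measurable
  have [measurable]: "Measurable.pred (?M \<Otimes>\<^sub>M ?I) (\<lambda>x. norm (A (fst x) (snd x)) < tanh \<gamma>)"
    by measurable
  have F: "(\<lambda>x. if norm (A (fst x) (snd x)) < tanh \<gamma> then cmod (f (snd x)) powr q else 0) \<in> borel_measurable (?M \<Otimes>\<^sub>M ?I)"
    by measurable
  have eq: "(if norm (A (fst x) (snd x)) < tanh \<gamma> then cmod (f (snd x)) powr q else 0)
      = indicator (bergman_ball (fst x) \<gamma>) (snd x) *\<^sub>R (cmod (f (snd x)) powr q)" if "x \<in> space (?M \<Otimes>\<^sub>M ?I)" for x
    using that bergman_ball_iff[of "fst x" "snd x" \<gamma>] ball_aut_eq[of "fst x" "snd x"]
    by (auto simp: space_pair_measure A_def)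
  have "(\<lambda>x. if norm (A (fst x) (snd x)) < tanh \<gamma> then cmod (f (snd x)) powr q else 0) \<in> borel_measurable (?M \<Otimes>\<^sub>M ?I)
      \<longleftrightarrow> (\<lambda>x. indicator (bergman_ball (fst x) \<gamma>) (snd x) *\<^sub>R (cmod (f (snd x)) powr q)) \<in> borel_measurable (?M \<Otimes>\<^sub>M ?I)"
    by (rule measurable_cong[OF eq])
  with F have "(\<lambda>x. indicator (bergman_ball (fst x) \<gamma>) (snd x) *\<^sub>R (cmod (f (snd x)) powr q)) \<in> borel_measurable (?M \<Otimes>\<^sub>M ?I)"
    by blast
  then have "(\<lambda>z. LINT w|?I. indicator (bergman_ball z \<gamma>) w *\<^sub>R (cmod (f w) powr q)) \<in> borel_measurable ?M"
    by (intro I.borel_measurable_lebesgue_integral) (simp add: case_prod_unfold)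
  then show ?thesis unfolding area_fun_def set_lebesgue_integral_def by measurable
qed

lemma area_fun_le:
  fixes f :: "complex ^ 'n \<Rightarrow> complex"
  assumes q: "q > 1" and f[measurable]: "f \<in> borel_measurable (inv_measure :: (complex ^ 'n) measure)"
    and z: "norm z < 1" and \<tau>: "emeasure inv_measure (bergman_ball z \<gamma>) \<le> ennreal C" "C \<ge> 0"
    and b: "\<And>w. w \<in> bergman_ball z \<gamma> \<Longrightarrow> cmod (f w) \<le> c" and c: "c \<ge> 0"
  shows "set_integrable inv_measure (bergman_ball z \<gamma>) (\<lambda>w. cmod (f w) powr q)"
    and "area_fun q \<gamma> f z \<le> C powr (1 / q) * c"
proof -
  let ?I = "inv_measure :: (complex ^ 'n) measure" and ?D = "bergman_ball z \<gamma>"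
  have D[measurable]: "?D \<in> sets ?I" using z by (rule bergman_ball_sets)
  have fin: "emeasure ?I ?D < \<infinity>" using \<tau>(1) by (rule le_less_trans) simp
  have i: "integrable ?I (\<lambda>w. indicator ?D w *\<^sub>R (c powr q))"
    using fin by (intro integrable_scaleR_left integrable_real_indicator D)
  have le: "indicator ?D w *\<^sub>R (cmod (f w) powr q) \<le> indicator ?D w *\<^sub>R (c powr q)" for w
    using b q by (auto simp: indicator_def intro: powr_mono2)
  have int: "integrable ?I (\<lambda>w. indicator ?D w *\<^sub>R (cmod (f w) powr q))"
  proof (rule Bochner_Integration.integrable_bound[OF i])
    show "(\<lambda>w. indicator ?D w *\<^sub>R (cmod (f w) powr q)) \<in> borel_measurable ?I" by measurable
    show "AE w in ?I. norm (indicator ?D w *\<^sub>R (cmod (f w) powr q)) \<le> norm (indicator ?D w *\<^sub>R (c powr q))"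
      using le by (intro AE_I2) (auto simp: indicator_def split: if_splits)
  qed
  then show "set_integrable ?I ?D (\<lambda>w. cmod (f w) powr q)" by (simp add: set_integrable_def)
  have "(LINT w:?D|?I. cmod (f w) powr q) \<le> (LINT w|?I. indicator ?D w *\<^sub>R (c powr q))"
    unfolding set_lebesgue_integral_def using int i le by (rule integral_mono)
  also have "\<dots> = measure ?I ?D * (c powr q)"
    using D sets.sets_into_space[OF D] by (simp add: Int_absorb2)
  also have "\<dots> \<le> C * c powr q"
    using \<tau> by (intro mult_right_mono) (auto simp: measure_def enn2real_leI)
  finally have "area_fun q \<gamma> f z \<le> (C * c powr q) powr (1 / q)"
    unfolding area_fun_def using q
    by (intro powr_mono2) (auto simp: set_lebesgue_integral_def intro!: integral_nonneg_AE AE_I2)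
  then show "area_fun q \<gamma> f z \<le> C powr (1 / q) * c"
    using q c \<tau>(2) by (simp add: powr_mult powr_powr)
qed

lemma abs_bergman_measurable:
  fixes f :: "complex ^ 'n \<Rightarrow> complex"
  assumes \<alpha>: "\<alpha> > -1" and [measurable]: "f \<in> borel_measurable (vol_weighted \<alpha>)"
  shows "abs_bergman \<alpha> f \<in> borel_measurable (vol_weighted \<alpha>)"
proof -
  interpret M: finite_measure "vol_weighted \<alpha> :: (complex ^ 'n) measure"
    using \<alpha> by (rule finite_measure_vol_weighted)
  note [measurable (raw)] = measurable_weighted_borel
  note [measurable] = borel_measurable_id_weighted(1)[of \<alpha>, where 'n='n]
  show ?thesis
    unfolding abs_bergman_def by (intro M.borel_measurable_lebesgue_integral) measurable
qed

text \<open>On D(z,\<gamma>) the function is at most a constant times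
  \<open>abs_bergman \<alpha> f z\<close>, and these balls have uniformly bounded \<tau>-measure.
  The area function is thus dominated pointwise by the positive operator.\<close>

lemma area_fun_bounded:
  assumes \<gamma>: "\<gamma> > 0" and \<alpha>: "\<alpha> > -1" and q: "1 < q" and p: "1 < p"
  shows "\<exists>C>0. \<forall>f\<in>(bergman_space \<alpha> p :: (complex ^ 'n \<Rightarrow> complex) set).
           (\<forall>z\<in>ball 0 1.
             set_integrable inv_measure (bergman_ball z \<gamma>) (\<lambda>w. cmod (f w) powr q)) \<and>
           area_fun q \<gamma> f \<in> Lp_fun (vol_weighted \<alpha>) p \<and>
           Lp_norm (vol_weighted \<alpha>) p (area_fun q \<gamma> f) \<le> C * Lp_norm (vol_weighted \<alpha>) p f"
proof -
  let ?M = "vol_weighted \<alpha> :: (complex ^ 'n) measure"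
  obtain C1 where C1: "C1 > 0" "\<And>f z w. f \<in> bergman_space \<alpha> p \<Longrightarrow> norm (z :: complex ^ 'n) < 1 \<Longrightarrow> w \<in> bergman_ball z \<gamma> \<Longrightarrow>
       cmod (f w) \<le> C1 * abs_bergman \<alpha> f z"
    using holomorphic_le_abs_bergman[OF \<alpha> \<gamma> p, where 'n='n] by blast
  obtain C2 where C2: "C2 > 0" "\<And>z :: complex ^ 'n. norm z < 1 \<Longrightarrow> emeasure inv_measure (bergman_ball z \<gamma>) \<le> ennreal C2"
    using emeasure_bergman_ball_le[OF \<gamma>] by blast
  obtain C3 where C3: "C3 > 0" "\<And>f :: complex ^ 'n \<Rightarrow> complex. f \<in> Lp_fun ?M p \<Longrightarrow>
      (\<integral>\<^sup>+z. ennreal (abs_bergman \<alpha> f z powr p) \<partial>?M) \<le> ennreal (C3 * Lp_norm ?M p f powr p)"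
    using abs_bergman_bounded[OF \<alpha> p] by blast
  define K where "K = C2 powr (1 / q) * C1"
  have K: "K > 0" using C1 C2 by (simp add: K_def)
  let ?C = "K * C3 powr (1 / p)"
  show ?thesis
  proof (intro exI[of _ ?C] conjI ballI)
    show "?C > 0" using K C3 by simp
    fix f :: "complex ^ 'n \<Rightarrow> complex" assume f: "f \<in> bergman_space \<alpha> p"
    then have fL: "f \<in> Lp_fun ?M p" by (simp add: bergman_space_def)
    have fm: "f \<in> borel_measurable inv_measure"
      using Lp_fun_measurable[OF fL] by (simp add: measurable_weighted_eq)
    have *: "set_integrable inv_measure (bergman_ball z \<gamma>) (\<lambda>w. cmod (f w) powr q)"
       "area_fun q \<gamma> f z \<le> K * abs_bergman \<alpha> f z" if z: "norm z < 1" for z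
      using area_fun_le[OF q fm z C2(2)[OF z] less_imp_le[OF C2(1)] C1(2)[OF f z]] C1(1) abs_bergman_nonneg[of \<alpha> f z]
      by (auto simp: K_def mult.assoc)
    show "set_integrable inv_measure (bergman_ball z \<gamma>) (\<lambda>w. cmod (f w) powr q)" if "z \<in> ball 0 1" for z
      using * that by simp
    have "(\<integral>\<^sup>+z. ennreal (norm (area_fun q \<gamma> f z) powr p) \<partial>?M) \<le> (\<integral>\<^sup>+z. ennreal (K powr p) * ennreal (abs_bergman \<alpha> f z powr p) \<partial>?M)"
    proof (rule nn_integral_mono)
      fix z assume "z \<in> space ?M"
      then have z: "norm z < 1" by simp
      have a0: "0 \<le> area_fun q \<gamma> f z" by (simp add: area_fun_def)
      have "norm (area_fun q \<gamma> f z) powr p \<le> (K * abs_bergman \<alpha> f z) powr p"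
        using *(2)[OF z] a0 p by (intro powr_mono2) auto
      also have "\<dots> = K powr p * abs_bergman \<alpha> f z powr p"
        using K abs_bergman_nonneg[of \<alpha> f z] by (intro powr_mult)
      finally show "ennreal (norm (area_fun q \<gamma> f z) powr p) \<le> ennreal (K powr p) * ennreal (abs_bergman \<alpha> f z powr p)"
        by (subst ennreal_mult[symmetric]) (auto intro: ennreal_leI)
    qed
    also have "\<dots> = ennreal (K powr p) * (\<integral>\<^sup>+z. ennreal (abs_bergman \<alpha> f z powr p) \<partial>?M)"
      using abs_bergman_measurable[OF \<alpha> Lp_fun_measurable[OF fL]] by (intro nn_integral_cmult) measurable
    also have "\<dots> \<le> ennreal (K powr p) * ennreal (C3 * Lp_norm ?M p f powr p)"
      by (intro mult_left_mono C3 fL) simp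
    also have "\<dots> = ennreal ((?C * Lp_norm ?M p f) powr p)"
      using C3(1) K p Lp_norm_nonneg[of ?M p f] by (subst ennreal_mult[symmetric]) (auto simp: powr_mult powr_powr mult.assoc)
    finally have "(\<integral>\<^sup>+z. ennreal (norm (area_fun q \<gamma> f z) powr p) \<partial>?M) \<le> ennreal ((?C * Lp_norm ?M p f) powr p)" .
    from Lp_fun_nn_integral_le[OF area_fun_measurable[OF fm] _ _ this]
    show "area_fun q \<gamma> f \<in> Lp_fun ?M p" "Lp_norm ?M p (area_fun q \<gamma> f) \<le> ?C * Lp_norm ?M p f"
      using p K Lp_norm_nonneg[of ?M p f] by auto
  qed
qed

section \<open>Pointwise estimates for the kernel\<close>

lemma cmod_powr_neg_of_real:
  assumes "x \<noteq> 0"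
  shows "cmod (x powr (- complex_of_real N)) = cmod x powr (- N)"
  using assms by (simp add: powr_def norm_exp_eq_Re)

text \<open>Mean value inequality on the segment, which stays in the right half-plane and so avoids
  the branch cut; the hypothesis on \<open>m\<close> bounds the derivative.\<close>

lemma powr_neg_lipschitz:
  assumes "0 < Re a" "0 < Re b" "0 < m" "0 < N" and m: "\<And>x. x \<in> closed_segment a b \<Longrightarrow> m \<le> cmod x"
  shows "cmod (a powr (- complex_of_real N) - b powr (- complex_of_real N)) \<le> N * m powr (- N - 1) * cmod (a - b)"
proof (rule field_differentiable_bound[where S = "closed_segment a b"])
  have "closed_segment a b \<subseteq> {x. 0 < Re x}"
    using assms by (intro closed_segment_subset convex_halfspace_Re_gt) auto
  then have Re: "0 < Re x" if "x \<in> closed_segment a b" for x using that by auto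
  fix x assume x: "x \<in> closed_segment a b"
  then have "x \<notin> \<real>\<^sub>\<le>\<^sub>0" using Re[OF x] by (auto simp: complex_nonpos_Reals_iff)
  then show "((\<lambda>x. x powr (- complex_of_real N)) has_field_derivative - complex_of_real N * x powr (- complex_of_real N - 1)) (at x within closed_segment a b)"
    by (intro has_field_derivative_at_within[OF has_field_derivative_powr])
  have "x \<noteq> 0" using Re[OF x] by auto
  moreover have E: "- complex_of_real N - 1 = - complex_of_real (N + 1)" by simp
  ultimately have "cmod (x powr (- complex_of_real N - 1)) = cmod x powr (- (N + 1))"
    unfolding E by (intro cmod_powr_neg_of_real)
  then have "cmod (- complex_of_real N * x powr (- complex_of_real N - 1)) = N * cmod x powr (- (N + 1))"
    using assms(4) unfolding norm_mult by simp
  also have "\<dots> \<le> N * m powr (- N - 1)"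
  proof -
    have "cmod x powr (- (N + 1)) \<le> m powr (- (N + 1))"
      using m[OF x] assms(3,4) by (intro powr_mono2') auto
    moreover have "- N - 1 = - (N + 1)" by simp
    ultimately show ?thesis using assms(4) by (simp only: mult_left_mono less_imp_le)
  qed
  finally show "cmod (- complex_of_real N * x powr (- complex_of_real N - 1)) \<le> N * m powr (- N - 1)" .
qed auto

lemma powr_neg_lipschitz_halfplane:
  assumes "m \<le> Re a" "m \<le> Re b" "0 < m" "0 < N"
  shows "cmod (a powr (- complex_of_real N) - b powr (- complex_of_real N)) \<le> N * m powr (- N - 1) * cmod (a - b)"
proof (rule powr_neg_lipschitz)
  fix x assume "x \<in> closed_segment a b"
  moreover have "closed_segment a b \<subseteq> {x. m \<le> Re x}"
    using assms by (intro closed_segment_subset convex_halfspace_Re_ge) auto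
  ultimately have "m \<le> Re x" by auto
  then show "m \<le> cmod x" using complex_Re_le_cmod[of x] by linarith
qed (use assms in auto)

text \<open>The last hypothesis makes x - y at most half of |y|, so the segment keeps distance
  \<open>m\<close> from 0. The derivative bound t^(-N-1) times sqrt (r t) then gives the exponents
  1/2 and N + 1/2.\<close>

lemma powr_neg_diff_le:
  assumes "0 < Re x" "0 < Re y" "0 < N" "0 < B" "0 < t" "0 \<le> r" "0 \<le> L"
    and xy: "cmod (x - y) \<le> L * sqrt (r * t)" and ty: "t \<le> B * cmod y" and rt: "4 * L\<^sup>2 * B\<^sup>2 * r \<le> t"
  shows "cmod (x powr (- complex_of_real N) - y powr (- complex_of_real N)) \<le> N * (2 * B) powr (N + 1) * L * (r powr (1/2) / t powr (N + 1/2))"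
proof -
  \<comment> \<open>A lower bound for |y| / 2, expressed by \<open>t\<close>; squaring L sqrt (r t)
    <= m gives exactly the last hypothesis.\<close>
  define m where "m = t / (2 * B)"
  have m: "m > 0" "m \<le> cmod y / 2" using assms by (simp_all add: m_def field_simps)
  have "(L * sqrt (r * t))\<^sup>2 \<le> m\<^sup>2"
  proof -
    have "(L * sqrt (r * t))\<^sup>2 = (4 * L\<^sup>2 * B\<^sup>2 * r) * t / (4 * B\<^sup>2)"
      using assms by (simp add: power_mult_distrib)
    also have "\<dots> \<le> t * t / (4 * B\<^sup>2)"
      using assms by (intro divide_right_mono mult_right_mono) auto
    also have "\<dots> = m\<^sup>2" by (simp add: m_def power_divide power2_eq_square)
    finally show ?thesis .
  qed
  then have "L * sqrt (r * t) \<le> m" by (rule power2_le_imp_le) (use m(1) in simp)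
  then have near: "cmod (x - y) \<le> cmod y / 2" using xy m by linarith
  have "cmod (x powr (- complex_of_real N) - y powr (- complex_of_real N)) \<le> N * m powr (- N - 1) * cmod (x - y)"
  proof (rule powr_neg_lipschitz)
    fix u assume "u \<in> closed_segment x y"
    then have "cmod (u - y) \<le> cmod (x - y)" using segment_bound(2)[of u x y] by (simp add: norm_minus_commute)
    then show "m \<le> cmod u" using near m norm_triangle_ineq2[of y "y - u"] by (simp add: norm_minus_commute)
  qed (use assms m in auto)
  also have "\<dots> \<le> N * m powr (- N - 1) * (L * sqrt (r * t))"
    using xy assms by (intro mult_left_mono) auto
  also have "m powr (- N - 1) = (2 * B) powr (N + 1) * t powr (- N - 1)"
  proof -
    have E: "- N - 1 = - (N + 1)" by simp
    have "m powr (- (N + 1)) = t powr (- (N + 1)) / (2 * B) powr (- (N + 1))"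
      unfolding m_def by (rule powr_divide)
    moreover have "inverse ((2 * B) powr (- (N + 1))) = (2 * B) powr (N + 1)"
      by (simp only: powr_minus inverse_inverse_eq)
    ultimately show ?thesis unfolding E by (simp only: divide_inverse) (rule mult.commute)
  qed
  also have "N * ((2 * B) powr (N + 1) * t powr (- N - 1)) * (L * sqrt (r * t)) = N * (2 * B) powr (N + 1) * L * (r powr (1/2) * (t powr (- N - 1) * t powr (1/2)))"
    using assms by (simp add: real_sqrt_mult powr_half_sqrt)
  also have "t powr (- N - 1) * t powr (1/2) = 1 / t powr (N + 1/2)"
    by (simp add: powr_minus_divide[symmetric] algebra_simps flip: powr_add)
  finally show ?thesis by simp
qed

section \<open>Comparison of \<open>rho\<close> with the Hermitian product\<close>

lemma rho_nonneg: "0 \<le> rho z w"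
  by (simp add: rho_def)

text \<open>For nonzero points put x = |z|, y = |w|, c = <z,w>. Then |x - y| <= 1 - x y, and
  replacing c by c / (x y) costs at most another 1 - x y because |c| <= x y; both are at most |1 -
  c|, whence the 3.\<close>

lemma rho_le:
  assumes z: "norm z \<le> 1" and w: "norm w \<le> 1"
  shows "rho z w \<le> 3 * cmod (1 - cinner z w)"
proof (cases "z \<noteq> 0 \<and> w \<noteq> 0")
  case False
  then have "rho z w \<le> 1" "cinner z w = 0" using z w by (auto simp: rho_def cinner_simps)
  then show ?thesis by simp
next
  case True
  define x y c where "x = norm z" and "y = norm w" and "c = cinner z w"
  have xy: "0 < x" "x \<le> 1" "0 < y" "y \<le> 1" using True z w by (auto simp: x_def y_def)
  have c: "cmod c \<le> x * y" unfolding c_def x_def y_def by (rule cinner_cauchy_schwarz)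
  have 1: "1 - x * y \<le> cmod (1 - c)"
    using c norm_triangle_ineq2[of 1 c] by simp
  have "x * y \<le> x" "x * y \<le> y" using xy by (auto simp: mult_left_le mult_left_le_one_le)
  then have 2: "\<bar>x - y\<bar> \<le> 1 - x * y" using xy by (intro abs_leI) linarith+
  have "1 - 1 / complex_of_real (x * y) * c = (1 - c) - complex_of_real (1 / (x * y) - 1) * c"
    by (simp add: algebra_simps)
  then have "cmod (1 - 1 / complex_of_real (x * y) * c) \<le> cmod (1 - c) + cmod (complex_of_real (1 / (x * y) - 1) * c)"
    by (metis norm_triangle_ineq4)
  also have "cmod (complex_of_real (1 / (x * y) - 1) * c) \<le> (1 / (x * y) - 1) * (x * y)"
  proof -
    have "0 < x * y" "x * y \<le> 1" using xy by (auto simp: mult_le_one)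
    then have "0 \<le> 1 / (x * y) - 1" by (simp add: field_simps)
    then show ?thesis unfolding norm_mult norm_of_real using c by (simp add: mult_left_mono)
  qed
  also have "(1 / (x * y) - 1) * (x * y) = 1 - x * y" using xy by (simp add: field_simps)
  finally show ?thesis using True 1 2 by (simp add: rho_def x_def y_def c_def)
qed

text \<open>With x = |z|, y = |w| and u = <z,w> / (x y), one has |z - w|^2 = (x - y)^2 + 2 x y (1 -
  Re u) and <z - w, w> = y ((x - y) - x (1 - u)); both are controlled by |x - y| and |1 - u|. The
  points at the origin are handled separately.\<close>

lemma rho_ge:
  assumes z: "norm z \<le> 1" and w: "norm w \<le> 1"
  shows "(norm (z - w))\<^sup>2 \<le> 2 * rho z w" "cmod (cinner (z - w) w) \<le> rho z w"
    "\<bar>defect z - defect w\<bar> \<le> 2 * rho z w"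
proof -
  have n: "\<bar>norm z - norm w\<bar> \<le> rho z w"
    by (auto simp: rho_def)
  have "\<bar>defect z - defect w\<bar> = \<bar>norm z - norm w\<bar> * (norm z + norm w)"
  proof -
    have "defect z - defect w = (norm w - norm z) * (norm w + norm z)"
      by (simp add: defect_def power2_eq_square algebra_simps)
    then show ?thesis by (simp add: abs_mult abs_minus_commute add.commute)
  qed
  also have "\<dots> \<le> rho z w * 2" using z w n rho_nonneg[of z w] by (intro mult_mono) auto
  finally show "\<bar>defect z - defect w\<bar> \<le> 2 * rho z w" by (simp only: mult.commute)
  have "(norm (z - w))\<^sup>2 \<le> 2 * rho z w \<and> cmod (cinner (z - w) w) \<le> rho z w"
  proof (cases "z \<noteq> 0 \<and> w \<noteq> 0")
    case False
    have sq: "(norm x)\<^sup>2 \<le> norm x" if "norm x \<le> 1" for x :: "complex ^ 'n"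
      using that by (simp add: power2_eq_square mult_left_le)
    have "cmod (cinner (z - w) w) \<le> norm w"
    proof -
      have "cmod (cinner (z - w) w) = (norm w)\<^sup>2 \<or> cmod (cinner (z - w) w) = 0"
        using False by (auto simp: cinner_simps cinner_self norm_power)
      then show ?thesis using sq[OF w] by auto
    qed
    moreover have "(norm (z - w))\<^sup>2 \<le> norm z + norm w" using False sq[OF z] sq[OF w] by auto
    moreover have "rho z w = norm z + norm w" using False by (auto simp: rho_def)
    ultimately show ?thesis using norm_ge_zero[of z] norm_ge_zero[of w] by linarith
  next
    case True
    define x y where "x = norm z" and "y = norm w"
    have xy: "0 < x" "x \<le> 1" "0 < y" "y \<le> 1" using True z w by (auto simp: x_def y_def)
    define u where "u = 1 / complex_of_real (x * y) * cinner z w"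
    have cu: "cinner z w = complex_of_real (x * y) * u" using xy by (simp add: u_def)
    have rho: "rho z w = \<bar>x - y\<bar> + cmod (1 - u)" using True by (simp add: rho_def u_def x_def y_def)
    have "x * y \<le> 1" using xy by (simp add: mult_le_one)
    have "(norm (z - w))\<^sup>2 = \<bar>x - y\<bar> * \<bar>x - y\<bar> + 2 * (x * y) * (1 - Re u)"
      unfolding norm_diff_square cu by (simp add: x_def y_def power2_eq_square algebra_simps flip: abs_mult)
    also have "\<dots> \<le> \<bar>x - y\<bar> * 1 + 2 * 1 * cmod (1 - u)"
    proof (intro add_mono mult_mono)
      have "\<bar>1 - Re u\<bar> \<le> cmod (1 - u)" using abs_Re_le_cmod[of "1 - u"] by simp
      have "(1 - Re u) \<le> cmod (1 - u)" using \<open>\<bar>1 - Re u\<bar> \<le> cmod (1 - u)\<close> by linarith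
      then show "1 - Re u \<le> cmod (1 - u)" .
      have "cmod u \<le> 1"
        using cinner_cauchy_schwarz[of z w] xy unfolding cu norm_mult norm_of_real by (simp add: x_def[symmetric] y_def[symmetric])
      then show "0 \<le> 1 - Re u" using complex_Re_le_cmod[of u] by linarith
    qed (use xy \<open>x * y \<le> 1\<close> in auto)
    also have "\<dots> \<le> 2 * rho z w" unfolding rho distrib_left by (intro add_mono) auto
    finally have 1: "(norm (z - w))\<^sup>2 \<le> 2 * rho z w" .
    have "cinner (z - w) w = complex_of_real y * (complex_of_real (x - y) - complex_of_real x * (1 - u))"
      unfolding cinner_diff_left cu cinner_self by (simp add: y_def[symmetric] algebra_simps power2_eq_square)
    then have "cmod (cinner (z - w) w) = y * cmod (complex_of_real (x - y) - complex_of_real x * (1 - u))"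
      using xy by (simp add: norm_mult)
    also have "\<dots> \<le> 1 * (\<bar>x - y\<bar> + x * cmod (1 - u))"
    proof (intro mult_mono)
      show "cmod (complex_of_real (x - y) - complex_of_real x * (1 - u)) \<le> \<bar>x - y\<bar> + x * cmod (1 - u)"
        using norm_triangle_ineq4[of "complex_of_real (x - y)" "complex_of_real x * (1 - u)"] xy
        by (simp only: norm_mult norm_of_real abs_of_pos)
    qed (use xy in auto)
    also have "\<dots> \<le> rho z w" unfolding rho using xy by (simp add: mult_left_le_one_le)
    finally show ?thesis using 1 by simp
  qed
  then show "(norm (z - w))\<^sup>2 \<le> 2 * rho z w" "cmod (cinner (z - w) w) \<le> rho z w" by auto
qed

lemma rho_pos:
  assumes "norm z \<le> 1" "norm w \<le> 1" "z \<noteq> w"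
  shows "0 < rho z w"
proof -
  have "0 < (norm (z - w))\<^sup>2" using assms by simp
  then show ?thesis using rho_ge(1)[OF assms(1,2)] by linarith
qed

text \<open>In the identity \<open>one_minus_cinner_aut_swap\<close> the two factors that contain
  \<open>a\<close> have modulus between 1 - R and 2, so the two remaining factors are
  comparable.\<close>

lemma one_minus_cinner_aut_bounds:
  assumes z: "norm z < 1" and u: "norm u < 1" and a: "norm a \<le> R" and R: "R < 1"
  shows "cmod (1 - cinner z u) \<le> 2 / (1 - R) * cmod (1 - cinner (ball_aut z a) u)"
    "cmod (1 - cinner (ball_aut z a) u) \<le> 2 / (1 - R) * cmod (1 - cinner z u)"
    "0 < Re (1 - cinner (ball_aut z a) u)"
proof -
  let ?g = "cmod (1 - cinner (ball_aut z a) u)" and ?d = "cmod (1 - cinner z u)"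
  let ?A = "cmod (1 - cinner a (ball_aut z u))" and ?Z = "cmod (1 - cinner a z)"
  have a1: "norm a < 1" using a R by linarith
  have au: "norm (ball_aut z u) < 1" using z u by (rule norm_ball_aut_less_1)
  have eq: "?Z * ?g = ?d * ?A"
    using one_minus_cinner_aut_swap[of z a u] z a1 u by (simp add: norm_mult[symmetric] del: norm_mult)
  have A: "1 - R \<le> ?A" "?A \<le> 2"
    using defect_le_cmod(1)[of a "ball_aut z u"] one_minus_cinner_bounds(3)[of a "ball_aut z u"] a a1 au by auto
  have Z: "1 - R \<le> ?Z" "?Z \<le> 2"
    using defect_le_cmod(1)[of a z] one_minus_cinner_bounds(3)[of a z] a a1 z by auto
  have "(1 - R) * ?d \<le> ?A * ?d" using A by (intro mult_right_mono) auto
  also have "\<dots> = ?Z * ?g" using eq by (simp add: mult.commute)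
  also have "\<dots> \<le> 2 * ?g" using Z by (intro mult_right_mono) auto
  finally show "?d \<le> 2 / (1 - R) * ?g" using R by (simp add: field_simps)
  have "(1 - R) * ?g \<le> ?Z * ?g" using Z by (intro mult_right_mono) auto
  also have "\<dots> = ?A * ?d" using eq by (simp add: mult.commute)
  also have "\<dots> \<le> 2 * ?d" using A by (intro mult_right_mono) auto
  finally show "?g \<le> 2 / (1 - R) * ?d" using R by (simp add: field_simps)
  show "0 < Re (1 - cinner (ball_aut z a) u)"
    using norm_ball_aut_less_1[OF z a1] u by (intro one_minus_cinner_bounds(4)) auto
qed

text \<open>Write r = \<open>rho w \<zeta>\<close>, d = |1 - <z,\<zeta>>| and phi =
  \<open>ball_aut z a\<close>. The difference splits into <phi - \<zeta>, w - \<zeta>>, where the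
  vectors have sizes sqrt d and sqrt r, and <\<zeta>, w - \<zeta>>, which is at most r <= sqrt (r
  d).\<close>

lemma aut_diff_second:
  assumes z: "norm z < 1" and w: "norm w < 1" and \<zeta>: "norm \<zeta> < 1" and a: "norm a \<le> R" and R: "R < 1"
    and r: "rho w \<zeta> \<le> cmod (1 - cinner z \<zeta>)"
  shows "cmod ((1 - cinner (ball_aut z a) w) - (1 - cinner (ball_aut z a) \<zeta>)) \<le> (1 + 2 * sqrt (2 / (1 - R))) * sqrt (rho w \<zeta> * cmod (1 - cinner z \<zeta>))"
proof -
  let ?r = "rho w \<zeta>" and ?d = "cmod (1 - cinner z \<zeta>)" and ?\<phi> = "ball_aut z a"
  have \<phi>: "norm ?\<phi> < 1" using z a R by (intro norm_ball_aut_less_1) auto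
  have r0: "0 \<le> ?r" by (rule rho_nonneg)
  have "(norm (?\<phi> - \<zeta>))\<^sup>2 \<le> 2 * (2 / (1 - R) * ?d)"
    using norm_diff_square_le[of ?\<phi> \<zeta>] one_minus_cinner_aut_bounds(2)[OF z \<zeta> a R] \<phi> \<zeta> by auto
  then have 1: "norm (?\<phi> - \<zeta>) \<le> sqrt (2 * (2 / (1 - R) * ?d))" by (rule real_le_rsqrt)
  have 2: "norm (w - \<zeta>) \<le> sqrt (2 * ?r)" using rho_ge(1)[of w \<zeta>] w \<zeta> by (intro real_le_rsqrt) auto
  have "(1 - cinner ?\<phi> w) - (1 - cinner ?\<phi> \<zeta>) = - cinner (?\<phi> - \<zeta>) (w - \<zeta>) - cinner \<zeta> (w - \<zeta>)"
    by (simp add: cinner_simps)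
  then have A: "cmod ((1 - cinner ?\<phi> w) - (1 - cinner ?\<phi> \<zeta>)) \<le> cmod (cinner (?\<phi> - \<zeta>) (w - \<zeta>)) + cmod (cinner \<zeta> (w - \<zeta>))"
    by (metis norm_minus_cancel norm_triangle_ineq4)
  have "cmod (cinner (?\<phi> - \<zeta>) (w - \<zeta>)) \<le> norm (?\<phi> - \<zeta>) * norm (w - \<zeta>)" by (rule cinner_cauchy_schwarz)
  also have "\<dots> \<le> sqrt (2 * (2 / (1 - R) * ?d)) * sqrt (2 * ?r)" using R by (intro mult_mono 1 2) auto
  also have "\<dots> = 2 * sqrt (2 / (1 - R)) * sqrt (?r * ?d)"
  proof -
    have "sqrt (2 * (E * d)) * sqrt (2 * r) = 2 * sqrt E * sqrt (r * d)" for E d r :: real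
    proof -
      have "sqrt (2 * (E * d)) * sqrt (2 * r) = sqrt (2\<^sup>2 * (E * (r * d)))"
        unfolding real_sqrt_mult[symmetric] by (simp add: power2_eq_square algebra_simps)
      then show ?thesis unfolding real_sqrt_mult[of "2\<^sup>2"] real_sqrt_mult[of E "r * d"] by simp
    qed
    then show ?thesis .
  qed
  finally have B: "cmod (cinner (?\<phi> - \<zeta>) (w - \<zeta>)) \<le> 2 * sqrt (2 / (1 - R)) * sqrt (?r * ?d)" .
  have C: "cmod (cinner \<zeta> (w - \<zeta>)) \<le> ?r"
    using rho_ge(2)[of w \<zeta>] w \<zeta> by (simp add: cmod_cinner_commute[of \<zeta>])
  have D: "?r \<le> sqrt (?r * ?d)"
    using r r0 by (intro real_le_rsqrt) (auto simp: power2_eq_square mult_left_mono)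
  have "cmod ((1 - cinner ?\<phi> w) - (1 - cinner ?\<phi> \<zeta>)) \<le> 2 * sqrt (2 / (1 - R)) * sqrt (?r * ?d) + sqrt (?r * ?d)"
    using A B C D by linarith
  then show ?thesis by (simp only: distrib_right mult_1_left add.commute)
qed

text \<open>Here the moving point is the parameter of the involution. By the swap identity 1 -
  <phi_x(a), z> = X x / Y x with Y x = 1 - <a,x> and X x = 1 - <x,z> - <a, \<psi> x>, where \<psi> x
  = (1 - <z,x>) phi_x(z). The numerator is polynomial apart from sqrt (1 - |x|^2), so its difference
  can be estimated term by term.\<close>

lemma aut_diff_first:
  fixes z w \<zeta> a :: "complex ^ 'n"
  assumes z: "norm z < 1" and w: "norm w < 1" and \<zeta>: "norm \<zeta> < 1" and a: "norm a \<le> R" and R: "R < 1"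
    and r: "rho w \<zeta> \<le> cmod (1 - cinner z \<zeta>)"
  shows "cmod ((1 - cinner (ball_aut w a) z) - (1 - cinner (ball_aut \<zeta> a) z)) \<le>
    (32 / (1 - R) + 8 / (1 - R) ^ 3) * sqrt (rho w \<zeta> * cmod (1 - cinner z \<zeta>))"
proof -
  define r where "r = rho w \<zeta>"
  define d where "d = cmod (1 - cinner z \<zeta>)"
  \<comment> \<open>The target size; every difference below is measured against sqrt (r d), and r <=
    d gives r <= q <= d.\<close>
  define q where "q = sqrt (r * d)"
  define e where "e = 1 - R"
  have e: "0 < e" using R by (simp add: e_def)
  have a1: "norm a < 1" using a R by linarith
  have rd: "0 \<le> r" "r \<le> d" "d \<le> 2" "0 \<le> d"
    using assms one_minus_cinner_bounds(3)[of z \<zeta>] by (auto simp: r_def d_def rho_nonneg)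
  have q0: "0 \<le> q" using rd by (simp add: q_def)
  have rq: "r \<le> q" unfolding q_def using rd by (intro real_le_rsqrt) (auto simp: power2_eq_square mult_left_mono)
  have q2: "sqrt (2 * r) * sqrt (2 * d) = 2 * q"
  proof -
    have "sqrt (2 * r) * sqrt (2 * d) = sqrt (2\<^sup>2 * (r * d))"
      unfolding real_sqrt_mult[symmetric] by (simp add: power2_eq_square algebra_simps)
    then show ?thesis unfolding real_sqrt_mult[of "2\<^sup>2"] q_def by simp
  qed
  \<comment> \<open>Since d <= 2, one factor d is at most sqrt (2 d).\<close>
  have dq: "d * sqrt (2 * r) \<le> 2 * q"
  proof -
    have "d = sqrt d * sqrt d" using rd by simp
    also have "\<dots> \<le> sqrt 2 * sqrt d" using rd by (intro mult_right_mono) auto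
    finally have "d \<le> sqrt (2 * d)" by (simp add: real_sqrt_mult)
    then have "d * sqrt (2 * r) \<le> sqrt (2 * d) * sqrt (2 * r)" using rd by (intro mult_right_mono) auto
    then show ?thesis using q2 by (simp add: mult.commute)
  qed
  define \<sigma> where "\<sigma> x = sqrt (defect x)" for x :: "complex ^ 'n"
  have \<sigma>0: "0 \<le> \<sigma> w" "0 \<le> \<sigma> \<zeta>" using w \<zeta> by (auto simp: \<sigma>_def intro!: defect_nonneg)
  have \<sigma>2: "\<sigma> w * \<sigma> w = defect w" "\<sigma> \<zeta> * \<sigma> \<zeta> = defect \<zeta>"
    using defect_nonneg[of w] defect_nonneg[of \<zeta>] w \<zeta> by (auto simp: \<sigma>_def)
  have \<sigma>\<zeta>: "\<sigma> \<zeta> \<le> sqrt (2 * d)" unfolding \<sigma>_def d_def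
    using defect_le_cmod(4)[of z \<zeta>] z \<zeta> by (intro real_sqrt_le_mono) auto
  have def_diff: "\<bar>defect w - defect \<zeta>\<bar> \<le> 2 * r" using rho_ge(3)[of w \<zeta>] w \<zeta> by (simp add: r_def)
  \<comment> \<open>The square root is only Hoelder 1/2 at the sphere: (s - t)^2 <= |s^2 - t^2| for
    s, t >= 0.\<close>
  have \<sigma>diff: "\<bar>\<sigma> w - \<sigma> \<zeta>\<bar> \<le> sqrt (2 * r)"
  proof (rule real_le_rsqrt)
    have "\<bar>\<sigma> w - \<sigma> \<zeta>\<bar> * \<bar>\<sigma> w - \<sigma> \<zeta>\<bar> \<le> \<bar>\<sigma> w - \<sigma> \<zeta>\<bar> * (\<sigma> w + \<sigma> \<zeta>)"
      using \<sigma>0 by (intro mult_left_mono) auto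
    also have "\<dots> = \<bar>(\<sigma> w - \<sigma> \<zeta>) * (\<sigma> w + \<sigma> \<zeta>)\<bar>" using \<sigma>0 by (simp add: abs_mult)
    also have "(\<sigma> w - \<sigma> \<zeta>) * (\<sigma> w + \<sigma> \<zeta>) = defect w - defect \<zeta>"
      by (simp add: algebra_simps \<sigma>2)
    finally show "\<bar>\<sigma> w - \<sigma> \<zeta>\<bar>\<^sup>2 \<le> 2 * r" using def_diff by (simp add: power2_eq_square)
  qed
  have w\<zeta>: "norm (w - \<zeta>) \<le> sqrt (2 * r)" using rho_ge(1)[of w \<zeta>] w \<zeta> by (intro real_le_rsqrt) (auto simp: r_def)
  have z\<zeta>: "norm (\<zeta> - z) \<le> sqrt (2 * d)"
    using norm_diff_square_le[of z \<zeta>] z \<zeta> by (intro real_le_rsqrt) (auto simp: d_def norm_minus_commute)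
  have lin: "cmod (cinner (w - \<zeta>) z) \<le> 3 * q"
  proof -
    \<comment> \<open>Pairing with \<zeta> is of order r by \<open>rho_ge\<close>; the correction
      pairs vectors of sizes sqrt r and sqrt d.\<close>
    have "cinner (w - \<zeta>) z = cinner (w - \<zeta>) \<zeta> - cinner (w - \<zeta>) (\<zeta> - z)" by (simp add: cinner_simps)
    then have "cmod (cinner (w - \<zeta>) z) \<le> cmod (cinner (w - \<zeta>) \<zeta>) + cmod (cinner (w - \<zeta>) (\<zeta> - z))"
      by (metis norm_triangle_ineq4)
    also have "cmod (cinner (w - \<zeta>) \<zeta>) \<le> q" using rho_ge(2)[of w \<zeta>] w \<zeta> rq by (simp add: r_def)
    also have "cmod (cinner (w - \<zeta>) (\<zeta> - z)) \<le> norm (w - \<zeta>) * norm (\<zeta> - z)" by (rule cinner_cauchy_schwarz)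
    also have "\<dots> \<le> sqrt (2 * r) * sqrt (2 * d)" using rd by (intro mult_mono w\<zeta> z\<zeta>) auto
    finally show ?thesis using q2 by linarith
  qed
  have lin': "cmod (cinner z (w - \<zeta>)) \<le> 3 * q" using lin cmod_cinner_commute[of z "w - \<zeta>"] by simp
  \<comment> \<open>This is (1 + \<sigma> x) times \<psi> x, grouped so that each summand at \<zeta>
    is of order d. Smallness at \<zeta> is used to absorb the variation of the factor 1 / (1 +
    \<sigma> x).\<close>
  define \<Phi> where "\<Phi> x = (1 - cinner z x) *s x + complex_of_real (\<sigma> x) *s (x - z) - complex_of_real (defect x) *s z" for x
  have \<Phi>\<zeta>: "norm (\<Phi> \<zeta>) \<le> 5 * d"
  proof -
    have "norm (\<Phi> \<zeta>) \<le> norm ((1 - cinner z \<zeta>) *s \<zeta>) + norm (complex_of_real (\<sigma> \<zeta>) *s (\<zeta> - z)) + norm (complex_of_real (defect \<zeta>) *s z)"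
      unfolding \<Phi>_def by (meson norm_triangle_ineq norm_triangle_ineq4 order_trans add_right_mono)
    also have "norm ((1 - cinner z \<zeta>) *s \<zeta>) \<le> d" unfolding norm_vec_smult d_def using \<zeta> by (simp add: mult_left_le)
    also have "norm (complex_of_real (\<sigma> \<zeta>) *s (\<zeta> - z)) \<le> sqrt (2 * d) * sqrt (2 * d)"
      unfolding norm_vec_smult norm_of_real using \<sigma>0 \<sigma>\<zeta> z\<zeta> rd by (intro mult_mono) auto
    also have "norm (complex_of_real (defect \<zeta>) *s z) \<le> 2 * d"
    proof -
      have "\<bar>defect \<zeta>\<bar> * norm z \<le> \<bar>defect \<zeta>\<bar>" using z by (simp add: mult_left_le)
      also have "\<dots> \<le> 2 * d" using defect_nonneg[of \<zeta>] defect_le_cmod(4)[of z \<zeta>] z \<zeta> by (simp add: d_def)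
      finally show ?thesis by (simp add: norm_vec_smult)
    qed
    finally show ?thesis using rd by simp
  qed
  have zw: "cmod (1 - cinner z w) \<le> 4 * d"
  proof -
    have "q \<le> d" unfolding q_def using rd by (intro real_le_lsqrt) (auto simp: power2_eq_square mult_right_mono)
    moreover have "1 - cinner z w = (1 - cinner z \<zeta>) - cinner z (w - \<zeta>)" by (simp add: cinner_simps)
    then have "cmod (1 - cinner z w) \<le> d + cmod (cinner z (w - \<zeta>))" unfolding d_def by (metis norm_triangle_ineq4)
    ultimately show ?thesis using lin' by linarith
  qed
  have \<sigma>w: "\<sigma> w \<le> 2 * sqrt (2 * d)"
  proof -
    have "sqrt (2 * r) \<le> sqrt (2 * d)" using rd by simp
    then show ?thesis using \<sigma>diff \<sigma>\<zeta> by linarith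
  qed
  have \<Phi>diff: "norm (\<Phi> w - \<Phi> \<zeta>) \<le> 19 * q"
  proof -
    have "\<Phi> w - \<Phi> \<zeta> = (1 - cinner z w) *s (w - \<zeta>) + (- cinner z (w - \<zeta>)) *s \<zeta> + complex_of_real (\<sigma> w) *s (w - \<zeta>)
        + complex_of_real (\<sigma> w - \<sigma> \<zeta>) *s (\<zeta> - z) - complex_of_real (defect w - defect \<zeta>) *s z"
      by (simp add: \<Phi>_def vec_eq_iff cinner_simps algebra_simps)
    then have "norm (\<Phi> w - \<Phi> \<zeta>) \<le> norm ((1 - cinner z w) *s (w - \<zeta>)) + norm ((- cinner z (w - \<zeta>)) *s \<zeta>)
        + norm (complex_of_real (\<sigma> w) *s (w - \<zeta>)) + norm (complex_of_real (\<sigma> w - \<sigma> \<zeta>) *s (\<zeta> - z))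
        + norm (complex_of_real (defect w - defect \<zeta>) *s z)"
      by (simp only:) (intro order_trans[OF norm_triangle_ineq4] order_trans[OF norm_triangle_ineq] add_mono order_refl)
    moreover have "norm ((1 - cinner z w) *s (w - \<zeta>)) \<le> 8 * q"
    proof -
      have "norm ((1 - cinner z w) *s (w - \<zeta>)) \<le> (4 * d) * sqrt (2 * r)"
        unfolding norm_vec_smult using zw w\<zeta> rd by (intro mult_mono) auto
      then show ?thesis using dq by simp
    qed
    moreover have "norm ((- cinner z (w - \<zeta>)) *s \<zeta>) \<le> 3 * q"
    proof -
      have "cmod (cinner z (w - \<zeta>)) * norm \<zeta> \<le> cmod (cinner z (w - \<zeta>))" using \<zeta> by (simp add: mult_left_le)
      then show ?thesis using lin' by (simp add: norm_vec_smult)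
    qed
    moreover have "norm (complex_of_real (\<sigma> w) *s (w - \<zeta>)) \<le> 4 * q"
    proof -
      have "norm (complex_of_real (\<sigma> w) *s (w - \<zeta>)) \<le> (2 * sqrt (2 * d)) * sqrt (2 * r)"
        unfolding norm_vec_smult norm_of_real using \<sigma>w \<sigma>0 w\<zeta> rd by (intro mult_mono) auto
      then show ?thesis using q2 by (simp add: mult.commute mult.left_commute)
    qed
    moreover have "norm (complex_of_real (\<sigma> w - \<sigma> \<zeta>) *s (\<zeta> - z)) \<le> 2 * q"
    proof -
      have "norm (complex_of_real (\<sigma> w - \<sigma> \<zeta>) *s (\<zeta> - z)) \<le> sqrt (2 * r) * sqrt (2 * d)"
        unfolding norm_vec_smult norm_of_real using \<sigma>diff z\<zeta> rd by (intro mult_mono) auto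
      then show ?thesis using q2 by simp
    qed
    moreover have "norm (complex_of_real (defect w - defect \<zeta>) *s z) \<le> 2 * q"
    proof -
      have "\<bar>defect w - defect \<zeta>\<bar> * norm z \<le> \<bar>defect w - defect \<zeta>\<bar>" using z by (simp add: mult_left_le)
      then have "norm (complex_of_real (defect w - defect \<zeta>) *s z) \<le> \<bar>defect w - defect \<zeta>\<bar>"
        unfolding norm_vec_smult norm_of_real .
      then show ?thesis using def_diff rq by linarith
    qed
    ultimately show ?thesis by linarith
  qed
  define \<psi> where "\<psi> x = complex_of_real (1 / (1 + \<sigma> x)) *s \<Phi> x" for x
  have \<psi>diff: "norm (\<psi> w - \<psi> \<zeta>) \<le> 29 * q"
  proof -
    have inv: "0 \<le> 1 / (1 + \<sigma> w)" "1 / (1 + \<sigma> w) \<le> 1" using \<sigma>0 by (auto simp: field_simps)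
    have "1 / (1 + \<sigma> w) - 1 / (1 + \<sigma> \<zeta>) = (\<sigma> \<zeta> - \<sigma> w) / ((1 + \<sigma> w) * (1 + \<sigma> \<zeta>))"
      using \<sigma>0 by (simp add: divide_simps)
    moreover have "1 * 1 \<le> (1 + \<sigma> w) * (1 + \<sigma> \<zeta>)" using \<sigma>0 by (intro mult_mono) auto
    ultimately have inv2: "\<bar>1 / (1 + \<sigma> w) - 1 / (1 + \<sigma> \<zeta>)\<bar> \<le> \<bar>\<sigma> w - \<sigma> \<zeta>\<bar>"
      using \<sigma>0 by (simp add: abs_minus_commute divide_le_eq mult_left_mono[of 1, simplified] mult_le_cancel_left1)
    have "\<psi> w - \<psi> \<zeta> = complex_of_real (1 / (1 + \<sigma> w)) *s (\<Phi> w - \<Phi> \<zeta>) + complex_of_real (1 / (1 + \<sigma> w) - 1 / (1 + \<sigma> \<zeta>)) *s \<Phi> \<zeta>"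
      by (simp add: \<psi>_def vec_eq_iff algebra_simps)
    then have "norm (\<psi> w - \<psi> \<zeta>) \<le> norm (complex_of_real (1 / (1 + \<sigma> w)) *s (\<Phi> w - \<Phi> \<zeta>)) + norm (complex_of_real (1 / (1 + \<sigma> w) - 1 / (1 + \<sigma> \<zeta>)) *s \<Phi> \<zeta>)"
      by (metis norm_triangle_ineq)
    also have "norm (complex_of_real (1 / (1 + \<sigma> w)) *s (\<Phi> w - \<Phi> \<zeta>)) \<le> 1 * (19 * q)"
      unfolding norm_vec_smult norm_of_real using inv \<Phi>diff by (intro mult_mono) auto
    also have "norm (complex_of_real (1 / (1 + \<sigma> w) - 1 / (1 + \<sigma> \<zeta>)) *s \<Phi> \<zeta>) \<le> sqrt (2 * r) * (5 * d)"
      unfolding norm_vec_smult norm_of_real using inv2 \<sigma>diff \<Phi>\<zeta> rd by (intro mult_mono) auto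
    finally show ?thesis using dq by (simp add: mult.commute mult.left_commute)
  qed
  define X where "X x = (1 - cinner x z) - cinner a (\<psi> x)" for x
  define Y where "Y x = 1 - cinner a x" for x
  have g_eq: "1 - cinner (ball_aut x a) z = X x / Y x" "e \<le> cmod (Y x)" "cmod (Y x) \<le> 2" if x: "norm x < 1" for x
  proof -
    have Y: "e \<le> cmod (Y x)" "cmod (Y x) \<le> 2"
      using defect_le_cmod(1)[of a x] one_minus_cinner_bounds(3)[of a x] a a1 x by (auto simp: Y_def e_def)
    then show "e \<le> cmod (Y x)" "cmod (Y x) \<le> 2" by auto
    have Yne: "Y x \<noteq> 0" using Y e by auto
    have ne: "1 - cinner z x \<noteq> 0" using one_minus_cinner_bounds(2)[of z x] z x by auto
    have s0: "0 < 1 + \<sigma> x" using x by (simp add: \<sigma>_def defect_nonneg add_pos_nonneg)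
    have ss: "complex_of_real (defect x) = complex_of_real (\<sigma> x) * complex_of_real (\<sigma> x)"
      using x by (simp add: \<sigma>_def defect_nonneg flip: of_real_mult)
    have sne: "1 + complex_of_real (\<sigma> x) \<noteq> 0" using s0 by (metis less_irrefl of_real_1 of_real_add of_real_eq_0_iff)
    have "(1 - cinner z x) *s ball_aut x z = x - complex_of_real (\<sigma> x) *s z - (cinner z x / (1 + complex_of_real (\<sigma> x))) *s x"
      using ne by (simp add: ball_aut_eq[OF x] vector_smult_assoc \<sigma>_def)
    also have "\<dots> = \<psi> x"
    proof -
      have "(1 + complex_of_real (\<sigma> x)) *s (x - complex_of_real (\<sigma> x) *s z - (cinner z x / (1 + complex_of_real (\<sigma> x))) *s x) = \<Phi> x"
      proof -
        have c: "(1 + complex_of_real (\<sigma> x)) * (cinner z x / (1 + complex_of_real (\<sigma> x))) = cinner z x"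
          using sne by simp
        show ?thesis unfolding vector_ssub_ldistrib vector_smult_assoc c
          by (simp add: vec_eq_iff \<Phi>_def ss algebra_simps)
      qed
      then have "\<psi> x = complex_of_real (1 / (1 + \<sigma> x)) *s ((1 + complex_of_real (\<sigma> x)) *s (x - complex_of_real (\<sigma> x) *s z - (cinner z x / (1 + complex_of_real (\<sigma> x))) *s x))"
        by (simp add: \<psi>_def)
      moreover have "complex_of_real (1 / (1 + \<sigma> x)) * (1 + complex_of_real (\<sigma> x)) = 1" using sne by simp
      ultimately show ?thesis by (simp only: vector_smult_assoc vector_smult_lid)
    qed
    finally have "cinner a (\<psi> x) = cnj (1 - cinner z x) * cinner a (ball_aut x z)" by (metis cinner_smult_right)
    then have "X x = (1 - cinner x z) * (1 - cinner a (ball_aut x z))"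
      by (simp add: X_def cnj_cinner algebra_simps)
    also have "\<dots> = Y x * (1 - cinner (ball_aut x a) z)"
      using one_minus_cinner_aut_swap[of x a z] x a1 z by (simp add: Y_def)
    finally show "1 - cinner (ball_aut x a) z = X x / Y x" using Yne by simp
  qed
  have Xdiff: "cmod (X w - X \<zeta>) \<le> 32 * q"
  proof -
    have "X w - X \<zeta> = - cinner (w - \<zeta>) z - cinner a (\<psi> w - \<psi> \<zeta>)" by (simp add: X_def cinner_simps)
    then have "cmod (X w - X \<zeta>) \<le> cmod (cinner (w - \<zeta>) z) + cmod (cinner a (\<psi> w - \<psi> \<zeta>))"
      by (metis norm_minus_cancel norm_triangle_ineq4)
    also have "cmod (cinner a (\<psi> w - \<psi> \<zeta>)) \<le> norm a * norm (\<psi> w - \<psi> \<zeta>)" by (rule cinner_cauchy_schwarz)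
    also have "\<dots> \<le> 1 * (29 * q)" using a1 \<psi>diff by (intro mult_mono) auto
    finally show ?thesis using lin by linarith
  qed
  have Ydiff: "cmod (Y \<zeta> - Y w) \<le> sqrt (2 * r)"
  proof -
    have "cmod (Y \<zeta> - Y w) = cmod (cinner a (w - \<zeta>))" by (simp add: Y_def cinner_simps norm_minus_commute)
    also have "\<dots> \<le> norm a * norm (w - \<zeta>)" by (rule cinner_cauchy_schwarz)
    also have "\<dots> \<le> 1 * sqrt (2 * r)" using a1 w\<zeta> by (intro mult_mono) auto
    finally show ?thesis by simp
  qed
  note gw = g_eq[OF w] and g\<zeta> = g_eq[OF \<zeta>]
  have Yne: "Y w \<noteq> 0" "Y \<zeta> \<noteq> 0" using gw g\<zeta> e by auto
  have g\<zeta>b: "cmod (X \<zeta> / Y \<zeta>) \<le> 2 / e * d"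
    using one_minus_cinner_aut_bounds(2)[OF \<zeta> z a R] g\<zeta>(1) cmod_one_minus_cinner_commute[of z \<zeta>] by (simp add: e_def d_def)
  \<comment> \<open>The denominators differ by sqrt (2 r) only, but this difference is multiplied by
    X \<zeta> / Y \<zeta>, which is of order d.\<close>
  have "X w / Y w - X \<zeta> / Y \<zeta> = (X w - X \<zeta>) / Y w + (X \<zeta> / Y \<zeta>) * (Y \<zeta> - Y w) / Y w"
    using Yne by (simp add: divide_simps) (simp add: algebra_simps)
  then have "cmod (X w / Y w - X \<zeta> / Y \<zeta>) \<le> cmod ((X w - X \<zeta>) / Y w) + cmod ((X \<zeta> / Y \<zeta>) * (Y \<zeta> - Y w) / Y w)"
    by (metis norm_triangle_ineq)
  also have "cmod ((X w - X \<zeta>) / Y w) \<le> 32 * q / e"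
    unfolding norm_divide using Xdiff gw e q0 by (intro frac_le) auto
  also have "cmod ((X \<zeta> / Y \<zeta>) * (Y \<zeta> - Y w) / Y w) \<le> (2 / e * d) * sqrt (2 * r) / e"
    unfolding norm_divide[of _ "Y w"] norm_mult using g\<zeta>b Ydiff gw e rd by (intro frac_le mult_mono) auto
  also have "(2 / e * d) * sqrt (2 * r) / e = 2 / e\<^sup>2 * (d * sqrt (2 * r))" by (simp add: power2_eq_square)
  also have "\<dots> \<le> 2 / e\<^sup>2 * (2 * q)" using dq by (intro mult_left_mono) auto
  also have "\<dots> \<le> 8 / e ^ 3 * q"
  proof -
    have "e \<le> 2" using order_trans[OF norm_ge_zero a] unfolding e_def by linarith
    then have "4 * e * q \<le> 8 * q" using q0 by (intro mult_right_mono) auto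
    then have "4 * e * q / e ^ 3 \<le> 8 * q / e ^ 3" using e by (intro divide_right_mono) auto
    then show ?thesis using e by (simp add: power2_eq_square power3_eq_cube)
  qed
  finally have "cmod (X w / Y w - X \<zeta> / Y \<zeta>) \<le> (32 / e + 8 / e ^ 3) * q" by (simp add: algebra_simps)
  then show ?thesis unfolding gw(1) g\<zeta>(1) q_def r_def d_def e_def .
qed

section \<open>The tent kernel\<close>

text \<open>A pointwise representative of the class \<open>K_tent\<close>; the last argument is the
  variable of the L^q space.\<close>

definition tent_kernel :: "real \<Rightarrow> complex ^ 'n \<Rightarrow> complex ^ 'n \<Rightarrow> complex ^ 'n \<Rightarrow> complex" where
  "tent_kernel \<alpha> z u w =
     (1 - cinner (ball_aut z w) u) powr (- complex_of_real (real CARD('n) + 1 + \<alpha>))"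

lemma K_tent_eq: "K_tent \<alpha> \<gamma> q z u = Lp_class (tent_measure \<gamma>) q (tent_kernel \<alpha> z u)"
  by (simp add: K_tent_def tent_kernel_def[abs_def])

lemma T_tent_eq: "T_tent \<alpha> \<gamma> q f z = Lp_class (tent_measure \<gamma>) q (\<lambda>w. \<integral>u. f u * tent_kernel \<alpha> z u w \<partial>vol_weighted \<alpha>)"
  unfolding T_tent_def tent_kernel_def powr_minus divide_inverse ..

lemma continuous_on_powr_halfplane:
  assumes "continuous_on S g" "\<And>x. x \<in> S \<Longrightarrow> 0 < Re (g x)"
  shows "continuous_on S (\<lambda>x. g x powr c)"
proof (rule continuous_on_eq)
  show "continuous_on S (\<lambda>x. exp (c * Ln (g x)))"
    using assms by (intro continuous_intros continuous_on_Ln') (auto simp: complex_nonpos_Reals_iff dest!: assms(2))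
  show "exp (c * Ln (g x)) = g x powr c" if "x \<in> S" for x
    using assms(2)[OF that] by (auto simp: powr_def)
qed

lemma continuous_on_tent_kernel:
  assumes "continuous_on S f" "continuous_on S g" "continuous_on S h"
    and "\<And>x. x \<in> S \<Longrightarrow> norm (f x) < 1" "\<And>x. x \<in> S \<Longrightarrow> norm (g x) < 1" "\<And>x. x \<in> S \<Longrightarrow> norm (h x) < 1"
  shows "continuous_on S (\<lambda>x. tent_kernel \<alpha> (f x) (g x) (h x))"
  unfolding tent_kernel_def
proof (rule continuous_on_powr_halfplane)
  show "continuous_on S (\<lambda>x. 1 - cinner (ball_aut (f x) (h x)) (g x))"
    using assms by (intro continuous_intros) (auto simp: less_imp_le)
  show "0 < Re (1 - cinner (ball_aut (f x) (h x)) (g x))" if "x \<in> S" for x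
    using norm_ball_aut_less_1[OF assms(4)[OF that] assms(6)[OF that]] assms(5)[OF that]
    by (intro one_minus_cinner_bounds(4)) auto
qed

lemma tent_kernel_measurable:
  assumes "norm z < 1" "norm u < 1"
  shows "tent_kernel \<alpha> z u \<in> borel_measurable (tent_measure \<gamma>)"
  unfolding measurable_weighted_eq
  by (intro borel_measurable_continuous_on_restrict continuous_on_tent_kernel continuous_intros) (use assms in auto)

text \<open>The first comparison of \<open>one_minus_cinner_aut_bounds\<close>, raised to a negative
  power: the pointwise domination of the tent operator by the positive one.\<close>

lemma cmod_tent_kernel_le:
  fixes z u w :: "complex ^ 'n"
  assumes \<alpha>: "\<alpha> > -1" and z: "norm z < 1" and u: "norm u < 1" and w: "norm w \<le> R" and R: "R < 1"
  shows "cmod (tent_kernel \<alpha> z u w) \<le> (2 / (1 - R)) powr (real CARD('n) + 1 + \<alpha>) * abs_kernel \<alpha> z u"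
proof -
  let ?N = "real CARD('n) + 1 + \<alpha>" and ?B = "2 / (1 - R)"
  let ?g = "1 - cinner (ball_aut z w) u" and ?d = "cmod (1 - cinner z u)"
  note b = one_minus_cinner_aut_bounds[OF z u w R]
  have d: "0 < ?d" using one_minus_cinner_bounds(1)[of z u] z u by simp
  have g: "?g \<noteq> 0" using b(3) by auto
  have "cmod (tent_kernel \<alpha> z u w) = cmod ?g powr (- ?N)"
    unfolding tent_kernel_def using g by (rule cmod_powr_neg_of_real)
  also have "\<dots> \<le> (?d / ?B) powr (- ?N)"
    using b(1) d R \<alpha> by (intro powr_mono2') (auto simp: field_simps)
  also have "\<dots> = ?B powr ?N * (1 / ?d powr ?N)"
  proof -
    have "(d / B) powr (- N) = B powr N * (1 / d powr N)" for d B N :: real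
      by (simp add: powr_divide powr_minus_divide)
    then show ?thesis .
  qed
  finally show ?thesis .
qed

lemma tent_kernel_bounded:
  fixes z :: "complex ^ 'n"
  assumes \<alpha>: "\<alpha> > -1" and z: "norm z < 1" and R: "R < 1"
  obtains C where "C > 0" "\<And>u w. norm u < 1 \<Longrightarrow> norm w \<le> R \<Longrightarrow> cmod (tent_kernel \<alpha> z u w) \<le> C"
proof
  let ?N = "real CARD('n) + 1 + \<alpha>"
  let ?C = "(2 / (1 - R)) powr ?N * (1 / (1 - norm z) powr ?N)"
  show "?C > 0" using R z by simp
  fix u w :: "complex ^ 'n" assume u: "norm u < 1" and w: "norm w \<le> R"
  have "cmod (tent_kernel \<alpha> z u w) \<le> (2 / (1 - R)) powr ?N * abs_kernel \<alpha> z u"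
    by (rule cmod_tent_kernel_le[OF \<alpha> z u w R])
  also have "\<dots> \<le> ?C" by (intro mult_left_mono abs_kernel_le[OF \<alpha> z u]) simp
  finally show "cmod (tent_kernel \<alpha> z u w) \<le> ?C" .
qed

text \<open>For fixed \<open>z\<close> the points phi_z(w) with |w| <= R form a compact subset of
  the ball, which bounds the real part below. The constant depends on \<open>z\<close>; it serves
  only to approximate the Bochner integral at that \<open>z\<close>.\<close>

lemma tent_kernel_lipschitz:
  fixes z :: "complex ^ 'n"
  assumes \<alpha>: "\<alpha> > -1" and z: "norm z < 1" and R: "R < 1"
  obtains L where "L \<ge> 0" "\<And>u v w. norm u < 1 \<Longrightarrow> norm v < 1 \<Longrightarrow> norm w \<le> R \<Longrightarrow>
    cmod (tent_kernel \<alpha> z u w - tent_kernel \<alpha> z v w) \<le> L * norm (u - v)"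
proof -
  let ?N = "real CARD('n) + 1 + \<alpha>"
  obtain m where m: "m > 0" "\<And>w. norm w \<le> R \<Longrightarrow> m \<le> 1 - norm (ball_aut z w)"
  proof (cases "cball 0 R = ({} :: (complex ^ 'n) set)")
    \<comment> \<open>This is the case R < 0, in which there are no points \<open>w\<close> to
      bound.\<close>
    case True
    then have "\<not> norm w \<le> R" for w :: "complex ^ 'n" by (auto simp: set_eq_iff)
    then show ?thesis by (intro that[of 1]) auto
  next
    case False
    have "continuous_on (cball 0 R) (\<lambda>w. norm (ball_aut z w))"
      using z R by (intro continuous_intros) auto
    from continuous_attains_sup[OF compact_cball False this] obtain w0
      where w0: "w0 \<in> cball 0 R" "\<And>w. w \<in> cball 0 R \<Longrightarrow> norm (ball_aut z w) \<le> norm (ball_aut z w0)" by blast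
    have "norm (ball_aut z w0) < 1" using z w0 R by (intro norm_ball_aut_less_1) auto
    then show ?thesis using w0 by (intro that[of "1 - norm (ball_aut z w0)"]) auto
  qed
  show ?thesis
  proof
    let ?L = "?N * m powr (- ?N - 1)"
    show "?L \<ge> 0" using \<alpha> by simp
    fix u v w :: "complex ^ 'n" assume u: "norm u < 1" and v: "norm v < 1" and w: "norm w \<le> R"
    let ?a = "ball_aut z w"
    have a: "norm ?a < 1" using z w R by (intro norm_ball_aut_less_1) auto
    have re: "m \<le> Re (1 - cinner ?a x)" if "norm x < 1" for x
    proof -
      have "Re (cinner ?a x) \<le> cmod (cinner ?a x)" by (rule complex_Re_le_cmod)
      also have "\<dots> \<le> norm ?a * norm x" by (rule cinner_cauchy_schwarz)
      also have "\<dots> \<le> norm ?a" using that by (simp add: mult_left_le)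
      finally show ?thesis using m(2)[OF w] by simp
    qed
    have "cmod (tent_kernel \<alpha> z u w - tent_kernel \<alpha> z v w) \<le> ?L * cmod ((1 - cinner ?a u) - (1 - cinner ?a v))"
      unfolding tent_kernel_def using \<alpha> m(1) by (intro powr_neg_lipschitz_halfplane re u v) auto
    also have "cmod ((1 - cinner ?a u) - (1 - cinner ?a v)) = cmod (cinner ?a (u - v))"
      by (simp add: cinner_simps norm_minus_commute)
    also have "?L * \<dots> \<le> ?L * norm (u - v)"
    proof (intro mult_left_mono)
      have "cmod (cinner ?a (u - v)) \<le> norm ?a * norm (u - v)" by (rule cinner_cauchy_schwarz)
      also have "\<dots> \<le> norm (u - v)" using a by (simp add: mult_left_le_one_le)
      finally show "cmod (cinner ?a (u - v)) \<le> norm (u - v)" .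
    qed (use \<alpha> in simp)
    finally show "cmod (tent_kernel \<alpha> z u w - tent_kernel \<alpha> z v w) \<le> ?L * norm (u - v)" .
  qed
qed

text \<open>Both difference estimates have the form required by \<open>powr_neg_diff_le\<close> with
  the same scale |1 - <z,\<zeta>>|. The constants do not depend on \<open>a\<close>, so the bound
  survives taking the norm in E.\<close>

lemma tent_kernel_smooth:
  assumes \<alpha>: "\<alpha> > -1" and R0: "0 \<le> R" and R: "R < 1"
  obtains C \<delta> where "C > 0" "\<delta> > 0"
    "\<And>z w \<zeta> a :: complex ^ 'n. norm z < 1 \<Longrightarrow> norm w < 1 \<Longrightarrow> norm \<zeta> < 1 \<Longrightarrow> z \<noteq> \<zeta> \<Longrightarrow> norm a \<le> R \<Longrightarrow>
       rho z \<zeta> \<ge> \<delta> * rho w \<zeta> \<Longrightarrow>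
       cmod (tent_kernel \<alpha> z w a - tent_kernel \<alpha> z \<zeta> a) \<le> C * rho w \<zeta> powr (1/2) / rho z \<zeta> powr (real CARD('n) + 1 + \<alpha> + 1/2) \<and>
       cmod (tent_kernel \<alpha> w z a - tent_kernel \<alpha> \<zeta> z a) \<le> C * rho w \<zeta> powr (1/2) / rho z \<zeta> powr (real CARD('n) + 1 + \<alpha> + 1/2)"
proof -
  let ?N = "real CARD('n) + 1 + \<alpha>"
  have N: "?N > 0" using \<alpha> by simp
  define B where "B = 2 / (1 - R)"
  have B: "B > 0" using R by (simp add: B_def)
  define L1 where "L1 = 1 + 2 * sqrt (2 / (1 - R))"
  define L2 where "L2 = 32 / (1 - R) + 8 / (1 - R) ^ 3"
  define L where "L = L1 + L2"
  have L12: "0 \<le> L1" "0 \<le> L2" using R by (simp_all add: L1_def L2_def)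
  then have L: "0 \<le> L" "L1 \<le> L" "L2 \<le> L" by (simp_all add: L_def)
  have L1': "L1 \<ge> 1" using R by (simp add: L1_def)
  then have Lpos: "L > 0" using L12 by (simp add: L_def)
  \<comment> \<open>As \<open>rho z \<zeta>\<close> is at most 3 d, the separation hypothesis yields
    r + 4 L^2 B^2 r <= d. This gives at once r <= d for the difference estimates and the smallness
    condition of \<open>powr_neg_diff_le\<close>.\<close>
  define \<delta> where "\<delta> = 3 * (1 + 4 * L\<^sup>2 * B\<^sup>2)"
  have \<delta>: "\<delta> > 0" using L B by (simp add: \<delta>_def add_pos_nonneg)
  define C where "C = ?N * (2 * B) powr (?N + 1) * L * 3 powr (?N + 1/2)"
  have C: "C > 0" using N B Lpos by (simp add: C_def)
  \<comment> \<open>The common ending for the two variables; dividing t by 3 converts d back to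
    \<open>rho\<close> and explains the power of 3 in \<open>C\<close>.\<close>
  have fin: "cmod (x powr (- complex_of_real ?N) - y powr (- complex_of_real ?N)) \<le> C * rho w \<zeta> powr (1/2) / rho z \<zeta> powr (?N + 1/2)"
    if z: "norm z < 1" and w: "norm w < 1" and \<zeta>: "norm \<zeta> < 1" and ne: "z \<noteq> \<zeta>" and rho: "rho z \<zeta> \<ge> \<delta> * rho w \<zeta>"
      and x: "0 < Re x" and y: "0 < Re y" and xy: "rho w \<zeta> \<le> cmod (1 - cinner z \<zeta>) \<Longrightarrow> cmod (x - y) \<le> L * sqrt (rho w \<zeta> * cmod (1 - cinner z \<zeta>))"
      and yd: "cmod (1 - cinner z \<zeta>) \<le> B * cmod y"
    for x y and z w \<zeta> :: "complex ^ 'n"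
  proof -
    define d r t where "d = cmod (1 - cinner z \<zeta>)" and "r = rho w \<zeta>" and "t = rho z \<zeta>"
    have d: "0 < d" using one_minus_cinner_bounds(1)[of z \<zeta>] z \<zeta> by (simp add: d_def)
    have r: "0 \<le> r" by (simp add: r_def rho_nonneg)
    have t: "0 < t" "t \<le> 3 * d" using rho_pos[of z \<zeta>] rho_le[of z \<zeta>] z \<zeta> ne by (auto simp: t_def d_def)
    have "3 * (1 + 4 * L\<^sup>2 * B\<^sup>2) * r \<le> 3 * d" using rho t(2) by (simp add: \<delta>_def r_def t_def)
    then have rd: "r + 4 * L\<^sup>2 * B\<^sup>2 * r \<le> d" by (simp add: algebra_simps)
    have "0 \<le> 4 * L\<^sup>2 * B\<^sup>2 * r" using r by simp
    then have rd': "r \<le> d" "4 * L\<^sup>2 * B\<^sup>2 * r \<le> d" using rd r by linarith+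
    have "cmod (x powr (- complex_of_real ?N) - y powr (- complex_of_real ?N)) \<le> ?N * (2 * B) powr (?N + 1) * L * (r powr (1/2) / d powr (?N + 1/2))"
      using xy yd rd' d r L(1) by (intro powr_neg_diff_le x y N B) (auto simp: d_def r_def)
    also have "\<dots> \<le> ?N * (2 * B) powr (?N + 1) * L * (r powr (1/2) / (t / 3) powr (?N + 1/2))"
      using N B L t d by (intro mult_left_mono divide_left_mono powr_mono2) auto
    also have "\<dots> = C * r powr (1/2) / t powr (?N + 1/2)"
      by (simp add: C_def powr_divide)
    finally show ?thesis by (simp add: r_def t_def)
  qed
  show ?thesis
  proof (rule that[OF C \<delta>], intro conjI)
    fix z w \<zeta> a :: "complex ^ 'n"
    assume z: "norm z < 1" and w: "norm w < 1" and \<zeta>: "norm \<zeta> < 1" and ne: "z \<noteq> \<zeta>" and a: "norm a \<le> R" and rho: "rho z \<zeta> \<ge> \<delta> * rho w \<zeta>"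
    let ?s = "sqrt (rho w \<zeta> * cmod (1 - cinner z \<zeta>))"
    have s0: "0 \<le> ?s" using rho_nonneg[of w \<zeta>] by simp
    show "cmod (tent_kernel \<alpha> z w a - tent_kernel \<alpha> z \<zeta> a) \<le> C * rho w \<zeta> powr (1/2) / rho z \<zeta> powr (?N + 1/2)"
      unfolding tent_kernel_def
    proof (rule fin[OF z w \<zeta> ne rho])
      show "0 < Re (1 - cinner (ball_aut z a) w)" by (rule one_minus_cinner_aut_bounds(3)[OF z w a R])
      show "0 < Re (1 - cinner (ball_aut z a) \<zeta>)" by (rule one_minus_cinner_aut_bounds(3)[OF z \<zeta> a R])
      show "cmod (1 - cinner z \<zeta>) \<le> B * cmod (1 - cinner (ball_aut z a) \<zeta>)"
        unfolding B_def by (rule one_minus_cinner_aut_bounds(1)[OF z \<zeta> a R])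
      assume "rho w \<zeta> \<le> cmod (1 - cinner z \<zeta>)"
      from aut_diff_second[OF z w \<zeta> a R this]
      have "cmod ((1 - cinner (ball_aut z a) w) - (1 - cinner (ball_aut z a) \<zeta>)) \<le> L1 * ?s" by (simp add: L1_def)
      also have "\<dots> \<le> L * ?s" using L s0 by (intro mult_right_mono)
      finally show "cmod ((1 - cinner (ball_aut z a) w) - (1 - cinner (ball_aut z a) \<zeta>)) \<le> L * ?s" .
    qed
    show "cmod (tent_kernel \<alpha> w z a - tent_kernel \<alpha> \<zeta> z a) \<le> C * rho w \<zeta> powr (1/2) / rho z \<zeta> powr (?N + 1/2)"
      unfolding tent_kernel_def
    proof (rule fin[OF z w \<zeta> ne rho])
      show "0 < Re (1 - cinner (ball_aut w a) z)" by (rule one_minus_cinner_aut_bounds(3)[OF w z a R])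
      show "0 < Re (1 - cinner (ball_aut \<zeta> a) z)" by (rule one_minus_cinner_aut_bounds(3)[OF \<zeta> z a R])
      show "cmod (1 - cinner z \<zeta>) \<le> B * cmod (1 - cinner (ball_aut \<zeta> a) z)"
        unfolding B_def cmod_one_minus_cinner_commute[of z] by (rule one_minus_cinner_aut_bounds(1)[OF \<zeta> z a R])
      assume "rho w \<zeta> \<le> cmod (1 - cinner z \<zeta>)"
      from aut_diff_first[OF z w \<zeta> a R this]
      have "cmod ((1 - cinner (ball_aut w a) z) - (1 - cinner (ball_aut \<zeta> a) z)) \<le> L2 * ?s" by (simp add: L2_def)
      also have "\<dots> \<le> L * ?s" using L s0 by (intro mult_right_mono)
      finally show "cmod ((1 - cinner (ball_aut w a) z) - (1 - cinner (ball_aut \<zeta> a) z)) \<le> L * ?s" .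
    qed
  qed
qed

section \<open>From pointwise kernel bounds to norms in E\<close>

lemma tent_Lp_bound:
  assumes \<gamma>: "\<gamma> > 0" and q: "q > 1" and f: "f \<in> borel_measurable (tent_measure \<gamma> :: (complex ^ 'n) measure)"
    and c: "c \<ge> 0" and b: "\<And>w. norm w < tanh \<gamma> \<Longrightarrow> cmod (f w) \<le> c"
  shows "f \<in> Lp_fun (tent_measure \<gamma>) q"
    "Lp_norm (tent_measure \<gamma>) q f \<le> c * measure (tent_measure \<gamma> :: (complex ^ 'n) measure) (space (tent_measure \<gamma>)) powr (1 / q)"
proof -
  have "AE w in (tent_measure \<gamma> :: (complex ^ 'n) measure). cmod (f w) \<le> c"
    using tent_measure_AE[OF \<gamma>] by eventually_elim (rule b)
  from Lp_fun_bounded[OF finite_measure_tent[OF \<gamma>] f _ c this, of q] q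
  show "f \<in> Lp_fun (tent_measure \<gamma>) q"
    "Lp_norm (tent_measure \<gamma>) q f \<le> c * measure (tent_measure \<gamma> :: (complex ^ 'n) measure) (space (tent_measure \<gamma>)) powr (1 / q)"
    by auto
qed

lemma tent_kernel_Lp:
  assumes \<gamma>: "\<gamma> > 0" and \<alpha>: "\<alpha> > -1" and q: "q > 1" and z: "norm z < 1" and u: "norm u < 1"
  shows "tent_kernel \<alpha> z u \<in> Lp_fun (tent_measure \<gamma>) q"
proof -
  obtain C where C: "C > 0" "\<And>u w. norm u < 1 \<Longrightarrow> norm w \<le> tanh \<gamma> \<Longrightarrow> cmod (tent_kernel \<alpha> z u w) \<le> C"
    using tent_kernel_bounded[OF \<alpha> z tanh_real_lt_1] by blast
  show ?thesis
    using C u by (intro tent_Lp_bound[OF \<gamma> q tent_kernel_measurable[OF z u], of C]) auto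
qed

lemma bergman_kernel_K_tent:
  assumes \<gamma>: "\<gamma> > 0" and \<alpha>: "\<alpha> > -1" and q: "q > 1"
  shows "bergman_kernel \<alpha> (Lp_space (tent_measure \<gamma> :: (complex ^ 'n) measure) q) (K_tent \<alpha> \<gamma> q)"
proof -
  let ?T = "tent_measure \<gamma> :: (complex ^ 'n) measure" and ?N = "real CARD('n) + 1 + \<alpha>" and ?R = "tanh \<gamma>"
  let ?E = "Lp_space ?T q"
  define Q where "Q = measure ?T (space ?T) powr (1 / q)"
  have Q: "0 \<le> Q" by (simp add: Q_def)
  have R: "0 \<le> ?R" "?R < 1" using \<gamma> by (simp_all add: tanh_real_lt_1)
  note kLp = tent_kernel_Lp[OF \<gamma> \<alpha> q]
  have nrm_diff: "nrm ?E (K_tent \<alpha> \<gamma> q z u \<ominus>\<^bsub>?E\<^esub> K_tent \<alpha> \<gamma> q z' u') \<le> c * Q"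
    if "norm z < 1" "norm u < 1" "norm z' < 1" "norm u' < 1" "0 \<le> c"
      "\<And>w. norm w \<le> ?R \<Longrightarrow> cmod (tent_kernel \<alpha> z u w - tent_kernel \<alpha> z' u' w) \<le> c" for z u z' u' c
  proof -
    note l = kLp[OF that(1,2)] kLp[OF that(3,4)]
    have "nrm ?E (K_tent \<alpha> \<gamma> q z u \<ominus>\<^bsub>?E\<^esub> K_tent \<alpha> \<gamma> q z' u') = Lp_norm ?T q (\<lambda>w. tent_kernel \<alpha> z u w - tent_kernel \<alpha> z' u' w)"
      unfolding K_tent_eq using q l by (simp add: Lp_space_minus Lp_space_nrm Lp_fun_diff)
    also have "\<dots> \<le> c * Q"
      unfolding Q_def using that by (intro tent_Lp_bound[OF \<gamma> q]) (auto intro!: borel_measurable_diff tent_kernel_measurable)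
    finally show ?thesis .
  qed
  obtain C \<delta> where C: "C > 0" "\<delta> > 0" and sm: "\<And>z w \<zeta> a :: complex ^ 'n. norm z < 1 \<Longrightarrow> norm w < 1 \<Longrightarrow> norm \<zeta> < 1 \<Longrightarrow> z \<noteq> \<zeta> \<Longrightarrow> norm a \<le> ?R \<Longrightarrow>
       rho z \<zeta> \<ge> \<delta> * rho w \<zeta> \<Longrightarrow>
       cmod (tent_kernel \<alpha> z w a - tent_kernel \<alpha> z \<zeta> a) \<le> C * rho w \<zeta> powr (1/2) / rho z \<zeta> powr (?N + 1/2) \<and>
       cmod (tent_kernel \<alpha> w z a - tent_kernel \<alpha> \<zeta> z a) \<le> C * rho w \<zeta> powr (1/2) / rho z \<zeta> powr (?N + 1/2)"
    using tent_kernel_smooth[OF \<alpha> R, where 'n='n] by blast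
  define C0 where "C0 = (2 / (1 - ?R)) powr ?N * 3 powr ?N"
  have C0: "C0 > 0" using R by (simp add: C0_def)
  define C' where "C' = 1 + C0 * Q + 2 * C * Q"
  have C': "C' > 0" "C0 * Q \<le> C'" "2 * C * Q \<le> C'" using C C0 Q by (auto simp: C'_def add_pos_nonneg)
  let ?\<Omega> = "{(z, w). z \<in> ball (0 :: complex ^ 'n) 1 \<and> w \<in> ball (0 :: complex ^ 'n) 1 \<and> z \<noteq> w}"
  have carrier: "K_tent \<alpha> \<gamma> q z u \<in> carrier ?E" if "norm z < 1" "norm u < 1" for z u
    unfolding K_tent_eq Lp_space_carrier using kLp[OF that] by blast
  have size: "nrm ?E (K_tent \<alpha> \<gamma> q z u) \<le> C' / rho z u powr ?N" if z: "norm z < 1" and u: "norm u < 1" and ne: "z \<noteq> u" for z u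
  proof -
    have rho: "0 < rho z u" "rho z u \<le> 3 * cmod (1 - cinner z u)" using rho_pos[of z u] rho_le[of z u] z u ne by auto
    have "nrm ?E (K_tent \<alpha> \<gamma> q z u) = Lp_norm ?T q (tent_kernel \<alpha> z u)"
      unfolding K_tent_eq by (rule Lp_space_nrm[OF kLp[OF z u]])
    also have "\<dots> \<le> (C0 / rho z u powr ?N) * Q"
      unfolding Q_def
    proof (rule tent_Lp_bound(2)[OF \<gamma> q tent_kernel_measurable[OF z u]])
      fix w :: "complex ^ 'n" assume "norm w < ?R"
      then have "cmod (tent_kernel \<alpha> z u w) \<le> (2 / (1 - ?R)) powr ?N * abs_kernel \<alpha> z u"
        by (intro cmod_tent_kernel_le \<alpha> z u R) auto
      also have "\<dots> \<le> (2 / (1 - ?R)) powr ?N * (1 / (rho z u / 3) powr ?N)"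
        using rho \<alpha> by (intro mult_left_mono divide_left_mono powr_mono2 mult_pos_pos) auto
      also have "\<dots> = C0 / rho z u powr ?N" by (simp add: C0_def powr_divide)
      finally show "cmod (tent_kernel \<alpha> z u w) \<le> C0 / rho z u powr ?N" .
    qed (use C0 in simp)
    also have "\<dots> = (C0 * Q) / rho z u powr ?N" by simp
    also have "\<dots> \<le> C' / rho z u powr ?N" using C' by (intro divide_right_mono) auto
    finally show ?thesis .
  qed
  have smooth: "nrm ?E (K_tent \<alpha> \<gamma> q z w \<ominus>\<^bsub>?E\<^esub> K_tent \<alpha> \<gamma> q z \<zeta>) + nrm ?E (K_tent \<alpha> \<gamma> q w z \<ominus>\<^bsub>?E\<^esub> K_tent \<alpha> \<gamma> q \<zeta> z)
      \<le> C' * rho w \<zeta> powr (1/2) / rho z \<zeta> powr (?N + 1/2)"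
    if z: "norm z < 1" and w: "norm w < 1" and \<zeta>: "norm \<zeta> < 1" and ne: "z \<noteq> \<zeta>" and rho: "rho z \<zeta> \<ge> \<delta> * rho w \<zeta>" for z w \<zeta>
  proof -
    let ?c = "C * rho w \<zeta> powr (1/2) / rho z \<zeta> powr (?N + 1/2)"
    have c: "0 \<le> ?c" using C by simp
    have "nrm ?E (K_tent \<alpha> \<gamma> q z w \<ominus>\<^bsub>?E\<^esub> K_tent \<alpha> \<gamma> q z \<zeta>) \<le> ?c * Q"
      using sm[OF z w \<zeta> ne _ rho] by (intro nrm_diff z w \<zeta> c) auto
    moreover have "nrm ?E (K_tent \<alpha> \<gamma> q w z \<ominus>\<^bsub>?E\<^esub> K_tent \<alpha> \<gamma> q \<zeta> z) \<le> ?c * Q"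
      using sm[OF z w \<zeta> ne _ rho] by (intro nrm_diff z w \<zeta> c) auto
    ultimately have "nrm ?E (K_tent \<alpha> \<gamma> q z w \<ominus>\<^bsub>?E\<^esub> K_tent \<alpha> \<gamma> q z \<zeta>) + nrm ?E (K_tent \<alpha> \<gamma> q w z \<ominus>\<^bsub>?E\<^esub> K_tent \<alpha> \<gamma> q \<zeta> z) \<le> ?c * Q + ?c * Q"
      by (rule add_mono)
    also have "\<dots> = (2 * C * Q) * rho w \<zeta> powr (1/2) / rho z \<zeta> powr (?N + 1/2)" by simp
    also have "\<dots> \<le> C' * rho w \<zeta> powr (1/2) / rho z \<zeta> powr (?N + 1/2)"
      using C' by (intro divide_right_mono mult_right_mono) auto
    finally show ?thesis .
  qed
  have cont: "((\<lambda>(z, w). nrm ?E (K_tent \<alpha> \<gamma> q z w \<ominus>\<^bsub>?E\<^esub> K_tent \<alpha> \<gamma> q z0 w0)) \<longlongrightarrow> 0) (at (z0, w0) within ?\<Omega>)"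
    if z0: "norm z0 < 1" and w0: "norm w0 < 1" for z0 w0
  proof (rule tendstoI)
    fix e :: real assume e: "e > 0"
    \<comment> \<open>Dividing by Q + 1 instead of Q is safe because only Q >= 0 is
      available.\<close>
    define e' where "e' = e / 2 / (Q + 1)"
    have e': "e' > 0" using e Q by (simp add: e'_def)
    \<comment> \<open>Joint continuity and compactness of the closed ball in the third variable give
      closeness uniformly in that variable, hence in the norm of E.\<close>
    have "continuous_on ((ball 0 1 \<times> ball 0 1) \<times> cball 0 ?R) (\<lambda>x. tent_kernel \<alpha> (fst (fst x)) (snd (fst x)) (snd x) :: complex)"
      using R by (intro continuous_on_tent_kernel continuous_intros) auto
    then obtain X where X: "(z0, w0) \<in> X" "open X"
      "\<forall>x\<in>X \<inter> (ball 0 1 \<times> ball 0 1). \<forall>t\<in>cball 0 ?R. dist (tent_kernel \<alpha> (fst x) (snd x) t) (tent_kernel \<alpha> z0 w0 t) \<le> e'"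
      using continuous_on_prod_compactE[of "ball 0 1 \<times> ball 0 1" "cball 0 ?R" "\<lambda>x. tent_kernel \<alpha> (fst (fst x)) (snd (fst x)) (snd x)" "(z0, w0)" e']
        e' z0 w0 by auto
    show "\<forall>\<^sub>F x in at (z0, w0) within ?\<Omega>. dist (case x of (z, w) \<Rightarrow> nrm ?E (K_tent \<alpha> \<gamma> q z w \<ominus>\<^bsub>?E\<^esub> K_tent \<alpha> \<gamma> q z0 w0)) 0 < e"
      unfolding eventually_at_topological
    proof (intro exI[of _ X] conjI ballI impI X)
      fix x assume x: "x \<in> X" "x \<in> ?\<Omega>"
      obtain z w where [simp]: "x = (z, w)" by (cases x)
      have zw: "norm z < 1" "norm w < 1" using x by auto
      have le: "nrm ?E (K_tent \<alpha> \<gamma> q z w \<ominus>\<^bsub>?E\<^esub> K_tent \<alpha> \<gamma> q z0 w0) \<le> e' * Q"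
      proof (rule nrm_diff[OF zw z0 w0])
        fix t :: "complex ^ 'n" assume "norm t \<le> ?R"
        then show "cmod (tent_kernel \<alpha> z w t - tent_kernel \<alpha> z0 w0 t) \<le> e'"
          using X(3)[rule_format, of "(z, w)" t] x zw by (simp add: dist_norm)
      qed (use e' in simp)
      have "e' * (Q + 1) = e / 2" by (rule iffD1[OF nonzero_eq_divide_eq e'_def]) (use Q in simp)
      then have "e' * Q < e" using e e' by (simp add: distrib_left)
      moreover have "0 \<le> nrm ?E (K_tent \<alpha> \<gamma> q z w \<ominus>\<^bsub>?E\<^esub> K_tent \<alpha> \<gamma> q z0 w0)"
        by (simp add: Lp_space_def Lp_norm_nonneg)
      ultimately show "dist (case x of (z, w) \<Rightarrow> nrm ?E (K_tent \<alpha> \<gamma> q z w \<ominus>\<^bsub>?E\<^esub> K_tent \<alpha> \<gamma> q z0 w0)) 0 < e"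
        using le by simp
    qed
  qed
  show ?thesis
    unfolding bergman_kernel_def Let_def
  proof (intro conjI)
    show "\<forall>(z, w)\<in>?\<Omega>. K_tent \<alpha> \<gamma> q z w \<in> carrier ?E" using carrier by auto
    show "\<forall>(z\<^sub>0, w\<^sub>0)\<in>?\<Omega>. ((\<lambda>(z, w). nrm ?E (K_tent \<alpha> \<gamma> q z w \<ominus>\<^bsub>?E\<^esub> K_tent \<alpha> \<gamma> q z\<^sub>0 w\<^sub>0)) \<longlongrightarrow> 0) (at (z\<^sub>0, w\<^sub>0) within ?\<Omega>)"
      using cont by auto
    show "\<exists>C>0. \<exists>\<delta>>0. \<exists>b>0. b \<le> 1 \<and>
        (\<forall>(z, w)\<in>?\<Omega>. nrm ?E (K_tent \<alpha> \<gamma> q z w) \<le> C / rho z w powr ?N) \<and>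
        (\<forall>z\<in>ball 0 1. \<forall>w\<in>ball 0 1. \<forall>\<zeta>\<in>ball 0 1. z \<noteq> w \<longrightarrow> z \<noteq> \<zeta> \<longrightarrow> rho z \<zeta> \<ge> \<delta> * rho w \<zeta> \<longrightarrow>
          nrm ?E (K_tent \<alpha> \<gamma> q z w \<ominus>\<^bsub>?E\<^esub> K_tent \<alpha> \<gamma> q z \<zeta>) + nrm ?E (K_tent \<alpha> \<gamma> q w z \<ominus>\<^bsub>?E\<^esub> K_tent \<alpha> \<gamma> q \<zeta> z)
            \<le> C * rho w \<zeta> powr b / rho z \<zeta> powr (?N + b))"
      using C'(1) C(2) size smooth by (intro exI[of _ C'] exI[of _ \<delta>] exI[of _ "1/2"] conjI) auto
  qed
qed

section \<open>Bochner integrals in Lebesgue spaces\<close>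

lemma norm_integral_le:
  fixes f :: "'a \<Rightarrow> 'b::{banach, second_countable_topology}"
  assumes "integrable M f" "integrable M g" "\<And>x. x \<in> space M \<Longrightarrow> norm (f x) \<le> g x"
  shows "norm (\<integral>x. f x \<partial>M) \<le> (\<integral>x. g x \<partial>M)"
proof -
  have "norm (\<integral>x. f x \<partial>M) \<le> (\<integral>x. norm (f x) \<partial>M)" by (rule integral_norm_bound)
  also have "\<dots> \<le> (\<integral>x. g x \<partial>M)" using assms by (intro integral_mono) auto
  finally show ?thesis .
qed

lemma (in finite_measure) integral_simple_function_comp:
  fixes \<psi> :: "'b \<Rightarrow> complex"
  assumes s: "simple_function M s"
  shows "(\<integral>u. \<psi> (s u) \<partial>M) = (\<Sum>y\<in>s ` space M. complex_of_real (measure M {x \<in> space M. s x = y}) * \<psi> y)"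
proof -
  have fin: "finite (s ` space M)" using s by (rule simple_functionD)
  have sets: "{x \<in> space M. s x = y} \<in> sets M" for y
    using simple_functionD(2)[OF s, of "{y}"] by (simp add: vimage_def Int_def conj_commute)
  have "(\<integral>u. \<psi> (s u) \<partial>M) = (\<integral>u. (\<Sum>y\<in>s ` space M. indicator {x \<in> space M. s x = y} u *\<^sub>R \<psi> y) \<partial>M)"
  proof (rule Bochner_Integration.integral_cong)
    fix u assume u: "u \<in> space M"
    have "(\<Sum>y\<in>s ` space M. indicator {x \<in> space M. s x = y} u *\<^sub>R \<psi> y) = (\<Sum>y\<in>{s u}. indicator {x \<in> space M. s x = y} u *\<^sub>R \<psi> y)"
      using fin u by (intro sum.mono_neutral_right) (auto simp: indicator_def)
    then show "\<psi> (s u) = (\<Sum>y\<in>s ` space M. indicator {x \<in> space M. s x = y} u *\<^sub>R \<psi> y)"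
      using u by simp
  qed simp
  also have "\<dots> = (\<Sum>y\<in>s ` space M. \<integral>u. indicator {x \<in> space M. s x = y} u *\<^sub>R \<psi> y \<partial>M)"
    using sets by (intro Bochner_Integration.integral_sum integrable_scaleR_left integrable_real_indicator)
      (auto simp: less_top[symmetric])
  also have "\<dots> = (\<Sum>y\<in>s ` space M. complex_of_real (measure M {x \<in> space M. s x = y}) * \<psi> y)"
    using sets by (intro sum.cong) (auto simp: scaleR_conv_of_real Int_absorb2 Collect_restrict)
  finally show ?thesis .
qed

lemma finsum_Lp_space:
  assumes q: "q \<ge> 1" and "finite A" and "\<And>y. y \<in> A \<Longrightarrow> g y \<in> Lp_fun T q"
  shows "(\<Oplus>\<^bsub>Lp_space T q\<^esub>y\<in>A. Lp_class T q (g y)) = Lp_class T q (\<lambda>w. \<Sum>y\<in>A. g y w) \<and> (\<lambda>w. \<Sum>y\<in>A. g y w) \<in> Lp_fun T q"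
  using assms(2,3)
proof (induction A rule: finite_induct)
  case empty
  interpret module complex_ring "Lp_space T q" by (rule module_Lp_space[OF q])
  show ?case using q by (simp add: Lp_space_zero Lp_fun_zero)
next
  case (insert a A)
  interpret module complex_ring "Lp_space T q" by (rule module_Lp_space[OF q])
  have g: "g y \<in> Lp_fun T q" if "y \<in> insert a A" for y using insert.prems that by blast
  have IH: "(\<Oplus>\<^bsub>Lp_space T q\<^esub>y\<in>A. Lp_class T q (g y)) = Lp_class T q (\<lambda>w. \<Sum>y\<in>A. g y w)"
    "(\<lambda>w. \<Sum>y\<in>A. g y w) \<in> Lp_fun T q" using insert.IH g by auto
  have "(\<Oplus>\<^bsub>Lp_space T q\<^esub>y\<in>insert a A. Lp_class T q (g y)) = Lp_class T q (g a) \<oplus>\<^bsub>Lp_space T q\<^esub> (\<Oplus>\<^bsub>Lp_space T q\<^esub>y\<in>A. Lp_class T q (g y))"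
    using insert.hyps g by (intro M.finsum_insert) (auto simp: Lp_space_carrier)
  also have "\<dots> = Lp_class T q (\<lambda>w. g a w + (\<Sum>y\<in>A. g y w))"
    unfolding IH(1) using g IH(2) by (intro Lp_space_add) auto
  finally show ?case
    using insert.hyps Lp_fun_add[OF q g[of a] IH(2)] by simp
qed

text \<open>The values of a simple function are classes, so its integral is the class of the pointwise integral
  only up to the finitely many null sets on which the chosen representatives differ.\<close>
lemma simple_integral_Lp_space:
  assumes M: "finite_measure M" and q: "q \<ge> 1" and c: "simple_function M c"
    and h: "\<And>u. u \<in> space M \<Longrightarrow> h (c u) \<in> Lp_fun T q"
  shows "\<exists>V\<in>Lp_fun T q. simple_integral_into M (Lp_space T q) (\<lambda>u. Lp_class T q (h (c u))) = Lp_class T q V \<and>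
     (AE w in T. V w = (\<integral>u. h (c u) w \<partial>M))"
proof -
  interpret M: finite_measure M by fact
  define s where "s u = Lp_class T q (h (c u))" for u
  have s: "simple_function M s"
    using simple_function_compose1[OF c, of "\<lambda>a. Lp_class T q (h a)"] by (simp add: s_def[abs_def])
  define \<mu> where "\<mu> y = complex_of_real (measure M {x \<in> space M. s x = y})" for y
  have fin: "finite (s ` space M)" using s by (rule simple_functionD)
  have rep: "Lp_rep y \<in> Lp_fun T q" "y = Lp_class T q (Lp_rep y)" if y: "y \<in> s ` space M" for y
  proof -
    obtain u where u: "u \<in> space M" "y = Lp_class T q (h (c u))" using y unfolding s_def by blast
    note r = Lp_rep_class[OF h[OF u(1)]]
    show "Lp_rep y \<in> Lp_fun T q" using r(1) u(2) by simp
    have "Lp_class T q (Lp_rep y) = Lp_class T q (h (c u))" using r(2) u(2) by (intro Lp_class_eqI) simp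
    then show "y = Lp_class T q (Lp_rep y)" using u(2) by simp
  qed
  define V where "V w = (\<Sum>y\<in>s ` space M. \<mu> y * Lp_rep y w)" for w
  interpret E: module complex_ring "Lp_space T q" by (rule module_Lp_space[OF q])
  have sm: "\<mu> y \<odot>\<^bsub>Lp_space T q\<^esub> y = Lp_class T q (\<lambda>w. \<mu> y * Lp_rep y w)" if "y \<in> s ` space M" for y
    using Lp_space_smult[OF rep(1)[OF that], of "\<mu> y"] rep(2)[OF that] by simp
  have cl: "Lp_class T q (\<lambda>w. \<mu> y * Lp_rep y w) \<in> carrier (Lp_space T q)" if "y \<in> s ` space M" for y
    unfolding Lp_space_carrier using rep(1)[OF that] by (blast intro: Lp_fun_cmult)
  have "simple_integral_into M (Lp_space T q) s = (\<Oplus>\<^bsub>Lp_space T q\<^esub>y\<in>s ` space M. Lp_class T q (\<lambda>w. \<mu> y * Lp_rep y w))"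
    unfolding simple_integral_into_def \<mu>_def[symmetric]
    by (rule E.M.finsum_cong') (use sm cl in auto)
  moreover have "(\<Oplus>\<^bsub>Lp_space T q\<^esub>y\<in>s ` space M. Lp_class T q (\<lambda>w. \<mu> y * Lp_rep y w)) = Lp_class T q (\<lambda>w. \<Sum>y\<in>s ` space M. \<mu> y * Lp_rep y w)
      \<and> (\<lambda>w. \<Sum>y\<in>s ` space M. \<mu> y * Lp_rep y w) \<in> Lp_fun T q"
    using rep(1) by (intro finsum_Lp_space q fin Lp_fun_cmult)
  ultimately have 1: "simple_integral_into M (Lp_space T q) s = Lp_class T q V" "V \<in> Lp_fun T q"
    by (simp_all add: V_def[abs_def])
  have "AE w in T. \<forall>a\<in>c ` space M. Lp_rep (Lp_class T q (h a)) w = h a w"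
    using simple_functionD(1)[OF c] h Lp_rep_class(2) by (intro AE_finite_allI) auto
  then have "AE w in T. V w = (\<integral>u. h (c u) w \<partial>M)"
  proof eventually_elim
    case (elim w)
    have "V w = (\<integral>u. Lp_rep (s u) w \<partial>M)"
      unfolding V_def \<mu>_def by (rule M.integral_simple_function_comp[OF s, symmetric])
    also have "\<dots> = (\<integral>u. h (c u) w \<partial>M)"
      using elim by (intro Bochner_Integration.integral_cong) (auto simp: s_def)
    finally show ?case .
  qed
  then show ?thesis using 1 unfolding s_def[abs_def] by blast
qed

text \<open>Values outside the ball are replaced by 0, so that a kernel can be evaluated at every
  approximating point; the limit lies in the open ball, so the replacement stops eventually.\<close>

lemma simple_approximation_ball:
  assumes "space M = ball (0 :: complex ^ 'n) 1" "(\<lambda>x. x) \<in> borel_measurable M"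
  obtains P where "\<And>k. simple_function M (P k)" "\<And>k u. norm (P k u) < 1"
    "\<And>u. u \<in> space M \<Longrightarrow> (\<lambda>k::nat. P k u) \<longlonglongrightarrow> u"
proof -
  from borel_measurable_implies_sequence_metric[OF assms(2), of 0]
  obtain F where F: "\<And>k::nat. simple_function M (F k)" "\<And>u. u \<in> space M \<Longrightarrow> (\<lambda>k. F k u) \<longlonglongrightarrow> u"
    by blast
  define P where "P k u = (if norm (F k u) < 1 then F k u else 0)" for k u
  show ?thesis
  proof
    show "simple_function M (P k)" for k
      unfolding P_def[abs_def] using simple_function_compose1[OF F(1), of "\<lambda>x. if norm x < 1 then x else 0" k] by simp
    show "norm (P k u) < 1" for k u by (simp add: P_def)
    show "(\<lambda>k. P k u) \<longlonglongrightarrow> u" if u: "u \<in> space M" for u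
    proof (rule Lim_transform_eventually[OF F(2)[OF u]])
      have "\<forall>\<^sub>F k in sequentially. F k u \<in> ball 0 1"
        by (rule topological_tendstoD[OF F(2)[OF u]]) (use u assms(1) in auto)
      then show "\<forall>\<^sub>F k in sequentially. F k u = P k u"
        by eventually_elim (simp add: P_def)
    qed
  qed
qed

text \<open>Replace f u and the point u in \<kappa> u by simple approximations. The pointwise error
  is at most a function \<open>D k u\<close> independent of w in S, dominated by a multiple of |f|
  and tending to 0; dominated convergence gives both the approximation of the integrand and the
  convergence of the simple integrals.\<close>

lemma has_integral_into_Lp_space:
  fixes \<kappa> :: "complex ^ 'n \<Rightarrow> 'b \<Rightarrow> complex"
  assumes M: "finite_measure M" "space M = ball 0 1" "(\<lambda>x. x) \<in> borel_measurable M"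
    and T: "finite_measure T" and q: "q \<ge> 1" and S: "AE w in T. w \<in> S"
    and f: "integrable M f"
    and \<kappa>: "\<And>u. norm u < 1 \<Longrightarrow> \<kappa> u \<in> borel_measurable T"
    and \<kappa>M: "\<And>w. w \<in> S \<Longrightarrow> (\<lambda>u. \<kappa> u w) \<in> borel_measurable M"
    and C: "C \<ge> 0" "\<And>u w. norm u < 1 \<Longrightarrow> w \<in> S \<Longrightarrow> cmod (\<kappa> u w) \<le> C"
    and L: "L \<ge> 0" "\<And>u v w. norm u < 1 \<Longrightarrow> norm v < 1 \<Longrightarrow> w \<in> S \<Longrightarrow> cmod (\<kappa> u w - \<kappa> v w) \<le> L * norm (u - v)"
    and G: "(\<lambda>w. \<integral>u. f u * \<kappa> u w \<partial>M) \<in> Lp_fun T q"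
  shows "has_integral_into M (Lp_space T q) (\<lambda>u. f u \<odot>\<^bsub>Lp_space T q\<^esub> Lp_class T q (\<kappa> u))
    (Lp_class T q (\<lambda>w. \<integral>u. f u * \<kappa> u w \<partial>M))"
proof -
  let ?E = "Lp_space T q"
  interpret M: finite_measure M by fact
  interpret E: module complex_ring ?E by (rule module_Lp_space[OF q])
  note [measurable] = borel_measurable_integrable[OF f]
  define Q where "Q = measure T (space T) powr (1 / q)"
  have Q: "0 \<le> Q" by (simp add: Q_def)
  have Lb: "g \<in> Lp_fun T q" "Lp_norm T q g \<le> c * Q" if "g \<in> borel_measurable T" "c \<ge> 0" "\<And>w. w \<in> S \<Longrightarrow> cmod (g w) \<le> c" for g c
  proof -
    have "AE w in T. cmod (g w) \<le> c" using S by eventually_elim (rule that(3))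
    from Lp_fun_bounded[OF T that(1) _ that(2) this, of q] q show "g \<in> Lp_fun T q" "Lp_norm T q g \<le> c * Q"
      by (auto simp: Q_def)
  qed
  obtain P where P: "\<And>k. simple_function M (P k)" "\<And>k u. norm (P k u) < 1"
    "\<And>u. u \<in> space M \<Longrightarrow> (\<lambda>k::nat. P k u) \<longlonglongrightarrow> u"
    using simple_approximation_ball[OF M(2,3)] by blast
  obtain F where F: "\<And>k::nat. simple_function M (F k)" "\<And>u. u \<in> space M \<Longrightarrow> (\<lambda>k. F k u) \<longlonglongrightarrow> f u"
      "\<And>k u. u \<in> space M \<Longrightarrow> cmod (F k u) \<le> 2 * cmod (f u)"
  proof -
    have "f \<in> borel_measurable M" by measurable
    from borel_measurable_implies_sequence_metric[OF this, of 0] obtain F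
      where "\<forall>k. simple_function M (F k)" "\<forall>u\<in>space M. (\<lambda>k. F k u) \<longlonglongrightarrow> f u"
        "\<forall>k. \<forall>u\<in>space M. dist (F k u) 0 \<le> 2 * dist (f u) 0" by blast
    then show ?thesis by (intro that[of F]) (auto simp: dist_norm)
  qed
  have kL: "(\<lambda>w. a * \<kappa> u w) \<in> Lp_fun T q" if "norm u < 1" for a u
    by (rule Lb(1)[of _ "cmod a * C"]) (use that C \<kappa> in \<open>auto simp: norm_mult intro: mult_left_mono\<close>)
  \<comment> \<open>A simple approximation of the pair (f u, u); every function composed with it is
    again simple, also with values in the space of classes.\<close>
  define c where "c k u = (F k u, P k u)" for k u
  define h where "h = (\<lambda>(a, v) w. a * \<kappa> v w)"
  have hc: "h (c k u) = (\<lambda>w. F k u * \<kappa> (P k u) w)" for k u by (simp add: h_def c_def)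
  have cs: "simple_function M (c k)" for k
    unfolding c_def[abs_def] by (intro simple_function_Pair F P)
  have hL: "h (c k u) \<in> Lp_fun T q" for k u unfolding hc by (rule kL[OF P(2)])
  define s where "s k u = Lp_class T q (h (c k u))" for k u
  have ss: "simple_into M ?E (s k)" for k
    unfolding simple_into_def s_def[abs_def] Lp_space_carrier
    using simple_function_compose1[OF cs, of "\<lambda>a. Lp_class T q (h a)"] hL by auto
  define g where "g u = f u \<odot>\<^bsub>?E\<^esub> Lp_class T q (\<kappa> u)" for u
  have g: "g u = Lp_class T q (\<lambda>w. f u * \<kappa> u w)" if "u \<in> space M" for u
    unfolding g_def using that M(2) kL[of u 1] by (intro Lp_space_smult) auto
  define D where "D k u = C * cmod (f u - F k u) + L * (cmod (f u) * norm (u - P k u))" for k u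
  have D0: "0 \<le> D k u" for k u using C L by (simp add: D_def)
  have pt: "cmod (f u * \<kappa> u w - h (c k u) w) \<le> D k u" if u: "u \<in> space M" and w: "w \<in> S" for k u w
  proof -
    have un: "norm u < 1" using u M(2) by simp
    have "f u * \<kappa> u w - h (c k u) w = (f u - F k u) * \<kappa> (P k u) w + f u * (\<kappa> u w - \<kappa> (P k u) w)"
      by (simp add: hc algebra_simps)
    then have "cmod (f u * \<kappa> u w - h (c k u) w) \<le> cmod (f u - F k u) * cmod (\<kappa> (P k u) w) + cmod (f u) * cmod (\<kappa> u w - \<kappa> (P k u) w)"
      by (metis norm_mult norm_triangle_ineq)
    also have "\<dots> \<le> cmod (f u - F k u) * C + cmod (f u) * (L * norm (u - P k u))"
      using C(2)[OF P(2) w] L(2)[OF un P(2) w] by (intro add_mono mult_left_mono) auto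
    finally show ?thesis by (simp add: D_def algebra_simps)
  qed
  have [measurable]: "F k \<in> borel_measurable M" "P k \<in> borel_measurable M" for k
    using F(1) P(1) by (auto intro: borel_measurable_simple_function)
  have Dm[measurable]: "D k \<in> borel_measurable M" for k
    unfolding D_def using M(3) by measurable
  have Dlim: "(\<lambda>k. D k u) \<longlonglongrightarrow> 0" if u: "u \<in> space M" for u
  proof -
    have "(\<lambda>k. D k u) \<longlonglongrightarrow> C * cmod (f u - f u) + L * (cmod (f u) * norm (u - u))"
      unfolding D_def by (intro tendsto_intros F(2) P(3) u)
    then show ?thesis by simp
  qed
  have Dle: "norm (D k u) \<le> (3 * C + 2 * L) * cmod (f u)" if u: "u \<in> space M" for k u
  proof -
    have "cmod (f u - F k u) \<le> 3 * cmod (f u)"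
      using norm_triangle_ineq4[of "f u" "F k u"] F(3)[OF u, of k] by linarith
    moreover have "norm (u - P k u) \<le> 2"
      using norm_triangle_ineq4[of u "P k u"] P(2)[of k u] u M(2) by simp
    ultimately have "D k u \<le> C * (3 * cmod (f u)) + L * (cmod (f u) * 2)"
      unfolding D_def using C L by (intro add_mono mult_left_mono) auto
    then show ?thesis using D0[of k u] by (simp add: algebra_simps)
  qed
  have Dint: "integrable M (D k)" for k
    by (rule Bochner_Integration.integrable_bound[of M "\<lambda>u. (3 * C + 2 * L) * cmod (f u)"])
      (use f Dle C L in \<open>auto intro!: AE_I2\<close>)
  have DintLim: "(\<lambda>k. \<integral>u. D k u \<partial>M) \<longlonglongrightarrow> 0"
  proof -
    have "(\<lambda>k. \<integral>u. D k u \<partial>M) \<longlonglongrightarrow> (\<integral>u. 0 \<partial>M)"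
      by (rule integral_dominated_convergence[where w = "\<lambda>u. (3 * C + 2 * L) * cmod (f u)"])
        (use f Dle Dlim in \<open>auto intro!: AE_I2\<close>)
    then show ?thesis by simp
  qed
  have gs: "nrm ?E (g u \<ominus>\<^bsub>?E\<^esub> s k u) \<le> D k u * Q" "nrm ?E (s k u \<ominus>\<^bsub>?E\<^esub> g u) \<le> D k u * Q" if u: "u \<in> space M" for k u
  proof -
    have uL: "(\<lambda>w. f u * \<kappa> u w) \<in> Lp_fun T q" using kL u M(2) by simp
    note m = Lp_fun_measurable[OF uL] Lp_fun_measurable[OF hL[of k u]]
    have "nrm ?E (g u \<ominus>\<^bsub>?E\<^esub> s k u) = Lp_norm T q (\<lambda>w. f u * \<kappa> u w - h (c k u) w)"
      unfolding g[OF u] s_def using q uL hL by (simp add: Lp_space_minus Lp_space_nrm Lp_fun_diff)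
    also have "\<dots> \<le> D k u * Q" using m D0 pt[OF u] by (intro Lb(2) borel_measurable_diff) auto
    finally show "nrm ?E (g u \<ominus>\<^bsub>?E\<^esub> s k u) \<le> D k u * Q" .
    have "nrm ?E (s k u \<ominus>\<^bsub>?E\<^esub> g u) = Lp_norm T q (\<lambda>w. h (c k u) w - f u * \<kappa> u w)"
      unfolding g[OF u] s_def using q uL hL by (simp add: Lp_space_minus Lp_space_nrm Lp_fun_diff)
    also have "\<dots> \<le> D k u * Q" using m D0 pt[OF u] by (intro Lb(2) borel_measurable_diff) (auto simp: norm_minus_commute)
    finally show "nrm ?E (s k u \<ominus>\<^bsub>?E\<^esub> g u) \<le> D k u * Q" .
  qed
  have nrm0: "0 \<le> nrm ?E A" for A by (simp add: Lp_space_def Lp_norm_nonneg)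
  have sm: "strongly_measurable M ?E g"
    unfolding strongly_measurable_def
  proof (intro exI[of _ s] conjI allI ss AE_I2)
    fix u assume u: "u \<in> space M"
    show "g u \<in> carrier ?E" unfolding g[OF u] Lp_space_carrier using kL u M(2) by auto
    have "(\<lambda>k. D k u * Q) \<longlonglongrightarrow> 0 * Q" by (intro tendsto_intros Dlim u)
    then have "(\<lambda>k. D k u * Q) \<longlonglongrightarrow> 0" by simp
    then show "(\<lambda>k. nrm ?E (s k u \<ominus>\<^bsub>?E\<^esub> g u)) \<longlonglongrightarrow> 0"
      by (rule Lim_null_comparison[rotated]) (intro always_eventually allI, simp add: nrm0 gs(2)[OF u])
  qed
  have lim1: "(\<lambda>k. \<integral>\<^sup>+ u. ennreal (nrm ?E (g u \<ominus>\<^bsub>?E\<^esub> s k u)) \<partial>M) \<longlonglongrightarrow> 0"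
  proof (rule tendsto_sandwich[OF _ _ tendsto_const])
    show "\<forall>\<^sub>F k in sequentially. (\<integral>\<^sup>+ u. ennreal (nrm ?E (g u \<ominus>\<^bsub>?E\<^esub> s k u)) \<partial>M) \<le> ennreal ((\<integral>u. D k u \<partial>M) * Q)"
    proof (intro always_eventually allI)
      fix k
      have "(\<integral>\<^sup>+ u. ennreal (nrm ?E (g u \<ominus>\<^bsub>?E\<^esub> s k u)) \<partial>M) \<le> (\<integral>\<^sup>+ u. ennreal (D k u * Q) \<partial>M)"
        using gs by (intro nn_integral_mono ennreal_leI)
      also have "\<dots> = ennreal (\<integral>u. D k u * Q \<partial>M)"
        using Dint D0 Q by (intro nn_integral_eq_integral) auto
      finally show "(\<integral>\<^sup>+ u. ennreal (nrm ?E (g u \<ominus>\<^bsub>?E\<^esub> s k u)) \<partial>M) \<le> ennreal ((\<integral>u. D k u \<partial>M) * Q)" by simp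
    qed
    have "(\<lambda>k. ennreal ((\<integral>u. D k u \<partial>M) * Q)) \<longlonglongrightarrow> ennreal (0 * Q)"
      by (intro tendsto_ennrealI tendsto_intros DintLim)
    then show "(\<lambda>k. ennreal ((\<integral>u. D k u \<partial>M) * Q)) \<longlonglongrightarrow> 0" by simp
  qed simp
  have lim2: "(\<lambda>k. nrm ?E (simple_integral_into M ?E (s k) \<ominus>\<^bsub>?E\<^esub> Lp_class T q (\<lambda>w. \<integral>u. f u * \<kappa> u w \<partial>M))) \<longlonglongrightarrow> 0"
  proof (rule tendsto_sandwich[OF _ _ tendsto_const])
    show "\<forall>\<^sub>F k in sequentially. nrm ?E (simple_integral_into M ?E (s k) \<ominus>\<^bsub>?E\<^esub> Lp_class T q (\<lambda>w. \<integral>u. f u * \<kappa> u w \<partial>M)) \<le> (\<integral>u. D k u \<partial>M) * Q"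
    proof (intro always_eventually allI)
      fix k
      obtain V where V: "V \<in> Lp_fun T q" "simple_integral_into M ?E (s k) = Lp_class T q V"
          "AE w in T. V w = (\<integral>u. h (c k u) w \<partial>M)"
        using simple_integral_Lp_space[where c = "c k" and h = h and T = T, OF M(1) q cs hL]
        unfolding s_def[abs_def] by blast
      \<comment> \<open>For almost every fixed \<open>w\<close> the representative of the simple
        integral is an ordinary integral, so the two scalar integrals can be compared under the
        integral sign.\<close>
      have "AE w in T. cmod (V w - (\<integral>u. f u * \<kappa> u w \<partial>M)) \<le> (\<integral>u. D k u \<partial>M)"
        using V(3) S
      proof eventually_elim
        case (elim w)
        have [measurable]: "(\<lambda>u. \<kappa> u w) \<in> borel_measurable M" by (rule \<kappa>M[OF elim(2)])
        have i1: "integrable M (\<lambda>u. f u * \<kappa> u w)"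
        proof (rule Bochner_Integration.integrable_bound[of M "\<lambda>u. cmod (f u) * C"])
          show "integrable M (\<lambda>u. cmod (f u) * C)" using f by auto
          show "AE u in M. norm (f u * \<kappa> u w) \<le> norm (cmod (f u) * C)"
            using C(2)[OF _ elim(2)] C(1) M(2) by (intro AE_I2) (auto simp: norm_mult intro!: mult_left_mono)
        qed measurable
        have sf: "simple_function M (\<lambda>u. h (c k u) w)"
          using simple_function_compose1[OF cs, of "\<lambda>a. h a w" k] by simp
        have [measurable]: "(\<lambda>u. h (c k u) w) \<in> borel_measurable M"
          using sf by (rule borel_measurable_simple_function)
        have i3: "integrable M (\<lambda>u. f u * \<kappa> u w - h (c k u) w)"
        proof (rule Bochner_Integration.integrable_bound[OF Dint])
          show "AE u in M. norm (f u * \<kappa> u w - h (c k u) w) \<le> norm (D k u)"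
            using pt[OF _ elim(2)] D0 by (intro AE_I2) auto
        qed measurable
        from Bochner_Integration.integrable_diff[OF i1 i3] have i2: "integrable M (\<lambda>u. h (c k u) w)" by simp
        have "V w - (\<integral>u. f u * \<kappa> u w \<partial>M) = (\<integral>u. h (c k u) w - f u * \<kappa> u w \<partial>M)"
          unfolding elim(1) using i1 i2 by simp
        also have "cmod \<dots> \<le> (\<integral>u. D k u \<partial>M)"
        proof (rule norm_integral_le)
          show "integrable M (\<lambda>u. h (c k u) w - f u * \<kappa> u w)" using i1 i2 by simp
          show "norm (h (c k u) w - f u * \<kappa> u w) \<le> D k u" if "u \<in> space M" for u
            using pt[OF that elim(2)] by (simp add: norm_minus_commute)
        qed (rule Dint)
        finally show ?case .
      qed
      moreover have "0 \<le> (\<integral>u. D k u \<partial>M)" using D0 by (intro integral_nonneg_AE AE_I2)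
      moreover have "(\<lambda>w. V w - (\<integral>u. f u * \<kappa> u w \<partial>M)) \<in> borel_measurable T"
        by (intro borel_measurable_diff Lp_fun_measurable[OF V(1)] Lp_fun_measurable[OF G])
      ultimately have "Lp_norm T q (\<lambda>w. V w - (\<integral>u. f u * \<kappa> u w \<partial>M)) \<le> (\<integral>u. D k u \<partial>M) * Q"
        unfolding Q_def using q by (intro Lp_fun_bounded[OF T]) auto
      then show "nrm ?E (simple_integral_into M ?E (s k) \<ominus>\<^bsub>?E\<^esub> Lp_class T q (\<lambda>w. \<integral>u. f u * \<kappa> u w \<partial>M)) \<le> (\<integral>u. D k u \<partial>M) * Q"
        unfolding V(2) using q V(1) G by (simp add: Lp_space_minus Lp_space_nrm Lp_fun_diff)
    qed
    have "(\<lambda>k. (\<integral>u. D k u \<partial>M) * Q) \<longlonglongrightarrow> 0 * Q" by (intro tendsto_intros DintLim)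
    then show "(\<lambda>k. (\<integral>u. D k u \<partial>M) * Q) \<longlonglongrightarrow> 0" by simp
  qed (simp add: nrm0)
  have "has_integral_into M ?E g (Lp_class T q (\<lambda>w. \<integral>u. f u * \<kappa> u w \<partial>M))"
    unfolding has_integral_into_def
  proof (intro conjI exI[of _ s] allI ss sm lim1 lim2)
    show "Lp_class T q (\<lambda>w. \<integral>u. f u * \<kappa> u w \<partial>M) \<in> carrier ?E"
      unfolding Lp_space_carrier using G by blast
    show "emeasure M {x \<in> space M. s k x \<noteq> \<zero>\<^bsub>?E\<^esub>} < \<infinity>" for k
      using M.emeasure_finite by (simp add: less_top[symmetric])
  qed
  then show ?thesis by (simp add: g_def[abs_def])
qed

section \<open>The tent operator\<close>

text \<open>The Bergman projection. The tent operator at \<open>z\<close> is its composition with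
  phi_z, so regularity in \<open>z\<close> and \<open>w\<close> together reduces to continuity of
  one function on the ball.\<close>

definition bergman_proj :: "real \<Rightarrow> (complex ^ 'n \<Rightarrow> complex) \<Rightarrow> complex ^ 'n \<Rightarrow> complex" where
  "bergman_proj \<alpha> f a = (\<integral>u. f u * (1 - cinner a u) powr (- complex_of_real (real CARD('n) + 1 + \<alpha>)) \<partial>vol_weighted \<alpha>)"

lemma T_tent_bergman_proj: "T_tent \<alpha> \<gamma> q f z = Lp_class (tent_measure \<gamma>) q (\<lambda>w. bergman_proj \<alpha> f (ball_aut z w))"
  by (simp add: T_tent_eq bergman_proj_def tent_kernel_def)

text \<open>On a smaller ball of radius r the real part of 1 - <a,u> is at least 1 - r, so the
  kernel is Lipschitz in \<open>a\<close> uniformly in \<open>u\<close>, and so is its integral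
  against \<open>f\<close>.\<close>

lemma continuous_on_bergman_proj:
  fixes f :: "complex ^ 'n \<Rightarrow> complex"
  assumes \<alpha>: "\<alpha> > -1" and f: "integrable (vol_weighted \<alpha>) f"
  shows "continuous_on (ball 0 1) (bergman_proj \<alpha> f)"
proof -
  let ?M = "vol_weighted \<alpha> :: (complex ^ 'n) measure" and ?N = "real CARD('n) + 1 + \<alpha>"
  let ?k = "\<lambda>a u :: complex ^ 'n. (1 - cinner a u) powr (- complex_of_real ?N)"
  note [measurable] = borel_measurable_integrable[OF f]
  have km: "?k a \<in> borel_measurable ?M" if a: "norm a < 1" for a
    unfolding measurable_weighted_eq
    by (intro borel_measurable_continuous_on_restrict continuous_on_powr_halfplane continuous_intros one_minus_cinner_bounds(4))
      (use a in auto)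
  have lip: "continuous_on (ball 0 r) (bergman_proj \<alpha> f)" if r: "r < 1" for r
  proof -
    have re: "1 - r \<le> Re (1 - cinner a u)" if a: "norm a \<le> r" and u: "norm u < 1" for a u :: "complex ^ 'n"
    proof -
      have "Re (cinner a u) \<le> cmod (cinner a u)" by (rule complex_Re_le_cmod)
      also have "\<dots> \<le> norm a * norm u" by (rule cinner_cauchy_schwarz)
      also have "\<dots> \<le> norm a" using u by (simp add: mult_left_le)
      finally show ?thesis using a by simp
    qed
    have int: "integrable ?M (\<lambda>u. f u * ?k a u)" if a: "norm a < r" for a
    proof (rule Bochner_Integration.integrable_bound[of ?M "\<lambda>u. cmod (f u) * (1 - r) powr (- ?N)"])
      show "integrable ?M (\<lambda>u. cmod (f u) * (1 - r) powr (- ?N))" using f by auto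
      have [measurable]: "?k a \<in> borel_measurable ?M" using a r by (intro km) linarith
      show "(\<lambda>u. f u * ?k a u) \<in> borel_measurable ?M" by measurable
      show "AE u in ?M. norm (f u * ?k a u) \<le> norm (cmod (f u) * (1 - r) powr (- ?N))"
      proof (rule AE_I2)
        fix u assume "u \<in> space ?M"
        then have u: "norm u < 1" by simp
        have "1 - r \<le> cmod (1 - cinner a u)"
          using re[OF less_imp_le[OF a] u] complex_Re_le_cmod[of "1 - cinner a u"] by linarith
        then have "cmod (?k a u) \<le> (1 - r) powr (- ?N)"
          using r \<alpha> by (subst cmod_powr_neg_of_real) (auto intro!: powr_mono2')
        then show "norm (f u * ?k a u) \<le> norm (cmod (f u) * (1 - r) powr (- ?N))"
          by (simp add: norm_mult mult_left_mono)
      qed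
    qed
    define L where "L = ?N * (1 - r) powr (- ?N - 1) * (\<integral>u. cmod (f u) \<partial>?M)"
    have "L-lipschitz_on (ball 0 r) (bergman_proj \<alpha> f)"
    proof (rule lipschitz_onI)
      show "0 \<le> L" using \<alpha> unfolding L_def by (intro mult_nonneg_nonneg integral_nonneg_AE AE_I2) auto
      fix a b :: "complex ^ 'n" assume "a \<in> ball 0 r" "b \<in> ball 0 r"
      then have ab: "norm a < r" "norm b < r" by auto
      have "bergman_proj \<alpha> f a - bergman_proj \<alpha> f b = (\<integral>u. f u * ?k a u - f u * ?k b u \<partial>?M)"
        unfolding bergman_proj_def by (rule Bochner_Integration.integral_diff[symmetric]) (intro int ab)+
      also have "cmod \<dots> \<le> (\<integral>u. ?N * (1 - r) powr (- ?N - 1) * norm (a - b) * cmod (f u) \<partial>?M)"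
      proof (rule norm_integral_le)
        show "integrable ?M (\<lambda>u. f u * ?k a u - f u * ?k b u)" by (intro Bochner_Integration.integrable_diff int ab)
        show "integrable ?M (\<lambda>u. ?N * (1 - r) powr (- ?N - 1) * norm (a - b) * cmod (f u))"
          using f by (intro integrable_mult_right integrable_norm)
        fix u assume "u \<in> space ?M"
        then have u: "norm u < 1" by simp
        have "cmod (?k a u - ?k b u) \<le> ?N * (1 - r) powr (- ?N - 1) * cmod ((1 - cinner a u) - (1 - cinner b u))"
          using r \<alpha> ab u by (intro powr_neg_lipschitz_halfplane re) auto
        also have "cmod ((1 - cinner a u) - (1 - cinner b u)) = cmod (cinner (a - b) u)"
          by (simp add: cinner_simps norm_minus_commute)
        also have "?N * (1 - r) powr (- ?N - 1) * \<dots> \<le> ?N * (1 - r) powr (- ?N - 1) * norm (a - b)"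
        proof (intro mult_left_mono)
          have "cmod (cinner (a - b) u) \<le> norm (a - b) * norm u" by (rule cinner_cauchy_schwarz)
          also have "\<dots> \<le> norm (a - b)" using u by (simp add: mult_left_le)
          finally show "cmod (cinner (a - b) u) \<le> norm (a - b)" .
        qed (use \<alpha> in simp)
        finally have le: "cmod (?k a u - ?k b u) \<le> ?N * (1 - r) powr (- ?N - 1) * norm (a - b)" .
        have "norm (f u * ?k a u - f u * ?k b u) = cmod (?k a u - ?k b u) * cmod (f u)"
          unfolding right_diff_distrib[symmetric] norm_mult by (rule mult.commute)
        also have "\<dots> \<le> ?N * (1 - r) powr (- ?N - 1) * norm (a - b) * cmod (f u)"
          by (rule mult_right_mono[OF le]) simp
        finally show "norm (f u * ?k a u - f u * ?k b u) \<le> ?N * (1 - r) powr (- ?N - 1) * norm (a - b) * cmod (f u)" .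
      qed
      also have "\<dots> = L * norm (a - b)" by (simp add: L_def)
      finally show "dist (bergman_proj \<alpha> f a) (bergman_proj \<alpha> f b) \<le> L * dist a b" by (simp add: dist_norm)
    qed
    then show ?thesis by (rule lipschitz_on_continuous_on)
  qed
  show ?thesis
  proof (intro continuous_at_imp_continuous_on ballI)
    fix a :: "complex ^ 'n" assume "a \<in> ball 0 1"
    then have a: "norm a < 1" by simp
    have "continuous_on (ball 0 ((1 + norm a) / 2)) (bergman_proj \<alpha> f)" by (rule lip) (use a in simp)
    then show "isCont (bergman_proj \<alpha> f) a"
      using a by (subst (asm) continuous_on_eq_continuous_at) auto
  qed
qed

lemma cmod_bergman_proj_aut_le:
  fixes f :: "complex ^ 'n \<Rightarrow> complex"
  assumes \<alpha>: "\<alpha> > -1" and f: "integrable (vol_weighted \<alpha>) f" and z: "norm z < 1" and w: "norm w \<le> R" and R: "R < 1"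
  shows "cmod (bergman_proj \<alpha> f (ball_aut z w)) \<le> (2 / (1 - R)) powr (real CARD('n) + 1 + \<alpha>) * abs_bergman \<alpha> f z"
proof -
  let ?M = "vol_weighted \<alpha> :: (complex ^ 'n) measure" and ?B = "(2 / (1 - R)) powr (real CARD('n) + 1 + \<alpha>)"
  have w1: "norm w < 1" using w R by linarith
  note [measurable] = borel_measurable_integrable[OF f]
  have [measurable]: "(\<lambda>u. tent_kernel \<alpha> z u w) \<in> borel_measurable ?M"
    unfolding measurable_weighted_eq
    by (intro borel_measurable_continuous_on_restrict continuous_on_tent_kernel continuous_intros) (use z w1 in auto)
  have int: "integrable ?M (\<lambda>u. abs_kernel \<alpha> z u * cmod (f u))"
    by (intro integrable_abs_kernel \<alpha> z integrable_norm f)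
  have le: "cmod (f u * tent_kernel \<alpha> z u w) \<le> ?B * (abs_kernel \<alpha> z u * cmod (f u))" if "u \<in> space ?M" for u
  proof -
    have "cmod (f u) * cmod (tent_kernel \<alpha> z u w) \<le> cmod (f u) * (?B * abs_kernel \<alpha> z u)"
      using that by (intro mult_left_mono cmod_tent_kernel_le \<alpha> z w R) auto
    then show ?thesis by (simp only: norm_mult ac_simps)
  qed
  have "bergman_proj \<alpha> f (ball_aut z w) = (\<integral>u. f u * tent_kernel \<alpha> z u w \<partial>?M)"
    by (simp add: bergman_proj_def tent_kernel_def)
  also have "cmod \<dots> \<le> (\<integral>u. ?B * (abs_kernel \<alpha> z u * cmod (f u)) \<partial>?M)"
  proof (rule norm_integral_le)
    show "integrable ?M (\<lambda>u. ?B * (abs_kernel \<alpha> z u * cmod (f u)))" by (intro integrable_mult_right int)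
    then show "integrable ?M (\<lambda>u. f u * tent_kernel \<alpha> z u w)"
    proof (rule Bochner_Integration.integrable_bound)
      show "AE u in ?M. norm (f u * tent_kernel \<alpha> z u w) \<le> norm (?B * (abs_kernel \<alpha> z u * cmod (f u)))"
        using le by (intro AE_I2) (simp only: real_norm_def, meson abs_ge_self order_trans)
    qed measurable
  qed (rule le)
  also have "\<dots> = ?B * abs_bergman \<alpha> f z"
    unfolding abs_bergman_def by (rule integral_mult_right_zero)
  finally show ?thesis .
qed

lemma bergman_proj_aut_Lp:
  fixes f :: "complex ^ 'n \<Rightarrow> complex"
  assumes \<gamma>: "\<gamma> > 0" and \<alpha>: "\<alpha> > -1" and q: "q > 1" and f: "integrable (vol_weighted \<alpha>) f" and z: "norm z < 1"
  shows "(\<lambda>w. bergman_proj \<alpha> f (ball_aut z w)) \<in> Lp_fun (tent_measure \<gamma>) q"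
    "Lp_norm (tent_measure \<gamma>) q (\<lambda>w. bergman_proj \<alpha> f (ball_aut z w)) \<le>
      (2 / (1 - tanh \<gamma>)) powr (real CARD('n) + 1 + \<alpha>) * abs_bergman \<alpha> f z *
      measure (tent_measure \<gamma> :: (complex ^ 'n) measure) (space (tent_measure \<gamma>)) powr (1 / q)"
proof -
  have m: "(\<lambda>w. bergman_proj \<alpha> f (ball_aut z w)) \<in> borel_measurable (tent_measure \<gamma>)"
    unfolding measurable_weighted_eq
    by (intro borel_measurable_continuous_on_restrict continuous_on_compose2[OF continuous_on_bergman_proj[OF \<alpha> f]] continuous_intros)
      (use z norm_ball_aut_less_1 in \<open>auto simp: less_imp_le\<close>)
  have c: "0 \<le> (2 / (1 - tanh \<gamma>)) powr (real CARD('n) + 1 + \<alpha>) * abs_bergman \<alpha> f z"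
    by (simp add: abs_bergman_nonneg)
  have b: "cmod (bergman_proj \<alpha> f (ball_aut z w)) \<le> (2 / (1 - tanh \<gamma>)) powr (real CARD('n) + 1 + \<alpha>) * abs_bergman \<alpha> f z" if "norm w < tanh \<gamma>" for w
    using that by (intro cmod_bergman_proj_aut_le[OF \<alpha> f z _ tanh_real_lt_1]) simp
  show "(\<lambda>w. bergman_proj \<alpha> f (ball_aut z w)) \<in> Lp_fun (tent_measure \<gamma>) q"
    "Lp_norm (tent_measure \<gamma>) q (\<lambda>w. bergman_proj \<alpha> f (ball_aut z w)) \<le>
      (2 / (1 - tanh \<gamma>)) powr (real CARD('n) + 1 + \<alpha>) * abs_bergman \<alpha> f z *
      measure (tent_measure \<gamma> :: (complex ^ 'n) measure) (space (tent_measure \<gamma>)) powr (1 / q)"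
    using tent_Lp_bound[OF \<gamma> q m c b] by auto
qed

lemma Lp_fun_integrable_complex:
  fixes f :: "complex ^ 'n \<Rightarrow> complex"
  assumes "\<alpha> > -1" "p > 1" "f \<in> Lp_fun (vol_weighted \<alpha>) p"
  shows "integrable (vol_weighted \<alpha>) f"
  using Lp_fun_integrable_vol_weighted[OF assms] Lp_fun_measurable[OF assms(3)] by (simp add: integrable_norm_iff)

text \<open>The Bochner integral exists at every point of the ball: for fixed \<open>z\<close> the
  kernel is bounded and Lipschitz in \<open>u\<close> uniformly over |w| < tanh \<gamma>, and
  \<open>f\<close> is integrable because dv_\<alpha> is finite.\<close>

lemma bergman_sio_T_tent:
  assumes \<gamma>: "\<gamma> > 0" and \<alpha>: "\<alpha> > -1" and q: "q > 1"
  shows "bergman_sio \<alpha> (Lp_space (tent_measure \<gamma> :: (complex ^ 'n) measure) q) (K_tent \<alpha> \<gamma> q) (T_tent \<alpha> \<gamma> q)"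
  unfolding bergman_sio_def
proof (intro conjI allI impI ballI AE_I2)
  let ?T = "tent_measure \<gamma> :: (complex ^ 'n) measure" and ?M = "vol_weighted \<alpha> :: (complex ^ 'n) measure"
  show "complex_banach_space (Lp_space ?T q)" using q by (intro complex_banach_space_Lp_space) simp
  show "bergman_kernel \<alpha> (Lp_space ?T q) (K_tent \<alpha> \<gamma> q)" by (rule bergman_kernel_K_tent[OF \<gamma> \<alpha> q])
  fix p :: real and f :: "complex ^ 'n \<Rightarrow> complex" and z
  assume p: "1 < p" and f: "f \<in> Lp_fun ?M p" and "z \<in> space ?M"
  then have z: "norm z < 1" by simp
  have fi: "integrable ?M f" using Lp_fun_integrable_complex[OF \<alpha> p f] .
  obtain C where C: "C > 0" "\<And>u w. norm u < 1 \<Longrightarrow> norm w \<le> tanh \<gamma> \<Longrightarrow> cmod (tent_kernel \<alpha> z u w) \<le> C"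
    using tent_kernel_bounded[OF \<alpha> z tanh_real_lt_1] by blast
  obtain L where L: "L \<ge> 0" "\<And>u v w. norm u < 1 \<Longrightarrow> norm v < 1 \<Longrightarrow> norm w \<le> tanh \<gamma> \<Longrightarrow>
    cmod (tent_kernel \<alpha> z u w - tent_kernel \<alpha> z v w) \<le> L * norm (u - v)"
    using tent_kernel_lipschitz[OF \<alpha> z tanh_real_lt_1] by blast
  show "has_integral_into ?M (Lp_space ?T q) (\<lambda>w. f w \<odot>\<^bsub>Lp_space ?T q\<^esub> K_tent \<alpha> \<gamma> q z w) (T_tent \<alpha> \<gamma> q f z)"
    unfolding K_tent_eq T_tent_eq
  proof (rule has_integral_into_Lp_space[where S = "{w. norm w < tanh \<gamma>}"])
    show "finite_measure ?M" by (rule finite_measure_vol_weighted[OF \<alpha>])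
    show "finite_measure ?T" by (rule finite_measure_tent[OF \<gamma>])
    show "AE w in ?T. w \<in> {w. norm w < tanh \<gamma>}" using tent_measure_AE[OF \<gamma>] by simp
    show "(\<lambda>u. tent_kernel \<alpha> z u w) \<in> borel_measurable ?M" if "w \<in> {w. norm w < tanh \<gamma>}" for w
      unfolding measurable_weighted_eq
      by (intro borel_measurable_continuous_on_restrict continuous_on_tent_kernel continuous_intros)
        (use z that tanh_real_lt_1[of \<gamma>] in auto)
    show "(\<lambda>w. \<integral>u. f u * tent_kernel \<alpha> z u w \<partial>?M) \<in> Lp_fun ?T q"
      using bergman_proj_aut_Lp(1)[OF \<gamma> \<alpha> q fi z] by (simp add: bergman_proj_def tent_kernel_def)
    show "cmod (tent_kernel \<alpha> z u w) \<le> C" if "norm u < 1" "w \<in> {w. norm w < tanh \<gamma>}" for u w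
      using that C(2) by auto
    show "cmod (tent_kernel \<alpha> z u w - tent_kernel \<alpha> z v w) \<le> L * norm (u - v)"
      if "norm u < 1" "norm v < 1" "w \<in> {w. norm w < tanh \<gamma>}" for u v w
      using that L(2) by auto
  qed (use q C(1) L(1) z fi in \<open>auto intro: tent_kernel_measurable borel_measurable_id_weighted\<close>)
qed

text \<open>The map is continuous in \<open>z\<close> with respect to the norm of E, by joint
  continuity and compactness in \<open>w\<close>; composing it with simple approximations of the
  identity gives the approximating functions.\<close>

lemma strongly_measurable_T_tent:
  fixes f :: "complex ^ 'n \<Rightarrow> complex"
  assumes \<gamma>: "\<gamma> > 0" and \<alpha>: "\<alpha> > -1" and q: "q > 1" and f: "integrable (vol_weighted \<alpha>) f"
  shows "strongly_measurable (vol_weighted \<alpha>) (Lp_space (tent_measure \<gamma>) q) (T_tent \<alpha> \<gamma> q f)"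
proof -
  let ?T = "tent_measure \<gamma> :: (complex ^ 'n) measure" and ?M = "vol_weighted \<alpha> :: (complex ^ 'n) measure"
  let ?E = "Lp_space ?T q"
  let ?h = "\<lambda>z w. bergman_proj \<alpha> f (ball_aut z w)"
  define Q where "Q = measure ?T (space ?T) powr (1 / q)"
  have Q: "0 \<le> Q" by (simp add: Q_def)
  have hL: "?h z \<in> Lp_fun ?T q" if "norm z < 1" for z by (rule bergman_proj_aut_Lp(1)[OF \<gamma> \<alpha> q f that])
  obtain P where P: "\<And>k. simple_function ?M (P k)" "\<And>k u. norm (P k u) < 1"
    "\<And>u. u \<in> space ?M \<Longrightarrow> (\<lambda>k::nat. P k u) \<longlonglongrightarrow> u"
    using simple_approximation_ball[of ?M] borel_measurable_id_weighted(1)[of \<alpha>, where 'n='n] by auto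
  show ?thesis
    unfolding strongly_measurable_def
  proof (intro exI[of _ "\<lambda>k u. T_tent \<alpha> \<gamma> q f (P k u)"] conjI allI AE_I2)
    show "simple_into ?M ?E (\<lambda>u. T_tent \<alpha> \<gamma> q f (P k u))" for k
      unfolding simple_into_def T_tent_bergman_proj Lp_space_carrier
      using simple_function_compose1[OF P(1), of "\<lambda>z. Lp_class ?T q (?h z)"] hL[OF P(2)] by auto
    fix z assume "z \<in> space ?M"
    then have z: "z \<in> space ?M" "norm z < 1" by auto
    show "T_tent \<alpha> \<gamma> q f z \<in> carrier ?E"
      unfolding T_tent_bergman_proj Lp_space_carrier using hL[OF z(2)] by blast
    show "(\<lambda>k. nrm ?E (T_tent \<alpha> \<gamma> q f (P k z) \<ominus>\<^bsub>?E\<^esub> T_tent \<alpha> \<gamma> q f z)) \<longlonglongrightarrow> 0"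
    proof (rule tendstoI)
      fix e :: real assume e: "e > 0"
      define e' where "e' = e / 2 / (Q + 1)"
      have e': "e' > 0" using e Q by (simp add: e'_def)
      have R: "tanh \<gamma> < 1" by (rule tanh_real_lt_1)
      have "continuous_on (ball 0 1 \<times> cball 0 (tanh \<gamma>)) (\<lambda>x. ?h (fst x) (snd x))"
        by (intro continuous_on_compose2[OF continuous_on_bergman_proj[OF \<alpha> f]] continuous_intros)
          (use R in \<open>auto intro!: norm_ball_aut_less_1\<close>)
      then obtain X where X: "z \<in> X" "open X"
        "\<forall>x\<in>X \<inter> ball 0 1. \<forall>t\<in>cball 0 (tanh \<gamma>). dist (?h x t) (?h z t) \<le> e'"
        using continuous_on_prod_compactE[of "ball 0 1" "cball 0 (tanh \<gamma>)" "\<lambda>x. ?h (fst x) (snd x)" z e'] e' z by auto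
      have "\<forall>\<^sub>F k in sequentially. P k z \<in> X"
        by (rule topological_tendstoD[OF P(3)[OF z(1)] X(2,1)])
      then show "\<forall>\<^sub>F k in sequentially. dist (nrm ?E (T_tent \<alpha> \<gamma> q f (P k z) \<ominus>\<^bsub>?E\<^esub> T_tent \<alpha> \<gamma> q f z)) 0 < e"
      proof eventually_elim
        case (elim k)
        note l = hL[OF P(2)[of k z]] hL[OF z(2)]
        have "nrm ?E (T_tent \<alpha> \<gamma> q f (P k z) \<ominus>\<^bsub>?E\<^esub> T_tent \<alpha> \<gamma> q f z) = Lp_norm ?T q (\<lambda>w. ?h (P k z) w - ?h z w)"
          unfolding T_tent_bergman_proj using q l by (simp add: Lp_space_minus Lp_space_nrm Lp_fun_diff)
        also have "\<dots> \<le> e' * Q"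
          unfolding Q_def
        proof (rule tent_Lp_bound(2)[OF \<gamma> q])
          show "(\<lambda>w. ?h (P k z) w - ?h z w) \<in> borel_measurable ?T"
            using l by (intro borel_measurable_diff Lp_fun_measurable)
          show "cmod (?h (P k z) w - ?h z w) \<le> e'" if "norm w < tanh \<gamma>" for w
            using X(3)[rule_format, of "P k z" w] elim P(2)[of k z] that by (simp add: dist_norm)
        qed (use e' in simp)
        also have "e' * Q < e"
        proof -
          have "e' * (Q + 1) = e / 2" by (rule iffD1[OF nonzero_eq_divide_eq e'_def]) (use Q in simp)
          then show ?thesis using e e' by (simp add: distrib_left)
        qed
        finally show ?case by (simp add: Lp_space_def Lp_norm_nonneg)
      qed
    qed
  qed
qed

text \<open>The norm of T f(z) in E is at most a constant times
  \<open>abs_bergman \<alpha> f z\<close>, so boundedness for each exponent p > 1 follows from that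
  of the positive operator.\<close>

lemma T_tent_BIO:
  assumes \<gamma>: "\<gamma> > 0" and \<alpha>: "\<alpha> > -1" and q: "q > 1"
  shows "(T_tent \<alpha> \<gamma> q :: (complex ^ 'n \<Rightarrow> complex) \<Rightarrow> _) \<in> BIO \<alpha> (Lp_space (tent_measure \<gamma> :: (complex ^ 'n) measure) q)"
proof -
  let ?T = "tent_measure \<gamma> :: (complex ^ 'n) measure" and ?M = "vol_weighted \<alpha> :: (complex ^ 'n) measure"
  let ?E = "Lp_space ?T q"
  define K where "K = (2 / (1 - tanh \<gamma>)) powr (real CARD('n) + 1 + \<alpha>) * measure ?T (space ?T) powr (1 / q)"
  have K: "K \<ge> 0" by (simp add: K_def)
  have "\<exists>C. \<forall>f\<in>Lp_fun ?M p. T_tent \<alpha> \<gamma> q f \<in> Bochner_Lp ?M p ?E \<and>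
      Bochner_Lp_norm ?M p ?E (T_tent \<alpha> \<gamma> q f) \<le> C * Lp_norm ?M p f" if p: "p > 1" for p
  proof -
    obtain C3 where C3: "C3 > 0" "\<And>f :: complex ^ 'n \<Rightarrow> complex. f \<in> Lp_fun ?M p \<Longrightarrow>
        (\<integral>\<^sup>+z. ennreal (abs_bergman \<alpha> f z powr p) \<partial>?M) \<le> ennreal (C3 * Lp_norm ?M p f powr p)"
      using abs_bergman_bounded[OF \<alpha> p] by blast
    let ?C = "K * C3 powr (1 / p)"
    show ?thesis
    proof (intro exI[of _ ?C] ballI)
      fix f :: "complex ^ 'n \<Rightarrow> complex" assume f: "f \<in> Lp_fun ?M p"
      have fi: "integrable ?M f" by (rule Lp_fun_integrable_complex[OF \<alpha> p f])
      have "(\<integral>\<^sup>+z. ennreal (nrm ?E (T_tent \<alpha> \<gamma> q f z) powr p) \<partial>?M) \<le> (\<integral>\<^sup>+z. ennreal (K powr p) * ennreal (abs_bergman \<alpha> f z powr p) \<partial>?M)"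
      proof (rule nn_integral_mono)
        fix z assume "z \<in> space ?M"
        then have z: "norm z < 1" by simp
        note h = bergman_proj_aut_Lp[OF \<gamma> \<alpha> q fi z]
        have "nrm ?E (T_tent \<alpha> \<gamma> q f z) \<le> K * abs_bergman \<alpha> f z"
          unfolding T_tent_bergman_proj Lp_space_nrm[OF h(1)] using h(2) by (simp add: K_def ac_simps)
        moreover have "0 \<le> nrm ?E (T_tent \<alpha> \<gamma> q f z)" by (simp add: Lp_space_def Lp_norm_nonneg)
        ultimately have "nrm ?E (T_tent \<alpha> \<gamma> q f z) powr p \<le> (K * abs_bergman \<alpha> f z) powr p"
          using p by (intro powr_mono2) auto
        also have "\<dots> = K powr p * abs_bergman \<alpha> f z powr p" by (rule powr_mult)
        finally show "ennreal (nrm ?E (T_tent \<alpha> \<gamma> q f z) powr p) \<le> ennreal (K powr p) * ennreal (abs_bergman \<alpha> f z powr p)"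
          by (subst ennreal_mult[symmetric]) (auto intro: ennreal_leI)
      qed
      also have "\<dots> = ennreal (K powr p) * (\<integral>\<^sup>+z. ennreal (abs_bergman \<alpha> f z powr p) \<partial>?M)"
        using abs_bergman_measurable[OF \<alpha> Lp_fun_measurable[OF f]] by (intro nn_integral_cmult) measurable
      also have "\<dots> \<le> ennreal (K powr p) * ennreal (C3 * Lp_norm ?M p f powr p)"
        by (intro mult_left_mono C3 f) simp
      also have "\<dots> = ennreal ((?C * Lp_norm ?M p f) powr p)"
        using C3(1) K p Lp_norm_nonneg[of ?M p f] by (subst ennreal_mult[symmetric]) (auto simp: powr_mult powr_powr mult.assoc)
      finally have le: "(\<integral>\<^sup>+z. ennreal (nrm ?E (T_tent \<alpha> \<gamma> q f z) powr p) \<partial>?M) \<le> ennreal ((?C * Lp_norm ?M p f) powr p)" .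
      have c0: "0 \<le> ?C * Lp_norm ?M p f" using K Lp_norm_nonneg[of ?M p f] by simp
      have "enn2real (\<integral>\<^sup>+z. ennreal (nrm ?E (T_tent \<alpha> \<gamma> q f z) powr p) \<partial>?M) powr (1 / p) \<le> ((?C * Lp_norm ?M p f) powr p) powr (1 / p)"
        using le p by (intro powr_mono2 enn2real_leI) auto
      also have "\<dots> = ?C * Lp_norm ?M p f" using p c0 by (simp add: powr_powr)
      finally have "Bochner_Lp_norm ?M p ?E (T_tent \<alpha> \<gamma> q f) \<le> ?C * Lp_norm ?M p f"
        by (simp add: Bochner_Lp_norm_def)
      moreover have "T_tent \<alpha> \<gamma> q f \<in> Bochner_Lp ?M p ?E"
        using strongly_measurable_T_tent[OF \<gamma> \<alpha> q fi] le_less_trans[OF le] by (simp add: Bochner_Lp_def)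
      ultimately show "T_tent \<alpha> \<gamma> q f \<in> Bochner_Lp ?M p ?E \<and> Bochner_Lp_norm ?M p ?E (T_tent \<alpha> \<gamma> q f) \<le> ?C * Lp_norm ?M p f" by simp
    qed
  qed
  then show ?thesis
    unfolding BIO_def using bergman_sio_T_tent[OF \<gamma> \<alpha> q] by blast
qed

theorem theorem5p2:
  fixes \<alpha> \<gamma> q p :: real
  assumes "\<gamma> > 0" and "\<alpha> > -1" and "1 < q" and "1 < p"
  shows "bergman_sio \<alpha> (Lp_space (tent_measure \<gamma> :: (complex ^ 'n) measure) q)
           (K_tent \<alpha> \<gamma> q) (T_tent \<alpha> \<gamma> q :: (complex ^ 'n \<Rightarrow> complex) \<Rightarrow> _) \<and>
         (T_tent \<alpha> \<gamma> q :: (complex ^ 'n \<Rightarrow> complex) \<Rightarrow> _) \<in>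
           BIO \<alpha> (Lp_space (tent_measure \<gamma> :: (complex ^ 'n) measure) q) \<and>
         (\<exists>C>0. \<forall>f\<in>(bergman_space \<alpha> p :: (complex ^ 'n \<Rightarrow> complex) set).
           (\<forall>z\<in>ball 0 1.
             set_integrable inv_measure (bergman_ball z \<gamma>) (\<lambda>w. cmod (f w) powr q)) \<and>
           area_fun q \<gamma> f \<in> Lp_fun (vol_weighted \<alpha>) p \<and>
           Lp_norm (vol_weighted \<alpha>) p (area_fun q \<gamma> f) \<le> C * Lp_norm (vol_weighted \<alpha>) p f)"
  using bergman_sio_T_tent[OF assms(1-3)] T_tent_BIO[OF assms(1-3)] area_fun_bounded[OF assms] by blast

end
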